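(* Let $(X,Y)$ be a bivariate normal random vector with mean vector $(\mu_X,\mu_Y)\in\mathbb{R}^2$, variances $(\sigma_X^2,\sigma_Y^2)\in(0,\infty)^2$ (with $\sigma_X,\sigma_Y>0$) and correlation coefficient $\rho\in(-1,1)$. Let $Z=XY$, let $n\geq1$ be an integer, let $Z_1,\ldots,Z_n$ be independent copies of $Z$, and let $S_n=\sum_{i=1}^n Z_i$. Then the probability density function (PDF) of $S_n$ is given, for $x\in\mathbb{R}$, by \begin{align*} f_{S_n}(x)&=\frac{(1-\rho^2)^{n/2-1}}{2^{n-1}\sigma_X\sigma_Y}\exp\bigg(-\frac{n}{2(1-\rho^2)}\bigg(\frac{\mu_X^2}{\sigma_X^2}+\frac{\mu_Y^2}{\sigma_Y^2}-\frac{2\rho\mu_X\mu_Y}{\sigma_X\sigma_Y}\bigg)-\frac{|x|}{\sigma_X\sigma_Y(1+\rho\,\mathrm{sgn}(x))}\bigg)\\ &\quad\times\sum_{k=0}^\infty\sum_{j=0}^k\frac{(n/8)^k}{k!\,\Gamma(n/2+a_{j,k}(x))}\binom{k}{j} \bigg(\frac{1+\rho}{1-\rho}\bigg)^j\bigg(\frac{\mu_X}{\sigma_X}-\frac{\mu_Y}{\sigma_Y}\bigg)^{2j} \bigg(\frac{1-\rho}{1+\rho}\bigg)^{k-j}\\ &\quad\times \bigg(\frac{\mu_X}{\sigma_X}+\frac{\mu_Y}{\sigma_Y}\bigg)^{2k-2j} U\bigg(1-\frac{n}{2}-a_{j,k}(x),\,2-n-k,\,\frac{2|x|}{\sigma_X\sigma_Y(1-\rho^2)}\bigg).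 \end{align*}
   Context: $\mathrm{sgn}(x)=1$ for $x>0$, $\mathrm{sgn}(0)=0$, $\mathrm{sgn}(x)=-1$ for $x<0$. For integers $0\le j\le k$, $a_{j,k}(x)=k-j$ if $x\geq0$ and $a_{j,k}(x)=j$ if $x<0$. The convention $0^0=1$ is used. $U(a,b,x)$ is the (Tricomi) confluent hypergeometric function of the second kind: for $x>0$ and $b\notin\mathbb{Z}$, $$U(a,b,x)=\frac{\Gamma(b-1)}{\Gamma(a)}x^{1-b}{}_1F_1(a-b+1;2-b;x)+\frac{\Gamma(1-b)}{\Gamma(a-b+1)}{}_1F_1(a;b;x),$$ where $1/\Gamma$ is taken to be $0$ at the poles of $\Gamma$ and ${}_1F_1(a;b;x)=\sum_{j\ge0}\frac{(a)_j}{(b)_j}\frac{x^j}{j!}$ with $(u)_j=u(u+1)\cdots(u+j-1)$; for $b\in\mathbb{Z}$, $U(a,b,x)=\lim_{\beta\to b}U(a,\beta,x)$. The value $U(a,b,0)$ means $\lim_{x\to0^+}U(a,b,x)$ (so for $n=1$ the formula gives the value $+\infty$ at $x=0$). *)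

theory Defs
  imports "HOL-Probability.Probability"
begin

text \<open>The bivariate normal law. The parameters \<open>\<sigma>X, \<sigma>Y\<close> are standard deviations (not variances);
  the density is the usual one for \<open>\<sigma>X, \<sigma>Y > 0\<close> and \<open>-1 < \<rho> < 1\<close>, the only case in which it is
  used.\<close>

definition bivariate_normal_density ::
    "real \<Rightarrow> real \<Rightarrow> real \<Rightarrow> real \<Rightarrow> real \<Rightarrow> real \<Rightarrow> real \<Rightarrow> real" where
  "bivariate_normal_density \<mu>X \<mu>Y \<sigma>X \<sigma>Y \<rho> x y =
     1 / (2 * pi * \<sigma>X * \<sigma>Y * sqrt (1 - \<rho>\<^sup>2)) *
     exp (- (1 / (2 * (1 - \<rho>\<^sup>2))) *
       (((x - \<mu>X) / \<sigma>X)\<^sup>2 - 2 * \<rho> * ((x - \<mu>X) / \<sigma>X) * ((y - \<mu>Y) / \<sigma>Y) + ((y - \<mu>Y) / \<sigma>Y)\<^sup>2))"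

definition bivariate_normal ::
    "'a measure \<Rightarrow> ('a \<Rightarrow> real) \<Rightarrow> ('a \<Rightarrow> real) \<Rightarrow> real \<Rightarrow> real \<Rightarrow> real \<Rightarrow> real \<Rightarrow> real \<Rightarrow> bool" where
  "bivariate_normal M X Y \<mu>X \<mu>Y \<sigma>X \<sigma>Y \<rho> \<longleftrightarrow>
     distributed M (lborel \<Otimes>\<^sub>M lborel) (\<lambda>\<omega>. (X \<omega>, Y \<omega>))
       (\<lambda>(x, y). ennreal (bivariate_normal_density \<mu>X \<mu>Y \<sigma>X \<sigma>Y \<rho> x y))"

definition hypergeom_1F1 :: "real \<Rightarrow> real \<Rightarrow> real \<Rightarrow> real" where
  "hypergeom_1F1 a b x = (\<Sum>j. pochhammer a j / pochhammer b j * x ^ j / fact j)"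

text \<open>Tricomi's function for \<open>x > 0\<close>: first for non-integer \<open>b\<close>, then extended to integer \<open>b\<close> as a
  limit. The entire function \<open>rGamma\<close> is \<open>1 / \<Gamma>\<close>, with value \<open>0\<close> at the poles of \<open>\<Gamma>\<close>.\<close>

definition tricomi_U_nonint :: "real \<Rightarrow> real \<Rightarrow> real \<Rightarrow> real" where
  "tricomi_U_nonint a b x =
     Gamma (b - 1) * rGamma a * x powr (1 - b) * hypergeom_1F1 (a - b + 1) (2 - b) x +
     Gamma (1 - b) * rGamma (a - b + 1) * hypergeom_1F1 a b x"

definition tricomi_U_pos :: "real \<Rightarrow> real \<Rightarrow> real \<Rightarrow> real" where
  "tricomi_U_pos a b x =
     (if b \<in> \<int> then Lim (at b) (\<lambda>\<beta>. tricomi_U_nonint a \<beta> x) else tricomi_U_nonint a b x)"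

text \<open>The value at \<open>x = 0\<close> is the right-hand limit, taken in the extended reals because it can be
  infinite, e.g. for \<open>a = 1/2\<close> and \<open>b = 1\<close>. Negative \<open>x\<close> are not meaningful.\<close>

definition tricomi_U :: "real \<Rightarrow> real \<Rightarrow> real \<Rightarrow> ereal" where
  "tricomi_U a b x =
     (if x = 0 then Lim (at_right 0) (\<lambda>t. ereal (tricomi_U_pos a b t))
      else ereal (tricomi_U_pos a b x))"

definition a_idx :: "nat \<Rightarrow> nat \<Rightarrow> real \<Rightarrow> nat" where
  "a_idx j k x = (if x \<ge> 0 then k - j else j)"

text \<open>The series is a series of extended reals; only the Tricomi function, and only at \<open>x = 0\<close>, can
  contribute an infinite value.\<close>

definition sum_normal_products_pdf ::
    "nat \<Rightarrow> real \<Rightarrow> real \<Rightarrow> real \<Rightarrow> real \<Rightarrow> real \<Rightarrow> real \<Rightarrow> ereal" where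
  "sum_normal_products_pdf n \<mu>X \<mu>Y \<sigma>X \<sigma>Y \<rho> x =
     ereal ((1 - \<rho>\<^sup>2) powr (real n / 2 - 1) / (2 ^ (n - 1) * \<sigma>X * \<sigma>Y) *
       exp (- (real n / (2 * (1 - \<rho>\<^sup>2))) *
              (\<mu>X\<^sup>2 / \<sigma>X\<^sup>2 + \<mu>Y\<^sup>2 / \<sigma>Y\<^sup>2 - 2 * \<rho> * \<mu>X * \<mu>Y / (\<sigma>X * \<sigma>Y))
            - \<bar>x\<bar> / (\<sigma>X * \<sigma>Y * (1 + \<rho> * sgn x)))) *
     (\<Sum>k. \<Sum>j=0..k.
        ereal ((real n / 8) ^ k / (fact k * Gamma (real n / 2 + real (a_idx j k x))) *
          real (k choose j) *
          ((1 + \<rho>) / (1 - \<rho>)) ^ j * (\<mu>X / \<sigma>X - \<mu>Y / \<sigma>Y) ^ (2 * j) *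
          ((1 - \<rho>) / (1 + \<rho>)) ^ (k - j) * (\<mu>X / \<sigma>X + \<mu>Y / \<sigma>Y) ^ (2 * k - 2 * j)) *
        tricomi_U (1 - real n / 2 - real (a_idx j k x)) (2 - real n - real k)
          (2 * \<bar>x\<bar> / (\<sigma>X * \<sigma>Y * (1 - \<rho>\<^sup>2))))"

end

theory Submission
  imports Defs "HOL-Real_Asymp.Real_Asymp"
begin

text \<open>Put \<open>x = k (u + v)\<close>, \<open>y = (u - v) / k\<close> with \<open>k\<^sup>2 = \<sigma>X / \<sigma>Y\<close>. In the new coordinates the two normal
  components are independent and \<open>x y = u\<^sup>2 - v\<^sup>2\<close>. The square of a normal variable is a Poisson mixture of
  Gamma variables of shapes \<open>1/2 + i\<close>, and such mixtures are stable under convolution; hence \<open>S\<^sub>n\<close> is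
  distributed as the difference of two independent noncentral Gamma variables of shape \<open>n / 2\<close>.
  Expanding both mixtures, the density of \<open>S\<^sub>n\<close> becomes a double series of integrals
  \<open>\<integral>\<^sub>0\<^sup>\<infinity> (z + t) powr (\<alpha> - 1) * t powr (\<beta> - 1) * exp (- t) dt\<close>, and each of them is
  \<open>\<Gamma>(\<beta>) U(1 - \<alpha>, 2 - \<alpha> - \<beta>, z)\<close>. Since \<open>U\<close> is defined by hypergeometric series, this last identity needs
  a proof: for \<open>0 < b < 1\<close> the integral and the two Kummer solutions satisfy the same differential
  equation, so their pairwise Wronskians are known from the behaviour at \<open>0\<close>; other non-integer \<open>b\<close> follow
  from \<open>U(a, b)' = - a U(a + 1, b + 1)\<close>, and integer \<open>b\<close> by continuity.\<close>

subsection \<open>Kummer's series\<close>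

text \<open>The parameters that occur are \<open>\<alpha> = n / 2 + a_idx j k x\<close> and
  \<open>\<beta> = n / 2 + (k - a_idx j k x)\<close>, so
  \<open>b = 2 - \<alpha> - \<beta> = 2 - n - k\<close> is always an integer, at most
  \<open>1\<close>: only limits of the non-integer formula ever enter. The value \<open>1\<close>
  occurs for \<open>n = 1\<close>, \<open>k = 0\<close> alone, but since the limit is two-sided it
  forces a treatment of \<open>1 < b < 2\<close> as well. The range \<open>0 < b < 1\<close> is the
  convenient one for Wronskians: the exponents \<open>0\<close> and \<open>1 - b\<close> of Kummer's
  equation at the origin are nonnegative, so the solutions stay bounded there, while their
  derivatives grow at most like \<open>z powr - b\<close>. Hence \<open>z powr b\<close> times each
  Wronskian has a limit that can be read off. Densities and their series live in
  \<open>ennreal\<close>. All terms are nonnegative, so sums and integrals may be exchanged freely,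
  and the pole at \<open>x = 0\<close> for \<open>n = 1\<close> is an ordinary value. Finiteness
  everywhere else is settled separately, by dominating the two mixture densities rather than the
  double series.\<close>

definition coeff_1F1 :: "real \<Rightarrow> real \<Rightarrow> nat \<Rightarrow> real" where
  "coeff_1F1 a b j = pochhammer a j / (pochhammer b j * fact j)"

lemma hypergeom_1F1_altdef: "hypergeom_1F1 a b x = (\<Sum>j. coeff_1F1 a b j * x ^ j)"
  by (simp add: hypergeom_1F1_def coeff_1F1_def)

lemma pochhammer_nonint_neq_0: "b \<notin> \<int> \<Longrightarrow> pochhammer (b::real) j \<noteq> 0"
  by (auto simp: pochhammer_eq_0_iff)

text \<open>Kept free of division because in this form it is Kummer's equation, read coefficient by
  coefficient.\<close>

lemma coeff_1F1_Suc:
  assumes "b \<notin> \<int>"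
  shows "real (Suc j) * (b + real j) * coeff_1F1 a b (Suc j) = (a + real j) * coeff_1F1 a b j"
proof -
  have "b + real j \<noteq> 0"
    using assms by (metis Ints_minus Ints_of_nat add_eq_0_iff2)
  moreover have "pochhammer b j \<noteq> 0" using assms by (rule pochhammer_nonint_neq_0)
  ultimately show ?thesis
    by (simp add: coeff_1F1_def pochhammer_Suc fact_Suc divide_simps del: of_nat_Suc)
qed

lemma coeff_1F1_ratio:
  assumes "b \<notin> \<int>"
  shows "coeff_1F1 a b (Suc j) = (a + real j) / (real (Suc j) * (b + real j)) * coeff_1F1 a b j"
proof -
  have "b + real j \<noteq> 0"
    using assms by (metis Ints_minus Ints_of_nat add_eq_0_iff2)
  then have "real (Suc j) * (b + real j) \<noteq> 0" by (simp del: of_nat_Suc)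
  with coeff_1F1_Suc[OF assms, of j a] show ?thesis
    by (metis nonzero_mult_div_cancel_left times_divide_eq_left)
qed

text \<open>Consecutive coefficients have a ratio of order \<open>1 / j\<close>, so the ratio test
  succeeds for every \<open>x\<close>.\<close>

lemma summable_coeff_1F1:
  assumes b: "b \<notin> \<int>"
  shows "summable (\<lambda>j. coeff_1F1 a b j * x ^ j)"
proof -
  have "(\<lambda>j. \<bar>(a + real j) / (real (Suc j) * (b + real j)) * x\<bar>) \<longlonglongrightarrow> 0"
    by (rule tendsto_rabs_zero) real_asymp
  then have "eventually (\<lambda>j. \<bar>(a + real j) / (real (Suc j) * (b + real j)) * x\<bar> < 1/2) sequentially"
    by (rule order_tendstoD) auto
  then obtain N where N: "\<And>j. j \<ge> N \<Longrightarrow> \<bar>(a + real j) / (real (Suc j) * (b + real j)) * x\<bar> < 1/2"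
    by (auto simp: eventually_sequentially)
  show ?thesis
  proof (rule summable_ratio_test[of "1/2" N])
    fix j assume "j \<ge> N"
    have "norm (coeff_1F1 a b (Suc j) * x ^ Suc j) =
      \<bar>(a + real j) / (real (Suc j) * (b + real j)) * x\<bar> * norm (coeff_1F1 a b j * x ^ j)"
      by (simp add: coeff_1F1_ratio[OF b] abs_mult abs_divide power_abs del: of_nat_Suc)
    also have "\<dots> \<le> 1/2 * norm (coeff_1F1 a b j * x ^ j)"
      using N[OF \<open>j \<ge> N\<close>] by (intro mult_right_mono) auto
    finally show "norm (coeff_1F1 a b (Suc j) * x ^ Suc j) \<le> 1/2 * norm (coeff_1F1 a b j * x ^ j)" .
  qed simp
qed

lemma diffs_coeff_1F1: "diffs (coeff_1F1 a b) = (\<lambda>j. a / b * coeff_1F1 (a + 1) (b + 1) j)"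
  by (auto simp: diffs_def coeff_1F1_def pochhammer_rec fact_Suc simp del: of_nat_Suc)

lemma hypergeom_1F1_0: "hypergeom_1F1 a b 0 = 1"
proof -
  have "(\<Sum>j. coeff_1F1 a b j * 0 ^ j) = coeff_1F1 a b 0" by (rule powser_zero)
  then show ?thesis by (simp add: hypergeom_1F1_altdef coeff_1F1_def)
qed

lemma has_field_derivative_hypergeom_1F1:
  assumes b: "b \<notin> \<int>"
  shows "(hypergeom_1F1 a b has_real_derivative a / b * hypergeom_1F1 (a + 1) (b + 1) x) (at x)"
proof -
  have b1: "b + 1 \<notin> \<int>" using b by simp
  have "((\<lambda>x. \<Sum>j. coeff_1F1 a b j * x ^ j) has_real_derivative (\<Sum>j. diffs (coeff_1F1 a b) j * x ^ j)) (at x)"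
    by (intro termdiffs_strong_converges_everywhere summable_coeff_1F1 b)
  also have "(\<Sum>j. diffs (coeff_1F1 a b) j * x ^ j) = a / b * hypergeom_1F1 (a + 1) (b + 1) x"
    unfolding diffs_coeff_1F1 hypergeom_1F1_altdef
    using suminf_mult[OF summable_coeff_1F1[OF b1], of "a / b" "a + 1" x] by (simp add: mult.assoc)
  finally show ?thesis
    by (simp add: hypergeom_1F1_altdef[abs_def])
qed

lemma continuous_hypergeom_1F1: "b \<notin> \<int> \<Longrightarrow> isCont (hypergeom_1F1 a b) x"
  using has_field_derivative_hypergeom_1F1 by (rule DERIV_isCont)

text \<open>Serves to multiply a power series by \<open>x\<close>: the index moves up by one and the
  new zeroth term vanishes.\<close>

lemma sums_Suc_0:
  fixes f :: "nat \<Rightarrow> real"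
  shows "(\<lambda>n. f (Suc n)) sums s \<Longrightarrow> f 0 = 0 \<Longrightarrow> f sums s"
  by (simp add: sums_Suc_iff)

text \<open>The equation \<open>x y'' + (b - x) y' - a y = 0\<close>, with \<open>y'\<close> and
  \<open>y''\<close> written as the shifted series that differentiation produces. Once everything is
  expanded in powers of \<open>x\<close>, the coefficient of \<open>x ^ j\<close> is the difference
  of the two sides of \<open>coeff_1F1_Suc\<close>.\<close>

lemma hypergeom_1F1_kummer_ode:
  assumes b: "b \<notin> \<int>"
  shows "x * (a / b * ((a + 1) / (b + 1) * hypergeom_1F1 (a + 2) (b + 2) x))
    + (b - x) * (a / b * hypergeom_1F1 (a + 1) (b + 1) x) - a * hypergeom_1F1 a b x = 0"
proof -
  let ?c = "coeff_1F1 a b"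
  have b1: "b + 1 \<notin> \<int>" "b + 2 \<notin> \<int>" using b by simp_all
  have s0: "(\<lambda>j. ?c j * x ^ j) sums hypergeom_1F1 a b x"
    unfolding hypergeom_1F1_altdef by (intro summable_sums summable_coeff_1F1 b)
  have s1: "(\<lambda>j. a / b * (coeff_1F1 (a + 1) (b + 1) j * x ^ j)) sums (a / b * hypergeom_1F1 (a + 1) (b + 1) x)"
    unfolding hypergeom_1F1_altdef by (intro sums_mult summable_sums summable_coeff_1F1 b1)
  have d1: "a / b * coeff_1F1 (a + 1) (b + 1) j = real (Suc j) * ?c (Suc j)" for j
    using diffs_coeff_1F1[of a b] by (simp add: diffs_def fun_eq_iff)
  have d2: "(a + 1) / (b + 1) * coeff_1F1 (a + 2) (b + 2) j = real (Suc j) * coeff_1F1 (a + 1) (b + 1) (Suc j)" for j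
    using diffs_coeff_1F1[of "a + 1" "b + 1"] by (simp add: diffs_def fun_eq_iff add.commute add.left_commute)
  have s2: "(\<lambda>j. a / b * ((a + 1) / (b + 1) * (coeff_1F1 (a + 2) (b + 2) j * x ^ j))) sums
      (a / b * ((a + 1) / (b + 1) * hypergeom_1F1 (a + 2) (b + 2) x))"
    unfolding hypergeom_1F1_altdef by (intro sums_mult summable_sums summable_coeff_1F1 b1)
  have s1': "(\<lambda>j. real (Suc j) * ?c (Suc j) * x ^ j) sums (a / b * hypergeom_1F1 (a + 1) (b + 1) x)"
    using s1 by (simp add: d1[symmetric] mult.assoc del: of_nat_Suc)
  have "a / b * ((a + 1) / (b + 1) * (coeff_1F1 (a + 2) (b + 2) j * x ^ j)) =
     real (Suc j) * real (Suc (Suc j)) * ?c (Suc (Suc j)) * x ^ j" for j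
  proof -
    have "a / b * ((a + 1) / (b + 1) * (coeff_1F1 (a + 2) (b + 2) j * x ^ j)) =
      a / b * ((a + 1) / (b + 1) * coeff_1F1 (a + 2) (b + 2) j) * x ^ j" by simp
    also have "\<dots> = real (Suc j) * (a / b * coeff_1F1 (a + 1) (b + 1) (Suc j)) * x ^ j"
      unfolding d2 by (simp del: of_nat_Suc)
    finally show ?thesis unfolding d1 by (simp del: of_nat_Suc)
  qed
  then have s2': "(\<lambda>j. real (Suc j) * real (Suc (Suc j)) * ?c (Suc (Suc j)) * x ^ j) sums
      (a / b * ((a + 1) / (b + 1) * hypergeom_1F1 (a + 2) (b + 2) x))"
    using s2 by (simp only:)
  have t2: "(\<lambda>j. real j * real (Suc j) * ?c (Suc j) * x ^ j) sums
      (x * (a / b * ((a + 1) / (b + 1) * hypergeom_1F1 (a + 2) (b + 2) x)))"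
  proof (rule sums_Suc_0)
    have "real (Suc j) * real (Suc (Suc j)) * ?c (Suc (Suc j)) * x ^ Suc j =
      x * (real (Suc j) * real (Suc (Suc j)) * ?c (Suc (Suc j)) * x ^ j)" for j
      by (simp only: power_Suc mult_ac)
    then show "(\<lambda>j. real (Suc j) * real (Suc (Suc j)) * ?c (Suc (Suc j)) * x ^ Suc j) sums
      (x * (a / b * ((a + 1) / (b + 1) * hypergeom_1F1 (a + 2) (b + 2) x)))"
      using sums_mult[OF s2', of x] by (simp only:)
  qed simp
  have t1: "(\<lambda>j. real j * ?c j * x ^ j) sums (x * (a / b * hypergeom_1F1 (a + 1) (b + 1) x))"
  proof (rule sums_Suc_0)
    have "real (Suc j) * ?c (Suc j) * x ^ Suc j = x * (real (Suc j) * ?c (Suc j) * x ^ j)" for j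
      by (simp only: power_Suc mult_ac)
    then show "(\<lambda>j. real (Suc j) * ?c (Suc j) * x ^ Suc j) sums
      (x * (a / b * hypergeom_1F1 (a + 1) (b + 1) x))"
      using sums_mult[OF s1', of x] by (simp only:)
  qed simp
  have "(\<lambda>j. real j * real (Suc j) * ?c (Suc j) * x ^ j + b * (real (Suc j) * ?c (Suc j) * x ^ j)
        - real j * ?c j * x ^ j - a * (?c j * x ^ j)) sums
     (x * (a / b * ((a + 1) / (b + 1) * hypergeom_1F1 (a + 2) (b + 2) x)) +
      b * (a / b * hypergeom_1F1 (a + 1) (b + 1) x) - x * (a / b * hypergeom_1F1 (a + 1) (b + 1) x)
      - a * hypergeom_1F1 a b x)"
    by (intro sums_diff sums_add t2 t1 sums_mult s1' s0)
  moreover have "real j * real (Suc j) * ?c (Suc j) * x ^ j + b * (real (Suc j) * ?c (Suc j) * x ^ j)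
        - real j * ?c j * x ^ j - a * (?c j * x ^ j) = 0" for j
  proof -
    have "real j * real (Suc j) * ?c (Suc j) * x ^ j + b * (real (Suc j) * ?c (Suc j) * x ^ j)
        - real j * ?c j * x ^ j - a * (?c j * x ^ j) =
       (real (Suc j) * (b + real j) * ?c (Suc j) - (a + real j) * ?c j) * x ^ j"
      by (simp add: algebra_simps del: of_nat_Suc)
    then show ?thesis using coeff_1F1_Suc[OF b, of j a] by simp
  qed
  ultimately have "x * (a / b * ((a + 1) / (b + 1) * hypergeom_1F1 (a + 2) (b + 2) x)) +
      b * (a / b * hypergeom_1F1 (a + 1) (b + 1) x) - x * (a / b * hypergeom_1F1 (a + 1) (b + 1) x)
      - a * hypergeom_1F1 a b x = 0"
    using sums_unique2 sums_zero by (metis (no_types, lifting) sums_cong)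
  then show ?thesis by (simp only: left_diff_distrib add_diff_eq)
qed

text \<open>The operator \<open>b + x d/dx\<close> multiplies the coefficient of
  \<open>x ^ j\<close> by \<open>b + j\<close>, and \<open>(b + j) (b)_j = b (b + 1)_j\<close>. This
  contiguous relation merges the two terms of the product rule when the second Kummer solution is
  differentiated.\<close>

lemma hypergeom_1F1_lower_parameter:
  assumes b: "b \<notin> \<int>"
  shows "b * hypergeom_1F1 a (b + 1) x + x * (a / (b + 1) * hypergeom_1F1 (a + 1) (b + 2) x)
    = b * hypergeom_1F1 a b x"
proof -
  have b1: "b + 1 \<notin> \<int>" "b + 2 \<notin> \<int>" using b by simp_all
  let ?c = "coeff_1F1 a (b + 1)"
  have d1: "a / (b + 1) * coeff_1F1 (a + 1) (b + 2) j = real (Suc j) * ?c (Suc j)" for j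
    using diffs_coeff_1F1[of a "b + 1"] by (simp add: diffs_def fun_eq_iff add.commute add.left_commute)
  have "(\<lambda>j. a / (b + 1) * (coeff_1F1 (a + 1) (b + 2) j * x ^ j)) sums (a / (b + 1) * hypergeom_1F1 (a + 1) (b + 2) x)"
    unfolding hypergeom_1F1_altdef by (intro sums_mult summable_sums summable_coeff_1F1 b1)
  then have s1': "(\<lambda>j. real (Suc j) * ?c (Suc j) * x ^ j) sums (a / (b + 1) * hypergeom_1F1 (a + 1) (b + 2) x)"
    by (simp add: d1[symmetric] mult.assoc del: of_nat_Suc)
  have t1: "(\<lambda>j. real j * ?c j * x ^ j) sums (x * (a / (b + 1) * hypergeom_1F1 (a + 1) (b + 2) x))"
  proof (rule sums_Suc_0)
    have "real (Suc j) * ?c (Suc j) * x ^ Suc j = x * (real (Suc j) * ?c (Suc j) * x ^ j)" for j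
      by (simp only: power_Suc mult_ac)
    then show "(\<lambda>j. real (Suc j) * ?c (Suc j) * x ^ Suc j) sums
      (x * (a / (b + 1) * hypergeom_1F1 (a + 1) (b + 2) x))"
      using sums_mult[OF s1', of x] by (simp only:)
  qed simp
  have "(\<lambda>j. b * (?c j * x ^ j) + real j * ?c j * x ^ j) sums
     (b * hypergeom_1F1 a (b + 1) x + x * (a / (b + 1) * hypergeom_1F1 (a + 1) (b + 2) x))"
    by (intro sums_add t1) (auto simp: hypergeom_1F1_altdef intro!: sums_mult summable_sums summable_coeff_1F1 b1)
  moreover have "b * (?c j * x ^ j) + real j * ?c j * x ^ j = b * (coeff_1F1 a b j * x ^ j)" for j
  proof -
    have "b * pochhammer (b + 1) j = (b + real j) * pochhammer b j"
      by (metis pochhammer_rec pochhammer_rec')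
    moreover have "pochhammer (b + 1) j \<noteq> 0" "pochhammer b j \<noteq> 0"
      using b b1 pochhammer_nonint_neq_0 by auto
    ultimately have "(b + real j) * ?c j = b * coeff_1F1 a b j"
      by (simp add: coeff_1F1_def divide_simps)
    then show ?thesis by (metis (no_types, lifting) distrib_right mult.assoc)
  qed
  moreover have "(\<lambda>j. b * (coeff_1F1 a b j * x ^ j)) sums (b * hypergeom_1F1 a b x)"
    unfolding hypergeom_1F1_altdef by (intro sums_mult summable_sums summable_coeff_1F1 b)
  ultimately show ?thesis using sums_unique2 by (metis (no_types, lifting) sums_cong)
qed

lemma has_field_derivative_hypergeom_1F1_powr:
  assumes b: "b \<notin> \<int>" and x: "x > 0"
  shows "((\<lambda>x. x powr (1 - b) * hypergeom_1F1 a (2 - b) x) has_real_derivative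
     (1 - b) * (x powr - b * hypergeom_1F1 a (1 - b) x)) (at x)"
proof -
  have b1: "1 - b \<notin> \<int>" "2 - b \<notin> \<int>"
    using b Ints_diff[of 1 "1 - b"] Ints_diff[of 2 "2 - b"] by auto
  have "((\<lambda>x. x powr (1 - b) * hypergeom_1F1 a (2 - b) x) has_real_derivative
     (1 - b) * x powr (1 - b - 1) * hypergeom_1F1 a (2 - b) x +
     (a / (2 - b) * hypergeom_1F1 (a + 1) (2 - b + 1) x) * x powr (1 - b)) (at x)"
    using x by (intro DERIV_mult has_field_derivative_hypergeom_1F1 b1) (auto intro!: derivative_eq_intros)
  also have "x powr (1 - b) = x powr (- b) * x" using x by (simp add: powr_diff powr_minus divide_simps)
  also have "1 - b - 1 = - b" by simp
  also have "(1 - b) * x powr - b * hypergeom_1F1 a (2 - b) x +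
     (a / (2 - b) * hypergeom_1F1 (a + 1) (2 - b + 1) x) * (x powr - b * x) =
      x powr - b * ((1 - b) * hypergeom_1F1 a (1 - b + 1) x + x * (a / (1 - b + 1) * hypergeom_1F1 (a + 1) (1 - b + 2) x))"
    by (simp add: algebra_simps)
  also have "\<dots> = (1 - b) * (x powr - b * hypergeom_1F1 a (1 - b) x)"
    by (subst hypergeom_1F1_lower_parameter[OF b1(1)]) simp
  finally show ?thesis .
qed

text \<open>Each of the two terms of \<open>U(a, b)\<close> is mapped to the corresponding term of
  \<open>U(a + 1, b + 1)\<close>, and the functional equation of Gamma adjusts the constants. Note
  that \<open>a - b + 1\<close> is unchanged by this shift, so the shape of the integral
  representation is unchanged too.\<close>

lemma has_field_derivative_tricomi_U_nonint:
  assumes b: "b \<notin> \<int>" and x: "x > 0"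
  shows "(tricomi_U_nonint a b has_real_derivative - a * tricomi_U_nonint (a + 1) (b + 1) x) (at x)"
proof -
  have b1: "b - 1 \<notin> \<int>" "- b \<notin> \<int>" using b by (auto simp: minus_in_Ints_iff)
  have nb: "- b \<notin> \<int>\<^sub>\<le>\<^sub>0" "b - 1 \<notin> \<int>\<^sub>\<le>\<^sub>0" using b1 nonpos_Ints_Int by blast+
  have G1: "Gamma (1 - b) = - b * Gamma (- b)"
    using Gamma_plus1[OF nb(1)] by simp
  have G2: "Gamma b = (b - 1) * Gamma (b - 1)"
    using Gamma_plus1[OF nb(2)] by simp
  have G3: "rGamma a = a * rGamma (a + 1)"
    using rGamma_plus1[of a] by simp
  have bz: "b \<noteq> 0" using b by auto
  have "((\<lambda>x. Gamma (b - 1) * rGamma a * (x powr (1 - b) * hypergeom_1F1 (a - b + 1) (2 - b) x) +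
      Gamma (1 - b) * rGamma (a - b + 1) * hypergeom_1F1 a b x) has_real_derivative
     Gamma (b - 1) * rGamma a * ((1 - b) * (x powr - b * hypergeom_1F1 (a - b + 1) (1 - b) x)) +
     Gamma (1 - b) * rGamma (a - b + 1) * (a / b * hypergeom_1F1 (a + 1) (b + 1) x)) (at x)"
    using b x by (intro DERIV_add DERIV_cmult has_field_derivative_hypergeom_1F1_powr
       has_field_derivative_hypergeom_1F1)
  also have "Gamma (b - 1) * rGamma a * ((1 - b) * (x powr - b * hypergeom_1F1 (a - b + 1) (1 - b) x)) +
     Gamma (1 - b) * rGamma (a - b + 1) * (a / b * hypergeom_1F1 (a + 1) (b + 1) x) =
     - a * tricomi_U_nonint (a + 1) (b + 1) x"
    using bz by (simp add: tricomi_U_nonint_def G1 G2 G3 algebra_simps)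
  finally show ?thesis by (simp add: tricomi_U_nonint_def[abs_def] mult.assoc)
qed

subsection \<open>The integral representation of Tricomi's function\<close>

lemma integral_dominated_convergence_within:
  fixes s :: "real \<Rightarrow> 'a \<Rightarrow> real"
  assumes [measurable]: "f \<in> borel_measurable M" "\<And>z. s z \<in> borel_measurable M"
    and w: "integrable M w"
    and lim: "\<And>t. t \<in> space M \<Longrightarrow> ((\<lambda>z. s z t) \<longlongrightarrow> f t) (at x within S)"
    and bound: "\<forall>\<^sub>F z in at x within S. \<forall>t\<in>space M. norm (s z t) \<le> w t"
  shows "((\<lambda>z. integral\<^sup>L M (s z)) \<longlongrightarrow> integral\<^sup>L M f) (at x within S)"
  unfolding tendsto_at_iff_sequentially comp_def
proof (intro allI impI)
  fix X assume X: "\<forall>i. X i \<in> S - {x}" "X \<longlonglongrightarrow> x"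
  then have Xf: "filterlim X (at x within S) sequentially"
    by (simp add: filterlim_at)
  from filterlim_iff[THEN iffD1, OF this, rule_format, OF bound]
  obtain N where N: "\<And>n t. N \<le> n \<Longrightarrow> t \<in> space M \<Longrightarrow> norm (s (X n) t) \<le> w t"
    by (auto simp: eventually_sequentially)
  show "(\<lambda>n. integral\<^sup>L M (s (X n))) \<longlonglongrightarrow> integral\<^sup>L M f"
  \<comment> \<open>The bound \<open>w\<close> holds only close to \<open>x\<close>; dropping the
    first \<open>N\<close> members of the sequence makes it hold throughout.\<close>
  proof (rule LIMSEQ_offset, rule integral_dominated_convergence)
    show "AE t in M. norm (s (X (n + N)) t) \<le> w t" for n
      using N by auto
    show "AE t in M. (\<lambda>n. s (X (n + N)) t) \<longlonglongrightarrow> f t"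
    proof (rule AE_I2)
      fix t assume "t \<in> space M"
      from filterlim_compose[OF lim[OF this] Xf]
      show "(\<lambda>n. s (X (n + N)) t) \<longlonglongrightarrow> f t" by (rule LIMSEQ_ignore_initial_segment)
    qed
  qed (use w in measurable)
qed

text \<open>By the mean value inequality the difference quotients inherit the bound \<open>w\<close>
  of the derivative, so dominated convergence applies to them.\<close>

lemma has_real_derivative_lebesgue_integral:
  fixes f f' :: "real \<Rightarrow> 'a \<Rightarrow> real"
  assumes e: "e > 0"
    and int: "\<And>z. z \<in> {x - e<..<x + e} \<Longrightarrow> integrable M (f z)"
    and [measurable]: "\<And>z. f z \<in> borel_measurable M" "f' x \<in> borel_measurable M"
    and der: "\<And>z t. z \<in> {x - e<..<x + e} \<Longrightarrow> t \<in> space M \<Longrightarrow>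
      ((\<lambda>z. f z t) has_real_derivative f' z t) (at z)"
    and bound: "\<And>z t. z \<in> {x - e<..<x + e} \<Longrightarrow> t \<in> space M \<Longrightarrow> \<bar>f' z t\<bar> \<le> w t"
    and w: "integrable M w"
  shows "((\<lambda>z. integral\<^sup>L M (f z)) has_real_derivative integral\<^sup>L M (f' x)) (at x)"
proof -
  have x: "x \<in> {x - e<..<x + e}" using e by simp
  have nhd: "\<forall>\<^sub>F z in at x. z \<in> {x - e<..<x + e}"
    using x by (intro eventually_at_in_open') auto
  have "((\<lambda>z. integral\<^sup>L M (\<lambda>t. (f z t - f x t) / (z - x))) \<longlongrightarrow> integral\<^sup>L M (f' x)) (at x)"
  proof (rule integral_dominated_convergence_within[OF _ _ w])
    fix t assume t: "t \<in> space M"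
    show "((\<lambda>z. (f z t - f x t) / (z - x)) \<longlongrightarrow> f' x t) (at x)"
      using der[OF x t] by (simp add: has_field_derivative_iff)
  next
    show "\<forall>\<^sub>F z in at x. \<forall>t\<in>space M. norm ((f z t - f x t) / (z - x)) \<le> w t"
      using nhd eventually_neq_at_within[of x x UNIV]
    proof eventually_elim
      case (elim z)
      show ?case
      proof
        fix t assume t: "t \<in> space M"
        have "norm (f z t - f x t) \<le> w t * norm (z - x)"
        proof (rule field_differentiable_bound[of "{x - e<..<x + e}" "\<lambda>z. f z t" "\<lambda>z. f' z t"])
          show "convex {x - e<..<x + e}" by simp
        qed (use elim x der bound t in \<open>auto intro: DERIV_subset\<close>)
        then show "norm ((f z t - f x t) / (z - x)) \<le> w t"
          using elim by (simp add: divide_simps)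
      qed
    qed
  qed measurable
  moreover have "\<forall>\<^sub>F z in at x. integral\<^sup>L M (\<lambda>t. (f z t - f x t) / (z - x)) =
      (integral\<^sup>L M (f z) - integral\<^sup>L M (f x)) / (z - x)"
    using nhd by eventually_elim (simp add: int x)
  ultimately show ?thesis
    unfolding has_field_derivative_iff by (rule Lim_transform_eventually)
qed

section \<open>Gamma integrals and the kernel of Tricomi's integral\<close>

lemma nn_integral_Gamma_rate:
  assumes c: "c > 0" and m: "m > (0::real)"
  shows "(\<integral>\<^sup>+t. ennreal (indicator {0<..} t * (t powr (c - 1) * exp (- (m * t)))) \<partial>lborel) =
    ennreal (Gamma c / m powr c)"
proof -
  have "ennreal (Gamma c) = (\<integral>\<^sup>+t. ennreal (indicator {0..} t * t powr (c - 1) / exp t) \<partial>lborel)"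
    by (rule Gamma_conv_nn_integral_real[OF c])
  also have "\<dots> = (\<integral>\<^sup>+t. ennreal (indicator {0<..} t * (t powr (c - 1) * exp (- t))) \<partial>lborel)"
    by (intro nn_integral_cong) (auto simp: indicator_def exp_minus field_simps)
  also have "\<dots> = ennreal m * (\<integral>\<^sup>+t. ennreal (indicator {0<..} (m * t) * ((m * t) powr (c - 1) * exp (- (m * t)))) \<partial>lborel)"
    using m by (subst nn_integral_real_affine[where c=m and t=0]) auto
  also have "\<dots> = ennreal m * (\<integral>\<^sup>+t. ennreal (m powr (c - 1)) * ennreal (indicator {0<..} t * (t powr (c - 1) * exp (- (m * t)))) \<partial>lborel)"
    using m by (intro arg_cong2[where f="(*)"] refl nn_integral_cong)
      (auto simp: indicator_def powr_mult zero_less_mult_iff mult_ac simp flip: ennreal_mult')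
  also have "\<dots> = ennreal (m powr c) * (\<integral>\<^sup>+t. ennreal (indicator {0<..} t * (t powr (c - 1) * exp (- (m * t)))) \<partial>lborel)"
    using m by (subst nn_integral_cmult) (auto simp: powr_diff simp flip: ennreal_mult' mult.assoc)
  finally have *: "ennreal (Gamma c) = ennreal (m powr c) * (\<integral>\<^sup>+t. ennreal (indicator {0<..} t * (t powr (c - 1) * exp (- (m * t)))) \<partial>lborel)" .
  have "ennreal (Gamma c / m powr c) = ennreal (1 / m powr c) * ennreal (Gamma c)"
    using m by (simp flip: ennreal_mult')
  also have "\<dots> = ennreal (1 / m powr c) * ennreal (m powr c) * (\<integral>\<^sup>+t. ennreal (indicator {0<..} t * (t powr (c - 1) * exp (- (m * t)))) \<partial>lborel)"
    unfolding * by (simp add: mult.assoc)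
  also have "ennreal (1 / m powr c) * ennreal (m powr c) = 1"
    using m by (simp flip: ennreal_mult')
  finally show ?thesis by simp
qed

lemma integrable_Gamma_kernel:
  assumes c: "c > 0"
  shows "integrable lborel (\<lambda>t::real. indicator {0<..} t * (t powr (c - 1) * exp (- t)))"
    and "(\<integral>t. indicator {0<..} t * (t powr (c - 1) * exp (- t :: real)) \<partial>lborel) = Gamma c"
proof -
  have *: "(\<integral>\<^sup>+t. ennreal (indicator {0<..} t * (t powr (c - 1) * exp (- t))) \<partial>lborel) = ennreal (Gamma c)"
    using nn_integral_Gamma_rate[OF c, of 1] by simp
  show "integrable lborel (\<lambda>t::real. indicator {0<..} t * (t powr (c - 1) * exp (- t)))"
    by (rule integrableI_nonneg) (auto simp: *)
  show "(\<integral>t. indicator {0<..} t * (t powr (c - 1) * exp (- t :: real)) \<partial>lborel) = Gamma c"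
    using * c by (subst integral_eq_nn_integral) (auto intro!: Gamma_real_nonneg)
qed

text \<open>With \<open>p = - a\<close> and \<open>c = a - b + 1\<close> this is the integrand of
  the Laplace integral of \<open>z powr (1 - b) * U(a - b + 1, 2 - b, z)\<close>, which equals
  \<open>U(a, b, z)\<close>, after the integration variable has been scaled by \<open>z\<close>. The
  usual Laplace integral of \<open>U(a, b, z)\<close> itself would require \<open>a > 0\<close>,
  whereas here \<open>a = 1 - \<alpha>\<close> is mostly negative; this form asks for
  \<open>c > 0\<close> only, and it is the shape in which convolutions of Gamma densities
  appear.\<close>

definition tricomi_kernel :: "real \<Rightarrow> real \<Rightarrow> real \<Rightarrow> real \<Rightarrow> real" where
  "tricomi_kernel p c z t = indicator {0<..} t * ((z + t) powr p * t powr (c - 1) * exp (- t))"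

definition tricomi_integral :: "real \<Rightarrow> real \<Rightarrow> real \<Rightarrow> real" where
  "tricomi_integral p c z = (\<integral>t. tricomi_kernel p c z t \<partial>lborel)"

lemma measurable_tricomi_kernel [measurable]: "tricomi_kernel p c z \<in> borel_measurable borel"
  unfolding tricomi_kernel_def by measurable

lemma tricomi_kernel_nonneg: "tricomi_kernel p c z t \<ge> 0"
  by (simp add: tricomi_kernel_def)

text \<open>For \<open>p < 0\<close> the base is at least \<open>l\<close>. For
  \<open>p \<ge> 0\<close> the larger of \<open>h\<close> and \<open>t\<close> dominates: the base
  is at most \<open>2 * h\<close> if \<open>t \<le> h\<close>, and at most \<open>2 * t\<close>
  otherwise. The constant adds up the three cases.\<close>

lemma powr_shift_bound:
  assumes l: "0 < l"
  shows "\<exists>C\<ge>0. \<forall>z\<in>{l..h}. \<forall>t>0. (z + t) powr p \<le> C * (1 + t powr \<bar>p\<bar> :: real)"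
proof (intro exI conjI ballI allI impI)
  let ?C = "l powr p + (2 * h) powr \<bar>p\<bar> + 2 powr \<bar>p\<bar>"
  show "?C \<ge> 0" by simp
  fix z t :: real assume z: "z \<in> {l..h}" and t: "t > 0"
  have nn: "0 \<le> l powr p" "0 \<le> (2 * h) powr \<bar>p\<bar>" "0 \<le> 2 powr \<bar>p\<bar> * t powr \<bar>p\<bar>" "0 \<le> t powr \<bar>p\<bar>"
    "0 \<le> l powr p * t powr \<bar>p\<bar>" "0 \<le> (2 * h) powr \<bar>p\<bar> * t powr \<bar>p\<bar>" "0 \<le> 2 powr \<bar>p\<bar>"
    by simp_all
  have "(z + t) powr p \<le> l powr p + (2 * h) powr \<bar>p\<bar> + 2 powr \<bar>p\<bar> * t powr \<bar>p\<bar>"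
  proof (cases "p \<ge> 0")
    case False
    then have "(z + t) powr p \<le> l powr p" using z t l by (intro powr_mono2') auto
    then show ?thesis using nn by linarith
  next
    case True
    show ?thesis
    proof (cases "t \<le> h")
      case True
      then have "(z + t) powr p \<le> (2 * h) powr p" using z t l \<open>p \<ge> 0\<close> by (intro powr_mono2) auto
      then show ?thesis using nn \<open>p \<ge> 0\<close> by (simp add: add_increasing add_increasing2)
    next
      case False
      then have "(z + t) powr p \<le> (2 * t) powr p" using z t l \<open>p \<ge> 0\<close> by (intro powr_mono2) auto
      moreover have "(2 * t) powr p = 2 powr \<bar>p\<bar> * t powr \<bar>p\<bar>"
        using \<open>p \<ge> 0\<close> t by (simp add: powr_mult)
      ultimately show ?thesis using nn by linarith
    qed
  qed
  also have "\<dots> \<le> ?C * (1 + t powr \<bar>p\<bar>)"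
    using nn by (simp add: algebra_simps)
  finally show "(z + t) powr p \<le> ?C * (1 + t powr \<bar>p\<bar>)" .
qed

text \<open>The majorant is a multiple of the sum of two Gamma integrands, of shapes
  \<open>c\<close> and \<open>c + \<bar>p\<bar>\<close>. It is uniform in \<open>z\<close> on a
  compact interval away from \<open>0\<close>, which differentiation in \<open>z\<close>
  requires.\<close>

lemma tricomi_kernel_bound:
  assumes l: "0 < l" and c: "c > 0"
  shows "\<exists>w. integrable lborel w \<and> (\<forall>z\<in>{l..h}. \<forall>t. tricomi_kernel p c z t \<le> w t)"
proof -
  obtain C where C: "C \<ge> 0" "\<And>z t. z \<in> {l..h} \<Longrightarrow> t > 0 \<Longrightarrow> (z + t) powr p \<le> C * (1 + t powr \<bar>p\<bar>)"
    using powr_shift_bound[OF l] by blast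
  let ?w = "\<lambda>t::real. C * (indicator {0<..} t * (t powr (c - 1) * exp (- t))
     + indicator {0<..} t * (t powr (c + \<bar>p\<bar> - 1) * exp (- t)))"
  have "integrable lborel ?w"
    using c by (intro integrable_mult_right Bochner_Integration.integrable_add integrable_Gamma_kernel) auto
  moreover have "tricomi_kernel p c z t \<le> ?w t" if "z \<in> {l..h}" for z t
  proof (cases "t > 0")
    case True
    have "(z + t) powr p * (t powr (c - 1) * exp (- t)) \<le> C * (1 + t powr \<bar>p\<bar>) * (t powr (c - 1) * exp (- t))"
      by (intro mult_right_mono C that True) auto
    also have "\<dots> = ?w t" using True by (simp add: algebra_simps powr_add powr_diff add_divide_distrib)
    finally show ?thesis using True by (simp add: tricomi_kernel_def mult.assoc)
  qed (simp add: tricomi_kernel_def)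
  ultimately show ?thesis by blast
qed

lemma integrable_tricomi_kernel:
  assumes "0 < z" "c > 0"
  shows "integrable lborel (tricomi_kernel p c z)"
proof -
  obtain w where w: "integrable lborel w" "\<And>t. tricomi_kernel p c z t \<le> w t"
    using tricomi_kernel_bound[OF assms, of z p] by auto
  show ?thesis
    by (rule Bochner_Integration.integrable_bound[OF w(1)])
      (use w(2) tricomi_kernel_nonneg[of p c z] in \<open>auto intro!: AE_I2 intro: order_trans[OF _ abs_ge_self]\<close>)
qed

lemma has_real_derivative_tricomi_integral:
  assumes z: "0 < z" and c: "c > 0"
  shows "(tricomi_integral p c has_real_derivative p * tricomi_integral (p - 1) c z) (at z)"
proof -
  \<comment> \<open>The radius \<open>z / 2\<close> keeps the parameter away from the singular point
    \<open>0\<close>.\<close>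
  obtain w where w: "integrable lborel w" "\<And>x t. x \<in> {z/2..3*z/2} \<Longrightarrow> tricomi_kernel (p - 1) c x t \<le> w t"
    using tricomi_kernel_bound[of "z/2" c "3*z/2" "p - 1"] z c by auto
  have "((\<lambda>x. integral\<^sup>L lborel (tricomi_kernel p c x)) has_real_derivative
     integral\<^sup>L lborel (\<lambda>t. p * tricomi_kernel (p - 1) c z t)) (at z)"
  proof (rule has_real_derivative_lebesgue_integral[of "z/2" _ _ _ "\<lambda>z t. p * tricomi_kernel (p - 1) c z t" "\<lambda>t. \<bar>p\<bar> * w t"])
    fix x t assume x: "x \<in> {z - z/2<..<z + z/2}"
    then have x0: "x > 0" using z by auto
    show "((\<lambda>z. tricomi_kernel p c z t) has_real_derivative p * tricomi_kernel (p - 1) c x t) (at x)"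
      unfolding tricomi_kernel_def using x0
      by (cases "t > 0") (auto intro!: derivative_eq_intros simp: algebra_simps)
    have "tricomi_kernel (p - 1) c x t \<le> w t" using x by (intro w) auto
    then show "\<bar>p * tricomi_kernel (p - 1) c x t\<bar> \<le> \<bar>p\<bar> * w t"
      by (simp add: abs_mult tricomi_kernel_nonneg mult_left_mono)
  qed (use z c w in \<open>auto intro!: integrable_tricomi_kernel\<close>)
  then show ?thesis by (simp add: tricomi_integral_def[abs_def])
qed

text \<open>At \<open>z = 0\<close> the two powers of \<open>t\<close> fuse into a Gamma integrand
  of shape \<open>p + c\<close>. Since \<open>(z + t) powr p\<close> is monotone in
  \<open>z\<close>, whatever the sign of \<open>p\<close>, the kernels for \<open>0 < z < 1\<close>
  are dominated by the sum of those at \<open>z = 0\<close> and at \<open>z = 1\<close>.\<close>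

lemma tricomi_integral_at_right_0:
  assumes c: "c > 0" and pc: "p + c > 0"
  shows "(tricomi_integral p c \<longlongrightarrow> Gamma (p + c)) (at_right 0)"
proof -
  obtain w where w: "integrable lborel w" "\<And>t. tricomi_kernel p c 1 t \<le> w t"
    using tricomi_kernel_bound[of 1 c 1 p] c by auto
  let ?g = "\<lambda>t::real. indicator {0<..} t * (t powr (p + c - 1) * exp (- t))"
  have "(tricomi_integral p c \<longlongrightarrow> integral\<^sup>L lborel ?g) (at_right 0)"
    unfolding tricomi_integral_def[abs_def]
  proof (rule integral_dominated_convergence_within[where w="\<lambda>t. ?g t + w t"])
    show "integrable lborel (\<lambda>t. ?g t + w t)"
      using w pc by (intro Bochner_Integration.integrable_add integrable_Gamma_kernel) auto
  next
    fix t :: real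
    show "((\<lambda>z. tricomi_kernel p c z t) \<longlongrightarrow> ?g t) (at_right 0)"
    proof (cases "t > 0")
      case True
      then have "((\<lambda>z. (z + t) powr p * t powr (c - 1) * exp (- t)) \<longlongrightarrow> (0 + t) powr p * t powr (c - 1) * exp (- t)) (at_right 0)"
        by (intro tendsto_intros) auto
      with True show ?thesis by (simp add: tricomi_kernel_def powr_add powr_diff)
    qed (simp add: tricomi_kernel_def)
  next
    have "\<forall>\<^sub>F z in at_right 0. z \<in> {0<..<1::real}"
      by (rule eventually_at_right_real) simp
    then show "\<forall>\<^sub>F z in at_right 0. \<forall>t\<in>space lborel. norm (tricomi_kernel p c z t) \<le> ?g t + w t"
    proof eventually_elim
      case (elim z)
      show ?case
      proof
        fix t :: real
        show "norm (tricomi_kernel p c z t) \<le> ?g t + w t"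
        proof (cases "t > 0")
          case True
          have "(z + t) powr p \<le> t powr p + (1 + t) powr p"
          proof (cases "p \<ge> 0")
            case True
            then have "(z + t) powr p \<le> (1 + t) powr p" using \<open>t > 0\<close> elim by (intro powr_mono2) auto
            then show ?thesis by (simp add: add_increasing)
          next
            case False
            then have "(z + t) powr p \<le> t powr p" using \<open>t > 0\<close> elim by (intro powr_mono2') auto
            then show ?thesis by (simp add: add_increasing2)
          qed
          then have "(z + t) powr p * (t powr (c - 1) * exp (- t)) \<le> (t powr p + (1 + t) powr p) * (t powr (c - 1) * exp (- t))"
            by (intro mult_right_mono) auto
          also have "\<dots> = ?g t + tricomi_kernel p c 1 t"
            using True by (simp add: tricomi_kernel_def algebra_simps powr_add powr_diff add_divide_distrib)
          finally have "tricomi_kernel p c z t \<le> ?g t + tricomi_kernel p c 1 t"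
            using True by (simp add: tricomi_kernel_def mult.assoc)
          then show ?thesis using w(2)[of t] tricomi_kernel_nonneg[of p c z t] by simp
        next
          case False
          then show ?thesis using w(2)[of t] by (simp add: tricomi_kernel_def)
        qed
      qed
    qed
  qed measurable
  then show ?thesis using integrable_Gamma_kernel(2)[OF pc] by simp
qed

text \<open>Supplies the passage to integer \<open>b\<close>, which moves \<open>c\<close> at fixed
  \<open>p\<close>. For \<open>c / 2 < d < 2 * c\<close> the power \<open>t powr (d - 1)\<close>
  lies below the one with exponent \<open>c / 2 - 1\<close> if \<open>t \<le> 1\<close>, and below
  the one with exponent \<open>2 * c - 1\<close> otherwise.\<close>

lemma continuous_tricomi_integral_shape:
  assumes z: "z > 0" and c: "c > 0"
  shows "((\<lambda>c. tricomi_integral p c z) \<longlongrightarrow> tricomi_integral p c z) (at c)"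
  unfolding tricomi_integral_def[abs_def]
proof (rule integral_dominated_convergence_within[where w="\<lambda>t. tricomi_kernel p (c/2) z t + tricomi_kernel p (2*c) z t"])
  show "integrable lborel (\<lambda>t. tricomi_kernel p (c/2) z t + tricomi_kernel p (2*c) z t)"
    using z c by (intro Bochner_Integration.integrable_add integrable_tricomi_kernel) auto
next
  fix t :: real
  show "((\<lambda>c. tricomi_kernel p c z t) \<longlongrightarrow> tricomi_kernel p c z t) (at c)"
    unfolding tricomi_kernel_def by (cases "t > 0") (auto intro!: tendsto_intros)
next
  have "\<forall>\<^sub>F d in at c. d \<in> {c/2<..<2*c}"
    using c by (intro eventually_at_in_open') auto
  then show "\<forall>\<^sub>F d in at c. \<forall>t\<in>space lborel. norm (tricomi_kernel p d z t) \<le> tricomi_kernel p (c/2) z t + tricomi_kernel p (2*c) z t"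
  proof eventually_elim
    case (elim d)
    show ?case
    proof
      fix t :: real
      show "norm (tricomi_kernel p d z t) \<le> tricomi_kernel p (c/2) z t + tricomi_kernel p (2*c) z t"
      proof (cases "t > 0")
        case True
        have "t powr (d - 1) \<le> t powr (c/2 - 1) + t powr (2*c - 1)"
        proof (cases "t \<le> 1")
          case t1: True
          have "t powr (d - 1) \<le> t powr (c/2 - 1)"
            using t1 True elim by (intro powr_mono') auto
          then show ?thesis by (simp add: add_increasing2)
        next
          case False
          have "t powr (d - 1) \<le> t powr (2*c - 1)"
            using False elim by (intro powr_mono) auto
          then show ?thesis by (simp add: add_increasing)
        qed
        then have "(z + t) powr p * exp (- t) * t powr (d - 1) \<le> (z + t) powr p * exp (- t) * (t powr (c/2 - 1) + t powr (2*c - 1))"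
          by (intro mult_left_mono) auto
        then show ?thesis using True by (simp add: tricomi_kernel_def algebra_simps)
      qed (simp add: tricomi_kernel_def)
    qed
  qed
qed measurable

text \<open>The integral over the half-line of the derivative of
  \<open>(z + t) powr q * t powr c * exp (- t)\<close>, a function that vanishes at both ends. As
  differentiation in \<open>z\<close> lowers the exponent by one, the instance
  \<open>q = - a - 1\<close> is Kummer's equation for the integral.\<close>

lemma tricomi_integral_recurrence:
  assumes z: "0 < z" and c: "c > 0"
  shows "tricomi_integral (q + 1) c z = (c + q + z) * tricomi_integral q c z - q * z * tricomi_integral (q - 1) c z"
proof -
  define F where "F t = (z + t) powr q * t powr c * exp (- t)" for t
  \<comment> \<open>This is \<open>F'\<close> after a factor \<open>t\<close> has been replaced by
    \<open>(z + t) - z\<close>; every term is then a kernel with the same \<open>c\<close>.\<close>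
  define f where "f t = (c + q + z) * ((z + t) powr q * t powr (c - 1) * exp (- t))
    - q * z * ((z + t) powr (q - 1) * t powr (c - 1) * exp (- t))
    - (z + t) powr (q + 1) * t powr (c - 1) * exp (- t)" for t
  have ker: "indicator {0<..} t * f t = (c + q + z) * tricomi_kernel q c z t
    - q * z * tricomi_kernel (q - 1) c z t - tricomi_kernel (q + 1) c z t" for t
    by (simp add: f_def tricomi_kernel_def algebra_simps)
  have int: "integrable lborel (\<lambda>t. indicator {0<..} t * f t)"
    unfolding ker using z c
    by (intro Bochner_Integration.integrable_diff integrable_mult_right integrable_tricomi_kernel)
  have "(LBINT t=0..\<infinity>. f t) = 0 - 0"
  proof (rule interval_integral_FTC_integrable)
    fix t :: real assume "0 < ereal t" "ereal t < \<infinity>"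
    then have t: "t > 0" by (simp add: zero_ereal_def)
    have "(F has_real_derivative f t) (at t)"
    proof -
      have "(F has_real_derivative (q * (z + t) powr (q - 1) * t powr c * exp (- t)
         + (z + t) powr q * (c * t powr (c - 1)) * exp (- t) - (z + t) powr q * t powr c * exp (- t))) (at t)"
        unfolding F_def using t z by (auto intro!: derivative_eq_intros simp: algebra_simps)
      also have "t powr c = t * t powr (c - 1)" using t by (simp add: powr_diff)
      also have "(q * (z + t) powr (q - 1) * (t * t powr (c - 1)) * exp (- t)
         + (z + t) powr q * (c * t powr (c - 1)) * exp (- t) - (z + t) powr q * (t * t powr (c - 1)) * exp (- t)) = f t"
      proof -
        have 1: "(z + t) powr (q + 1) = (z + t) powr (q - 1) * (z + t)\<^sup>2"
          "(z + t) powr q = (z + t) powr (q - 1) * (z + t)"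
          using t z by (simp_all add: powr_add powr_diff power2_eq_square)
        show ?thesis unfolding f_def 1 by (simp add: algebra_simps power2_eq_square)
      qed
      finally show ?thesis .
    qed
    then show "(F has_vector_derivative f t) (at t)"
      by (simp add: has_real_derivative_iff_has_vector_derivative)
    show "isCont f t" unfolding f_def using t z by (intro continuous_intros) auto
  next
    show "set_integrable lborel (einterval 0 \<infinity>) f"
      using int by (simp add: set_integrable_def zero_ereal_def)
  next
    have "((\<lambda>t. (z + t) powr q * t powr c * exp (- t)) \<longlongrightarrow> (z + 0) powr q * 0 powr c * exp (- 0)) (at_right 0)"
      using z c by (intro tendsto_intros tendsto_powr')
        (auto intro: eventually_mono[OF eventually_at_right_less])
    then show "((F \<circ> real_of_ereal) \<longlongrightarrow> 0) (at_right 0)"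
      using c by (simp add: zero_ereal_def ereal_tendsto_simps F_def[abs_def])
  next
    have "(F \<longlongrightarrow> 0) at_top"
      unfolding F_def[abs_def] using z c by real_asymp
    then show "((F \<circ> real_of_ereal) \<longlongrightarrow> 0) (at_left \<infinity>)"
      by (simp add: ereal_tendsto_simps)
  qed simp
  also have "(LBINT t=0..\<infinity>. f t) = (\<integral>t. indicator {0<..} t * f t \<partial>lborel)"
    by (simp add: interval_integral_to_infinity_eq zero_ereal_def set_lebesgue_integral_def)
  also have "\<dots> = (c + q + z) * tricomi_integral q c z - q * z * tricomi_integral (q - 1) c z - tricomi_integral (q + 1) c z"
    unfolding ker tricomi_integral_def using integrable_tricomi_kernel[OF z c] by simp
  finally show ?thesis by simp
qed

text \<open>Write \<open>Gamma A * (1 + s) powr (- A)\<close> as the integral of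
  \<open>u powr (A - 1) * exp (- (1 + s) * u)\<close> over \<open>u\<close> and exchange the order:
  integrating over \<open>s\<close> leaves \<open>Gamma c / u powr c\<close>, and what remains is
  the integral of \<open>Gamma (A - c)\<close>.\<close>

lemma nn_integral_beta_prime:
  assumes c: "c > 0" and A: "A > c"
  shows "(\<integral>\<^sup>+s. ennreal (indicator {0<..} s * ((1 + s) powr (- A) * s powr (c - 1))) \<partial>lborel)
     = ennreal (Gamma c * Gamma (A - c) / Gamma A)"
proof -
  let ?h = "\<lambda>s u::real. ennreal (indicator {0<..} s * s powr (c - 1)) *
      ennreal (indicator {0<..} u * (u powr (A - 1) * exp (- ((1 + s) * u))))"
  have A0: "A > 0" using c A by simp
  have "ennreal (Gamma A) * (\<integral>\<^sup>+s. ennreal (indicator {0<..} s * ((1 + s) powr (- A) * s powr (c - 1))) \<partial>lborel)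
    = (\<integral>\<^sup>+s. ennreal (Gamma A) * ennreal (indicator {0<..} s * ((1 + s) powr (- A) * s powr (c - 1))) \<partial>lborel)"
    by (subst nn_integral_cmult) auto
  also have "\<dots> = (\<integral>\<^sup>+s. (\<integral>\<^sup>+u. ?h s u \<partial>lborel) \<partial>lborel)"
  proof (intro nn_integral_cong)
    fix s :: real
    show "ennreal (Gamma A) * ennreal (indicator {0<..} s * ((1 + s) powr (- A) * s powr (c - 1))) = (\<integral>\<^sup>+u. ?h s u \<partial>lborel)"
    proof (cases "s > 0")
      case True
      have "(\<integral>\<^sup>+u. ?h s u \<partial>lborel) = ennreal (indicator {0<..} s * s powr (c - 1)) * ennreal (Gamma A / (1 + s) powr A)"
        using True by (subst nn_integral_cmult) (auto simp: nn_integral_Gamma_rate[OF A0])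
      then show ?thesis using True A0
        by (simp add: powr_minus divide_simps mult_ac Gamma_real_nonneg flip: ennreal_mult')
    qed simp
  qed
  also have "\<dots> = (\<integral>\<^sup>+u. (\<integral>\<^sup>+s. ?h s u \<partial>lborel) \<partial>lborel)"
    by (rule lborel_pair.Fubini') simp
  also have "\<dots> = (\<integral>\<^sup>+u. ennreal (Gamma c) * ennreal (indicator {0<..} u * (u powr (A - c - 1) * exp (- (1 * u)))) \<partial>lborel)"
  proof (intro nn_integral_cong)
    fix u :: real
    show "(\<integral>\<^sup>+s. ?h s u \<partial>lborel) = ennreal (Gamma c) * ennreal (indicator {0<..} u * (u powr (A - c - 1) * exp (- (1 * u))))"
    proof (cases "u > 0")
      case True
      have "(\<integral>\<^sup>+s. ?h s u \<partial>lborel) = (\<integral>\<^sup>+s. ennreal (u powr (A - 1) * exp (- u)) * ennreal (indicator {0<..} s * (s powr (c - 1) * exp (- (u * s)))) \<partial>lborel)"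
        using True by (intro nn_integral_cong) (auto simp: indicator_def algebra_simps exp_add exp_diff exp_minus divide_simps simp flip: ennreal_mult')
      also have "\<dots> = ennreal (u powr (A - 1) * exp (- u)) * ennreal (Gamma c / u powr c)"
        using True by (subst nn_integral_cmult) (auto simp: nn_integral_Gamma_rate[OF c])
      finally show ?thesis using True c
        by (simp add: powr_diff divide_simps mult_ac Gamma_real_nonneg flip: ennreal_mult')
    qed simp
  qed
  also have "\<dots> = ennreal (Gamma c) * ennreal (Gamma (A - c))"
    using A nn_integral_Gamma_rate[of "A - c" 1] by (subst nn_integral_cmult) simp_all
  finally have *: "ennreal (Gamma A) * (\<integral>\<^sup>+s. ennreal (indicator {0<..} s * ((1 + s) powr (- A) * s powr (c - 1))) \<partial>lborel)
     = ennreal (Gamma c) * ennreal (Gamma (A - c))" .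
  have G: "Gamma A > 0" "Gamma c > 0" "Gamma (A - c) > 0" using A0 c A by (auto intro: Gamma_real_pos)
  have "(\<integral>\<^sup>+s. ennreal (indicator {0<..} s * ((1 + s) powr (- A) * s powr (c - 1))) \<partial>lborel) =
     ennreal (1 / Gamma A) * ennreal (Gamma A) * (\<integral>\<^sup>+s. ennreal (indicator {0<..} s * ((1 + s) powr (- A) * s powr (c - 1))) \<partial>lborel)"
    using G by (simp flip: ennreal_mult')
  also have "\<dots> = ennreal (1 / Gamma A) * (ennreal (Gamma c) * ennreal (Gamma (A - c)))"
    unfolding mult.assoc * ..
  also have "\<dots> = ennreal (Gamma c * Gamma (A - c) / Gamma A)"
    using G by (simp flip: ennreal_mult')
  finally show ?thesis .
qed

text \<open>Covers the exponents for which the integral diverges as \<open>z\<close> tends to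
  \<open>0\<close>, as happens for the derivative of the solution. Substituting
  \<open>t = z * s\<close> extracts the rate \<open>z powr (c - A)\<close>; the remaining factor
  \<open>exp (- (z * s))\<close> tends to \<open>1\<close> and is bounded by
  \<open>1\<close>.\<close>

lemma tricomi_integral_scaled_at_right_0:
  assumes c: "c > 0" and A: "A > c"
  shows "((\<lambda>z. z powr (A - c) * tricomi_integral (- A) c z) \<longlongrightarrow> Gamma c * Gamma (A - c) / Gamma A) (at_right 0)"
proof -
  let ?g = "\<lambda>s::real. indicator {0<..} s * ((1 + s) powr (- A) * s powr (c - 1))"
  let ?s = "\<lambda>z s::real. indicator {0<..} s * ((1 + s) powr (- A) * s powr (c - 1) * exp (- (z * s)))"
  have G: "Gamma A > 0" "Gamma c > 0" "Gamma (A - c) > 0" using c A by (auto intro: Gamma_real_pos)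
  have gi: "integrable lborel ?g" "integral\<^sup>L lborel ?g = Gamma c * Gamma (A - c) / Gamma A"
    using nn_integral_beta_prime[OF c A] G by (auto intro!: integrableI_nonneg simp: integral_eq_nn_integral)
  have "((\<lambda>z. integral\<^sup>L lborel (?s z)) \<longlongrightarrow> integral\<^sup>L lborel ?g) (at_right 0)"
  proof (rule integral_dominated_convergence_within[where w="?g"])
    fix s :: real
    have "((\<lambda>z. ?s z s) \<longlongrightarrow> indicator {0<..} s * ((1 + s) powr (- A) * s powr (c - 1) * exp (- (0 * s)))) (at_right 0)"
      by (intro tendsto_intros)
    then show "((\<lambda>z. ?s z s) \<longlongrightarrow> ?g s) (at_right 0)" by simp
  next
    have "\<forall>\<^sub>F z::real in at_right 0. z > 0" by (simp add: eventually_at_right_less)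
    then show "\<forall>\<^sub>F z in at_right 0. \<forall>s\<in>space lborel. norm (?s z s) \<le> ?g s"
      by eventually_elim (auto simp: indicator_def intro!: mult_left_le)
  qed (use gi in measurable)
  moreover have "\<forall>\<^sub>F z::real in at_right 0. integral\<^sup>L lborel (?s z) = z powr (A - c) * tricomi_integral (- A) c z"
  proof -
    have "\<forall>\<^sub>F z::real in at_right 0. z > 0" by (simp add: eventually_at_right_less)
    then show ?thesis
    proof eventually_elim
      case (elim z)
      have "tricomi_integral (- A) c z = z * (\<integral>s. tricomi_kernel (- A) c z (0 + z * s) \<partial>lborel)"
        unfolding tricomi_integral_def using elim by (subst lborel_integral_real_affine[where c=z and t=0]) auto
      also have "(\<integral>s. tricomi_kernel (- A) c z (0 + z * s) \<partial>lborel) = (\<integral>s. z powr (c - 1 - A) * ?s z s \<partial>lborel)"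
      proof (intro Bochner_Integration.integral_cong refl)
        fix s :: real
        show "tricomi_kernel (- A) c z (0 + z * s) = z powr (c - 1 - A) * ?s z s"
        proof (cases "s > 0")
          case True
          have "z + z * s = z * (1 + s)" by (simp add: algebra_simps)
          then show ?thesis using True elim
            by (simp add: tricomi_kernel_def powr_mult powr_diff powr_minus divide_simps)
        qed (use elim in \<open>simp add: tricomi_kernel_def zero_less_mult_iff\<close>)
      qed
      also have "\<dots> = z powr (c - 1 - A) * integral\<^sup>L lborel (?s z)" by simp
      finally have "z powr (A - c) * tricomi_integral (- A) c z = (z powr (A - c) * (z * z powr (c - 1 - A))) * integral\<^sup>L lborel (?s z)"
        by simp
      also have "z powr (A - c) * (z * z powr (c - 1 - A)) = 1"
        using elim by (simp add: powr_diff divide_simps)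
      finally show ?case by simp
    qed
  qed
  ultimately show ?thesis unfolding gi by (rule Lim_transform_eventually)
qed

text \<open>Abel's identity: a Wronskian \<open>W\<close> of Kummer's equation satisfies
  \<open>z W' = (z - b) W\<close>, so \<open>z powr b * exp (- z) * W\<close> is constant on the
  positive axis. Its value is found at \<open>0\<close>, where the exponential tends to
  \<open>1\<close> and may be dropped from the limit.\<close>

lemma kummer_wronskian_constant:
  fixes y y' y'' w w' w'' :: "real \<Rightarrow> real"
  assumes y: "\<And>z. z > 0 \<Longrightarrow> (y has_real_derivative y' z) (at z)"
      "\<And>z. z > 0 \<Longrightarrow> (y' has_real_derivative y'' z) (at z)"
      "\<And>z. z > 0 \<Longrightarrow> z * y'' z + (b - z) * y' z - a * y z = 0"
    and w: "\<And>z. z > 0 \<Longrightarrow> (w has_real_derivative w' z) (at z)"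
      "\<And>z. z > 0 \<Longrightarrow> (w' has_real_derivative w'' z) (at z)"
      "\<And>z. z > 0 \<Longrightarrow> z * w'' z + (b - z) * w' z - a * w z = 0"
    and lim: "((\<lambda>z. z powr b * (y z * w' z - y' z * w z)) \<longlongrightarrow> L) (at_right 0)"
    and z: "z > 0"
  shows "z powr b * exp (- z) * (y z * w' z - y' z * w z) = L"
proof -
  define W where "W z = z powr b * exp (- z) * (y z * w' z - y' z * w z)" for z
  have "\<exists>k. \<forall>x\<in>{0<..}. W x = k"
  proof (rule has_field_derivative_zero_constant)
    fix x :: real assume "x \<in> {0<..}"
    then have x: "x > 0" by simp
    have "(W has_real_derivative (b * x powr (b - 1) * exp (- x) * (y x * w' x - y' x * w x)
      - x powr b * exp (- x) * (y x * w' x - y' x * w x)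
      + x powr b * exp (- x) * (y' x * w' x + y x * w'' x - (y'' x * w x + y' x * w' x)))) (at x)"
      unfolding W_def using x
      by (auto intro!: derivative_eq_intros y w simp: algebra_simps)
    also have "x powr b = x * x powr (b - 1)" using x by (simp add: powr_diff)
    also have "(b * x powr (b - 1) * exp (- x) * (y x * w' x - y' x * w x)
      - x * x powr (b - 1) * exp (- x) * (y x * w' x - y' x * w x)
      + x * x powr (b - 1) * exp (- x) * (y' x * w' x + y x * w'' x - (y'' x * w x + y' x * w' x)))
     = x powr (b - 1) * exp (- x) * (y x * (x * w'' x + (b - x) * w' x - a * w x)
       - w x * (x * y'' x + (b - x) * y' x - a * y x))"
      by (simp add: algebra_simps)
    also have "\<dots> = 0" using y(3) w(3) x by simp
    finally show "(W has_real_derivative 0) (at x within {0<..})" by (rule DERIV_subset) auto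
  qed simp
  then obtain k where k: "\<And>x. x > 0 \<Longrightarrow> W x = k" by auto
  have "((\<lambda>z. exp (- z) * (z powr b * (y z * w' z - y' z * w z))) \<longlongrightarrow> exp (- 0) * L) (at_right 0)"
    by (intro tendsto_intros lim)
  then have "(W \<longlongrightarrow> L) (at_right 0)"
    by (simp add: W_def[abs_def] mult_ac)
  moreover have "\<forall>\<^sub>F x in at_right 0. W x = k"
    using eventually_at_right_less[of "0::real"] by eventually_elim (rule k)
  ultimately have "((\<lambda>x::real. k) \<longlongrightarrow> L) (at_right 0)" by (rule Lim_transform_eventually)
  then have "k = L" by (simp add: tendsto_const_iff)
  with k z show ?thesis by (simp add: W_def)
qed

section \<open>Behaviour at the origin and the representation for \<open>0 < b < 1\<close>\<close>

lemma tendsto_hypergeom_1F1_at_right_0: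
  assumes "b \<notin> \<int>"
  shows "(hypergeom_1F1 a b \<longlongrightarrow> 1) (at_right 0)"
proof -
  have "(hypergeom_1F1 a b \<longlongrightarrow> hypergeom_1F1 a b 0) (at 0)"
    using continuous_hypergeom_1F1[OF assms] by (simp add: isCont_def)
  then show ?thesis by (simp add: hypergeom_1F1_0 filterlim_at_split)
qed

text \<open>The substitution \<open>w = z powr (1 - b) * m\<close> turns Kummer's equation with
  parameters \<open>(a, b)\<close> into the one with parameters
  \<open>(a - b + 1, 2 - b)\<close>.\<close>

lemma kummer_ode_second_solution:
  fixes m m' m'' :: "real \<Rightarrow> real"
  assumes z: "z > 0"
    and m: "(m has_real_derivative m' z) (at z)" "(m' has_real_derivative m'' z) (at z)"
      "z * m'' z + (2 - b - z) * m' z - (a - b + 1) * m z = 0"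
  defines "w \<equiv> \<lambda>z. z powr (1 - b) * m z"
    and "w' \<equiv> \<lambda>z. z powr - b * ((1 - b) * m z + z * m' z)"
    and "w'' \<equiv> \<lambda>z. - b * z powr (- b - 1) * ((1 - b) * m z + z * m' z) + z powr - b * ((2 - b) * m' z + z * m'' z)"
  shows "(w has_real_derivative w' z) (at z)" "(w' has_real_derivative w'' z) (at z)"
    "z * w'' z + (b - z) * w' z - a * w z = 0"
proof -
  have p: "z powr (1 - b) = z * z powr - b" "z powr - b = z * z powr (- b - 1)"
    using z by (simp_all add: powr_diff powr_minus divide_simps)
  show "(w has_real_derivative w' z) (at z)"
    unfolding w_def w'_def using z p(1)
    by (auto intro!: derivative_eq_intros m simp: algebra_simps)
  show "(w' has_real_derivative w'' z) (at z)"
    unfolding w'_def w''_def using z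
    by (auto intro!: derivative_eq_intros m simp: algebra_simps)
  have "z * w'' z + (b - z) * w' z - a * w z =
      z * z powr - b * (z * m'' z + (2 - b - z) * m' z - (a - b + 1) * m z)"
    unfolding w_def w'_def w''_def p by (simp add: algebra_simps)
  then show "z * w'' z + (b - z) * w' z - a * w z = 0" using m(3) by simp
qed

text \<open>As \<open>z\<close> tends to \<open>0\<close>, \<open>y\<close> tends to
  \<open>1\<close> with a bounded derivative, \<open>w\<close> tends to \<open>0\<close> with
  \<open>z powr b * w'\<close> tending to \<open>1 - b\<close>, and the integral \<open>v\<close>
  tends to \<open>V0\<close> with \<open>z powr b * v'\<close> tending to \<open>V1\<close>. These
  limits determine the three Wronskians. The one of \<open>y\<close> and \<open>w\<close> is not
  zero, so it can be divided out, and the coefficients of \<open>v\<close> agree with those in the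
  definition of \<open>U\<close> by the functional equation of Gamma.\<close>

lemma tricomi_U_nonint_base:
  assumes b: "0 < b" "b < 1" and c: "a - b + 1 > 0" and z: "z > 0"
  shows "tricomi_U_nonint a b z = rGamma (a - b + 1) * tricomi_integral (- a) (a - b + 1) z"
proof -
  define c where "c = a - b + 1"
  have c0: "c > 0" using c by (simp add: c_def)
  have bZ: "b \<notin> \<int>"
    using b by (auto elim!: Ints_cases)
  have b2: "2 - b \<notin> \<int>" "b + 1 \<notin> \<int>" "2 - b + 1 \<notin> \<int>"
    using bZ Ints_diff[of 2 "2 - b"] Ints_diff[of 3 "2 - b + 1"] by auto
  have a1: "a + 1 > c" using b by (simp add: c_def)
  have dM: "((\<lambda>z. A / B * hypergeom_1F1 (A + 1) (B + 1) z) has_real_derivative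
      A / B * ((A + 1) / (B + 1) * hypergeom_1F1 (A + 2) (B + 2) z)) (at z)" if "B + 1 \<notin> \<int>" for A B z
    using DERIV_cmult[OF has_field_derivative_hypergeom_1F1[OF that, of "A + 1" z], of "A / B"]
    by (simp add: add.assoc)

  define y where "y = hypergeom_1F1 a b"
  define y' where "y' = (\<lambda>z. a / b * hypergeom_1F1 (a + 1) (b + 1) z)"
  define y'' where "y'' = (\<lambda>z. a / b * ((a + 1) / (b + 1) * hypergeom_1F1 (a + 2) (b + 2) z))"
  have y: "(y has_real_derivative y' z) (at z)" "(y' has_real_derivative y'' z) (at z)"
      "z * y'' z + (b - z) * y' z - a * y z = 0" for z
    unfolding y_def y'_def y''_def
    by (rule has_field_derivative_hypergeom_1F1[OF bZ] dM b2 hypergeom_1F1_kummer_ode[OF bZ])+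

  define m where "m = hypergeom_1F1 c (2 - b)"
  define m' where "m' = (\<lambda>z. c / (2 - b) * hypergeom_1F1 (c + 1) (2 - b + 1) z)"
  define m'' where "m'' = (\<lambda>z. c / (2 - b) * ((c + 1) / (2 - b + 1) * hypergeom_1F1 (c + 2) (2 - b + 2) z))"
  have m: "(m has_real_derivative m' z) (at z)" "(m' has_real_derivative m'' z) (at z)"
      "z * m'' z + (2 - b - z) * m' z - (a - b + 1) * m z = 0" for z
    unfolding m_def m'_def m''_def c_def[symmetric]
    by (rule has_field_derivative_hypergeom_1F1[OF b2(1)] dM b2(3) hypergeom_1F1_kummer_ode[OF b2(1)])+
  define w where "w = (\<lambda>z. z powr (1 - b) * m z)"
  define w' where "w' = (\<lambda>z. z powr - b * ((1 - b) * m z + z * m' z))"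
  define w'' where "w'' = (\<lambda>z. - b * z powr (- b - 1) * ((1 - b) * m z + z * m' z) + z powr - b * ((2 - b) * m' z + z * m'' z))"
  have w: "(w has_real_derivative w' z) (at z)" "(w' has_real_derivative w'' z) (at z)"
    "z * w'' z + (b - z) * w' z - a * w z = 0" if "z > 0" for z
    unfolding w_def w'_def w''_def by (rule kummer_ode_second_solution[OF that] m)+

  define v where "v = tricomi_integral (- a) c"
  define v' where "v' = (\<lambda>z. - a * tricomi_integral (- a - 1) c z)"
  define v'' where "v'' = (\<lambda>z. - a * ((- a - 1) * tricomi_integral (- 2 - a) c z))"
  have v: "(v has_real_derivative v' z) (at z)" "(v' has_real_derivative v'' z) (at z)"
    "z * v'' z + (b - z) * v' z - a * v z = 0" if "z > 0" for z
  proof -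
    show "(v has_real_derivative v' z) (at z)" unfolding v_def v'_def
      by (rule has_real_derivative_tricomi_integral[OF that c0])
    show "(v' has_real_derivative v'' z) (at z)" unfolding v'_def v''_def
      using DERIV_cmult[OF has_real_derivative_tricomi_integral[OF that c0, of "- a - 1"], of "- a"]
      by simp
    have "tricomi_integral (- a) c z = (c + (- a - 1) + z) * tricomi_integral (- a - 1) c z
        - (- a - 1) * z * tricomi_integral (- 2 - a) c z"
      using tricomi_integral_recurrence[OF that c0, of "- a - 1"] by simp
    moreover have "z * v'' z + (b - z) * v' z - a * v z = a * ((c + (- a - 1) + z) * tricomi_integral (- a - 1) c z
        - (- a - 1) * z * tricomi_integral (- 2 - a) c z - tricomi_integral (- a) c z)"
      unfolding v_def v'_def v''_def by (simp add: c_def algebra_simps)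
    ultimately show "z * v'' z + (b - z) * v' z - a * v z = 0" by simp
  qed

  \<comment> \<open>The integral in \<open>v'\<close> has exponent \<open>- (a + 1)\<close> and
    grows like \<open>z powr - (a + 1 - c) = z powr - b\<close>, which explains the
    \<open>Gamma b\<close> in \<open>V1\<close>.\<close>
  define V0 where "V0 = Gamma (1 - b)"
  define V1 where "V1 = - a * (Gamma c * Gamma b / Gamma (a + 1))"
  have lim_p: "((\<lambda>z. z powr b) \<longlongrightarrow> 0) (at_right 0)" "((\<lambda>z. z powr (1 - b)) \<longlongrightarrow> 0) (at_right 0)"
    using b by (auto intro!: tendsto_eq_intros tendsto_powr' eventually_mono[OF eventually_at_right_less])
  have lim_v: "(v \<longlongrightarrow> V0) (at_right 0)"
    using tricomi_integral_at_right_0[of c "- a"] c0 b by (simp add: v_def V0_def c_def)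
  have "((\<lambda>z. - a * (z powr (a + 1 - c) * tricomi_integral (- (a + 1)) c z)) \<longlongrightarrow> - a * (Gamma c * Gamma (a + 1 - c) / Gamma (a + 1))) (at_right 0)"
    by (intro tendsto_mult_left tricomi_integral_scaled_at_right_0 c0 a1)
  then have lim_v': "((\<lambda>z. z powr b * v' z) \<longlongrightarrow> V1) (at_right 0)"
    by (simp add: v'_def V1_def c_def mult_ac)
  have lim_y: "(y \<longlongrightarrow> 1) (at_right 0)" "(y' \<longlongrightarrow> a / b * 1) (at_right 0)"
    unfolding y_def y'_def by (intro tendsto_mult_left tendsto_hypergeom_1F1_at_right_0 bZ b2)+
  have lim_m: "(m \<longlongrightarrow> 1) (at_right 0)" "(m' \<longlongrightarrow> c / (2 - b) * 1) (at_right 0)"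
    unfolding m_def m'_def by (intro tendsto_mult_left tendsto_hypergeom_1F1_at_right_0 b2)+
  have "((\<lambda>z. (1 - b) * m z + z * m' z) \<longlongrightarrow> (1 - b) * 1 + 0 * (c / (2 - b) * 1)) (at_right 0)"
    by (intro tendsto_intros lim_m)
  moreover have "\<forall>\<^sub>F z in at_right 0. (1 - b) * m z + z * m' z = z powr b * w' z"
    using eventually_at_right_less[of "0::real"] by eventually_elim (simp add: w'_def powr_minus)
  ultimately have lim_w': "((\<lambda>z. z powr b * w' z) \<longlongrightarrow> 1 - b) (at_right 0)"
    using Lim_transform_eventually by fastforce
  have lim_w: "(w \<longlongrightarrow> 0) (at_right 0)"
    unfolding w_def using tendsto_mult[OF lim_p(2) lim_m(1)] by simp

  have 1: "((\<lambda>z. z powr b * (v z * y' z - v' z * y z)) \<longlongrightarrow> - V1) (at_right 0)"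
    using tendsto_diff[OF tendsto_mult[OF lim_p(1) tendsto_mult[OF lim_v lim_y(2)]] tendsto_mult[OF lim_v' lim_y(1)]]
    by (simp add: algebra_simps)
  have 2: "((\<lambda>z. z powr b * (v z * w' z - v' z * w z)) \<longlongrightarrow> V0 * (1 - b)) (at_right 0)"
    using tendsto_diff[OF tendsto_mult[OF lim_v lim_w'] tendsto_mult[OF lim_v' lim_w]]
    by (simp add: algebra_simps)
  have 3: "((\<lambda>z. z powr b * (y z * w' z - y' z * w z)) \<longlongrightarrow> (1 - b)) (at_right 0)"
    using tendsto_diff[OF tendsto_mult[OF lim_y(1) lim_w'] tendsto_mult[OF lim_p(1) tendsto_mult[OF lim_y(2) lim_w]]]
    by (simp add: algebra_simps)
  define E where "E = z powr b * exp (- z)"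
  have W1: "E * (v z * y' z - v' z * y z) = - V1"
    unfolding E_def by (rule kummer_wronskian_constant[OF v y 1 z])
  have W2: "E * (v z * w' z - v' z * w z) = V0 * (1 - b)"
    unfolding E_def by (rule kummer_wronskian_constant[OF v w 2 z])
  have W3: "E * (y z * w' z - y' z * w z) = 1 - b"
    unfolding E_def by (rule kummer_wronskian_constant[OF y w 3 z])
  (* v W(y, w) = y W(v, w) - w W(v, y) expresses v in the basis y, w. *)
  have "v z * (1 - b) = y z * (E * (v z * w' z - v' z * w z)) - w z * (E * (v z * y' z - v' z * y z))"
    unfolding W3[symmetric] by (simp add: algebra_simps)
  also have "\<dots> = y z * (V0 * (1 - b)) + w z * V1" unfolding W1 W2 by simp
  finally have v_eq: "v z = V0 * y z + V1 / (1 - b) * w z" using b by (simp add: field_simps)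

  have G: "rGamma c * Gamma c = 1"
    using c0 by (simp add: rGamma_inverse_Gamma Gamma_eq_zero_iff nonpos_Ints_def)
  have nb: "b - 1 \<notin> \<int>\<^sub>\<le>\<^sub>0"
  proof
    assume "b - 1 \<in> \<int>\<^sub>\<le>\<^sub>0"
    then have "b - 1 \<in> \<int>" by (rule nonpos_Ints_Int)
    then show False using bZ by simp
  qed
  have Gb: "Gamma b = (b - 1) * Gamma (b - 1)"
    using Gamma_plus1[OF nb] by simp
  \<comment> \<open>Written with \<open>rGamma\<close> so as to include \<open>a = 0\<close>, where
    both sides vanish.\<close>
  have Ga: "rGamma a = a * rGamma (a + 1)" using rGamma_plus1[of a] by simp
  have "rGamma c * (V1 / (1 - b)) = (rGamma c * Gamma c) * (- a * Gamma b * rGamma (a + 1)) / (1 - b)"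
    by (simp add: V1_def rGamma_inverse_Gamma divide_inverse)
  also have "\<dots> = Gamma (b - 1) * rGamma a"
    unfolding G Gb Ga using b by (simp add: divide_simps) (simp add: algebra_simps)
  finally have *: "rGamma c * (V1 / (1 - b)) = Gamma (b - 1) * rGamma a" .
  have "rGamma c * v z = rGamma c * (V1 / (1 - b)) * w z + Gamma (1 - b) * rGamma c * y z"
    unfolding v_eq V0_def by (simp add: algebra_simps)
  then show ?thesis
    unfolding * by (simp add: v_def w_def y_def m_def tricomi_U_nonint_def c_def mult_ac)
qed

section \<open>From \<open>0 < b < 1\<close> to the remaining parameters \<open>b\<close>\<close>

lemma tendsto_tricomi_U_nonint_at_right_0:
  assumes b: "b \<notin> \<int>" "b < 1"
  shows "(tricomi_U_nonint a b \<longlongrightarrow> Gamma (1 - b) * rGamma (a - b + 1)) (at_right 0)"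
proof -
  have b2: "2 - b \<notin> \<int>" using b Ints_diff[of 2 "2 - b"] by auto
  have "((\<lambda>x. x powr (1 - b)) \<longlongrightarrow> 0) (at_right 0)"
    using b by (auto intro!: tendsto_eq_intros tendsto_powr' eventually_mono[OF eventually_at_right_less])
  then have "((\<lambda>x. Gamma (b - 1) * rGamma a * x powr (1 - b) * hypergeom_1F1 (a - b + 1) (2 - b) x +
     Gamma (1 - b) * rGamma (a - b + 1) * hypergeom_1F1 a b x) \<longlongrightarrow>
     Gamma (b - 1) * rGamma a * 0 * 1 + Gamma (1 - b) * rGamma (a - b + 1) * 1) (at_right 0)"
    by (intro tendsto_intros tendsto_hypergeom_1F1_at_right_0 b b2)
  then show ?thesis by (simp add: tricomi_U_nonint_def[abs_def])
qed

text \<open>Downward induction in unit steps of \<open>b\<close>. The difference \<open>D\<close> of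
  the two sides has derivative \<open>0\<close>, by the hypothesis for
  \<open>(a + 1, b + 1)\<close>, hence is constant; the constant is \<open>0\<close> because both
  sides have the limit \<open>Gamma (1 - b) * rGamma (a - b + 1)\<close> at the origin.\<close>

lemma tricomi_U_nonint_integral_less_1:
  assumes "b \<notin> \<int>" "b < 1" "- real n < b" "a - b + 1 > 0" "z > 0"
  shows "tricomi_U_nonint a b z = rGamma (a - b + 1) * tricomi_integral (- a) (a - b + 1) z"
  using assms
proof (induction n arbitrary: a b z)
  case 0
  then show ?case by (intro tricomi_U_nonint_base) auto
next
  case (Suc n)
  show ?case
  proof (cases "b > 0")
    case True
    then show ?thesis using Suc.prems by (intro tricomi_U_nonint_base) auto
  next
    case False
    then have b0: "b < 0" using Suc.prems(1) by (cases "b = 0") auto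
    define c where "c = a - b + 1"
    have c0: "c > 0" using Suc.prems c_def by simp
    define D where "D x = tricomi_U_nonint a b x - rGamma c * tricomi_integral (- a) c x" for x
    have IH: "tricomi_U_nonint (a + 1) (b + 1) x = rGamma c * tricomi_integral (- a - 1) c x" if "x > 0" for x
      using Suc.IH[of "b + 1" "a + 1" x] Suc.prems b0 that by (simp add: c_def)
    have "\<exists>k. \<forall>x\<in>{0<..}. D x = k"
    proof (rule has_field_derivative_zero_constant)
      fix x :: real assume "x \<in> {0<..}"
      then have x: "x > 0" by simp
      have "(D has_real_derivative - a * tricomi_U_nonint (a + 1) (b + 1) x - rGamma c * (- a * tricomi_integral (- a - 1) c x)) (at x)"
        unfolding D_def using Suc.prems x c0
        by (intro DERIV_diff DERIV_cmult has_field_derivative_tricomi_U_nonint has_real_derivative_tricomi_integral)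
      then have "(D has_real_derivative 0) (at x)" by (simp add: IH[OF x])
      then show "(D has_real_derivative 0) (at x within {0<..})" by (rule DERIV_subset) auto
    qed simp
    then obtain k where k: "\<And>x. x > 0 \<Longrightarrow> D x = k" by auto
    have "(D \<longlongrightarrow> Gamma (1 - b) * rGamma (a - b + 1) - rGamma c * Gamma (- a + c)) (at_right 0)"
      unfolding D_def using Suc.prems c0 b0
      by (intro tendsto_diff tendsto_mult_left tendsto_tricomi_U_nonint_at_right_0 tricomi_integral_at_right_0)
        (auto simp: c_def)
    moreover have "\<forall>\<^sub>F x in at_right 0. D x = k"
      using eventually_at_right_less[of "0::real"] by eventually_elim (rule k)
    ultimately have "((\<lambda>x::real. k) \<longlongrightarrow> Gamma (1 - b) * rGamma (a - b + 1) - rGamma c * Gamma (- a + c)) (at_right 0)"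
      by (rule Lim_transform_eventually)
    then have "k = 0" by (simp add: tendsto_const_iff c_def)
    with k[OF Suc.prems(5)] show ?thesis by (simp add: D_def c_def)
  qed
qed

text \<open>The derivative formula with parameters \<open>a - 1\<close>, \<open>b - 1\<close> carries the factor \<open>a - 1\<close>, whence \<open>a \<noteq> 1\<close>.\<close>

lemma tricomi_U_nonint_integral_between_1_2:
  assumes b: "1 < b" "b < 2" and c: "a - b + 1 > 0" and a: "a \<noteq> 1" and z: "z > 0"
  shows "tricomi_U_nonint a b z = rGamma (a - b + 1) * tricomi_integral (- a) (a - b + 1) z"
proof -
  define c where "c = a - b + 1"
  have c0: "c > 0" using c by (simp add: c_def)
  have bZ: "b - 1 \<notin> \<int>"
    using b by (auto elim!: Ints_cases)
  have "((\<lambda>z. rGamma c * tricomi_integral (- (a - 1)) c z) has_real_derivative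
      rGamma c * (- (a - 1) * tricomi_integral (- (a - 1) - 1) c z)) (at z)"
    by (intro DERIV_cmult has_real_derivative_tricomi_integral z c0)
  then have "((\<lambda>z. rGamma c * tricomi_integral (- (a - 1)) c z) has_real_derivative
      rGamma c * (- (a - 1) * tricomi_integral (- a) c z)) (at z)" by simp
  then have "(tricomi_U_nonint (a - 1) (b - 1) has_real_derivative
      rGamma c * (- (a - 1) * tricomi_integral (- a) c z)) (at z)"
  proof (rule has_field_derivative_transform_within_open[of _ _ _ "{0<..}"])
    show "rGamma c * tricomi_integral (- (a - 1)) c x = tricomi_U_nonint (a - 1) (b - 1) x" if "x \<in> {0<..}" for x
      using tricomi_U_nonint_base[of "b - 1" "a - 1" x] b c that by (simp add: c_def algebra_simps)
  qed (use z in auto)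
  moreover have "(tricomi_U_nonint (a - 1) (b - 1) has_real_derivative
      - (a - 1) * tricomi_U_nonint (a - 1 + 1) (b - 1 + 1) z) (at z)"
    by (rule has_field_derivative_tricomi_U_nonint[OF bZ z])
  ultimately have "rGamma c * (- (a - 1) * tricomi_integral (- a) c z) = - (a - 1) * tricomi_U_nonint (a - 1 + 1) (b - 1 + 1) z"
    by (rule DERIV_unique)
  then have "(a - 1) * (rGamma c * tricomi_integral (- a) c z) = (a - 1) * tricomi_U_nonint a b z"
    by simp
  then show ?thesis using a by (simp add: c_def)
qed

text \<open>In a punctured neighbourhood of the integer \<open>b\<close> the second parameter is not
  an integer, and there \<open>U\<close> equals an expression in the shape \<open>a - x + 1\<close>
  that is continuous up to \<open>x = b\<close>.\<close>

lemma tricomi_U_pos_integral: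
  assumes al: "\<alpha> > 0" and be: "\<beta> > 0" and ab: "\<alpha> + \<beta> \<in> \<int>" and z: "z > 0"
  shows "tricomi_U_pos (1 - \<alpha>) (2 - \<alpha> - \<beta>) z = rGamma \<beta> * tricomi_integral (\<alpha> - 1) \<beta> z"
proof -
  define a where "a = 1 - \<alpha>"
  define b where "b = 2 - \<alpha> - \<beta>"
  obtain k :: int where k: "\<alpha> + \<beta> = of_int k" using ab by (auto elim: Ints_cases)
  have k1: "k \<ge> 1" using al be k by (metis add_pos_pos int_one_le_iff_zero_less of_int_0_less_iff)
  have bk: "b = of_int (2 - k)" using k by (simp add: b_def)
  have bZ: "b \<in> \<int>" unfolding bk by simp
  \<comment> \<open>Radius \<open>1\<close> keeps the other integers out, and
    \<open>x < a + 1\<close> keeps the shape \<open>a - x + 1\<close> positive.\<close>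
  have "\<forall>\<^sub>F x in at b. x \<in> {b - 1<..<b + 1} \<inter> {..<a + 1}"
    using be by (intro eventually_at_in_open') (auto simp: a_def b_def)
  then have ev: "\<forall>\<^sub>F x in at b. rGamma (a - x + 1) * tricomi_integral (- a) (a - x + 1) z = tricomi_U_nonint a x z"
    using eventually_neq_at_within[of b b UNIV]
  proof eventually_elim
    case (elim x)
    have xZ: "x \<notin> \<int>"
    proof
      assume "x \<in> \<int>"
      then obtain i where i: "x = of_int i" by (auto elim: Ints_cases)
      have "real_of_int i < of_int (3 - k)" "real_of_int i > of_int (1 - k)" using elim unfolding i bk by auto
      then have "i < 3 - k" "i > 1 - k" by (simp_all only: of_int_less_iff)
      then have "i = 2 - k" by simp
      then show False using elim i bk by simp
    qed
    \<comment> \<open>Points \<open>x > 1\<close> can therefore be met for \<open>b = 1\<close>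
      only. The other representation then needs \<open>a \<noteq> 1\<close>, which
      \<open>a = 1 - \<alpha>\<close> with \<open>\<alpha> > 0\<close> provides.\<close>
    have "b = 1 \<or> b \<le> 0" using k1 unfolding bk by (cases "k = 1") auto
    show ?case
    proof (cases "x < 1")
      case True
      obtain n where "- x < real n" using reals_Archimedean2 by blast
      then show ?thesis using True xZ elim z
        by (subst tricomi_U_nonint_integral_less_1[of _ n]) auto
    next
      case False
      then have "x > 1" using xZ by (cases "x = 1") auto
      with \<open>b = 1 \<or> b \<le> 0\<close> have "b = 1" using elim by auto
      then have "a \<noteq> 1" "x < 2" using al elim by (auto simp: a_def)
      then show ?thesis using \<open>x > 1\<close> elim z
        by (subst tricomi_U_nonint_integral_between_1_2) auto
    qed
  qed
  have lin: "filterlim (\<lambda>x. a - x + 1) (at \<beta>) (at b)"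
    unfolding filterlim_at
    by (auto intro!: tendsto_eq_intros simp: a_def b_def eventually_at_filter)
  have "((\<lambda>x. rGamma (a - x + 1) * tricomi_integral (- a) (a - x + 1) z) \<longlongrightarrow>
      rGamma \<beta> * tricomi_integral (- a) \<beta> z) (at b)"
    using filterlim_compose[OF continuous_tricomi_integral_shape[OF z be] lin]
    by (intro tendsto_mult isCont_tendsto_compose[OF isCont_rGamma]) (auto intro!: tendsto_eq_intros simp: a_def b_def)
  then have "((\<lambda>x. tricomi_U_nonint a x z) \<longlongrightarrow> rGamma \<beta> * tricomi_integral (- a) \<beta> z) (at b)"
    by (rule Lim_transform_eventually[OF _ ev])
  then have "Lim (at b) (\<lambda>x. tricomi_U_nonint a x z) = rGamma \<beta> * tricomi_integral (- a) \<beta> z"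
    by (intro tendsto_Lim) auto
  then show ?thesis using bZ by (simp add: tricomi_U_pos_def a_def b_def)
qed

section \<open>Tricomi's integral in \<open>ennreal\<close> and its value at the origin\<close>

lemma nn_integral_tricomi_kernel:
  assumes "z > 0" "\<beta> > 0"
  shows "(\<integral>\<^sup>+t. ennreal (tricomi_kernel p \<beta> z t) \<partial>lborel) = ennreal (tricomi_integral p \<beta> z)"
  unfolding tricomi_integral_def
  by (intro nn_integral_eq_integral integrable_tricomi_kernel assms) (auto simp: tricomi_kernel_nonneg)

text \<open>For \<open>z \<le> \<epsilon> \<le> t \<le> 1\<close> one has
  \<open>z + t \<le> 2 * t\<close>, and since the exponents \<open>\<alpha> - 1\<close> and
  \<open>\<beta> - 1\<close> add up to \<open>- 1\<close>, the kernel is at least a constant over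
  \<open>t\<close>. Uniformity in \<open>z\<close> lets one estimate prove both the divergence of
  the integral at \<open>z = 0\<close> and the growth of \<open>U\<close> as \<open>z\<close> tends
  to \<open>0\<close>.\<close>

lemma tricomi_kernel_log_bound:
  assumes al: "\<alpha> < 1" and ab: "\<alpha> + \<beta> = 1" and z: "0 \<le> z" "z \<le> \<epsilon>" and e: "0 < \<epsilon>" "\<epsilon> < 1"
  shows "ennreal (2 powr (\<alpha> - 1) * exp (- 1) * - ln \<epsilon>) \<le> (\<integral>\<^sup>+t. ennreal (tricomi_kernel (\<alpha> - 1) \<beta> z t) \<partial>lborel)"
proof -
  define K where "K = 2 powr (\<alpha> - 1) * exp (- 1 :: real)"
  have K: "K > 0" by (simp add: K_def)
  have "(\<integral>\<^sup>+t. ennreal (K / t) * indicator {\<epsilon>..1} t \<partial>lborel) = ennreal (K * ln 1 - K * ln \<epsilon>)"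
    using e K by (intro nn_integral_FTC_Icc) (auto intro!: derivative_eq_intros)
  then have "ennreal (K * - ln \<epsilon>) = (\<integral>\<^sup>+t. ennreal (K / t) * indicator {\<epsilon>..1} t \<partial>lborel)"
    by simp
  also have "\<dots> \<le> (\<integral>\<^sup>+t. ennreal (tricomi_kernel (\<alpha> - 1) \<beta> z t) \<partial>lborel)"
  proof (intro nn_integral_mono)
    fix t :: real
    show "ennreal (K / t) * indicator {\<epsilon>..1} t \<le> ennreal (tricomi_kernel (\<alpha> - 1) \<beta> z t)"
    proof (cases "t \<in> {\<epsilon>..1}")
      case True
      then have t: "t > 0" "t \<le> 1" "z \<le> t" using e z by auto
      have "2 powr (\<alpha> - 1) * t powr (\<alpha> - 1) = (2 * t) powr (\<alpha> - 1)" using t by (simp add: powr_mult)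
      also have "\<dots> \<le> (z + t) powr (\<alpha> - 1)" using t z al by (intro powr_mono2') auto
      finally have 1: "2 powr (\<alpha> - 1) * t powr (\<alpha> - 1) \<le> (z + t) powr (\<alpha> - 1)" .
      have b1: "\<beta> - 1 = - \<alpha>" using ab by simp
      have "K / t = 2 powr (\<alpha> - 1) * t powr (\<alpha> - 1) * (t powr (\<beta> - 1) * exp (- 1))"
        using t unfolding b1 by (simp add: K_def powr_diff powr_minus divide_simps)
      also have "\<dots> \<le> (z + t) powr (\<alpha> - 1) * (t powr (\<beta> - 1) * exp (- t))"
        using t by (intro mult_mono 1) auto
      finally have "K / t \<le> tricomi_kernel (\<alpha> - 1) \<beta> z t" using t by (simp add: tricomi_kernel_def mult.assoc)
      then show ?thesis using True by (simp add: ennreal_leI)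
    qed simp
  qed
  finally show ?thesis unfolding K_def .
qed

lemma nn_integral_tricomi_kernel_top:
  assumes al: "\<alpha> < 1" and ab: "\<alpha> + \<beta> = 1"
  shows "(\<integral>\<^sup>+t. ennreal (tricomi_kernel (\<alpha> - 1) \<beta> 0 t) \<partial>lborel) = \<top>"
    (is "?I = _")
proof (rule ccontr)
  assume "?I \<noteq> \<top>"
  then obtain r where r: "?I = ennreal r" "r \<ge> 0" by (cases ?I) auto
  define K where "K = 2 powr (\<alpha> - 1) * exp (- 1 :: real)"
  have K: "K > 0" by (simp add: K_def)
  \<comment> \<open>Chosen to make the logarithmic lower bound equal to \<open>r + 1\<close>, beyond
    the supposed value \<open>r\<close>.\<close>
  define e where "e = exp (- ((r + 1) / K))"
  have "ennreal (K * - ln e) \<le> ?I"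
    unfolding K_def using al ab by (rule tricomi_kernel_log_bound) (use r K in \<open>auto simp: e_def\<close>)
  also have "K * - ln e = r + 1" using K by (simp add: e_def)
  finally show False using r by (simp add: ennreal_le_iff)
qed

lemma nn_integral_tricomi_kernel_0:
  assumes ab: "\<alpha> + \<beta> > 1"
  shows "(\<integral>\<^sup>+t. ennreal (tricomi_kernel (\<alpha> - 1) \<beta> 0 t) \<partial>lborel) = ennreal (Gamma (\<alpha> - 1 + \<beta>))"
proof -
  have "(\<integral>\<^sup>+t. ennreal (tricomi_kernel (\<alpha> - 1) \<beta> 0 t) \<partial>lborel) =
    (\<integral>\<^sup>+t. ennreal (indicator {0<..} t * (t powr (\<alpha> - 1 + \<beta> - 1) * exp (- (1 * t)))) \<partial>lborel)"
    by (intro nn_integral_cong) (auto simp: tricomi_kernel_def indicator_def algebra_simps simp flip: powr_add)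
  also have "\<dots> = ennreal (Gamma (\<alpha> - 1 + \<beta>))"
    using ab by (subst nn_integral_Gamma_rate) auto
  finally show ?thesis .
qed

text \<open>Only \<open>z = 0\<close> goes beyond the preceding representation. If
  \<open>\<alpha> + \<beta> = 1\<close>, then both sides are infinite by the logarithmic bound;
  otherwise integrality gives \<open>\<alpha> + \<beta> > 1\<close>, and both sides are
  \<open>rGamma \<beta> * Gamma (\<alpha> - 1 + \<beta>)\<close>.\<close>

lemma tricomi_U_eq_nn_integral:
  assumes al: "\<alpha> > 0" and be: "\<beta> > 0" and ab: "\<alpha> + \<beta> \<in> \<int>" and z: "z \<ge> 0"
  shows "tricomi_U (1 - \<alpha>) (2 - \<alpha> - \<beta>) z =
    enn2ereal (ennreal (rGamma \<beta>) * (\<integral>\<^sup>+t. ennreal (tricomi_kernel (\<alpha> - 1) \<beta> z t) \<partial>lborel))"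
proof (cases "z = 0")
  case False
  have rG: "rGamma \<beta> \<ge> 0" using be by (simp add: rGamma_inverse_Gamma Gamma_real_nonneg)
  have "tricomi_integral (\<alpha> - 1) \<beta> z \<ge> 0"
    unfolding tricomi_integral_def by (intro Bochner_Integration.integral_nonneg tricomi_kernel_nonneg)
  then have "enn2ereal (ennreal (rGamma \<beta>) * (\<integral>\<^sup>+t. ennreal (tricomi_kernel (\<alpha> - 1) \<beta> z t) \<partial>lborel)) =
     ereal (rGamma \<beta> * tricomi_integral (\<alpha> - 1) \<beta> z)"
    using False z be rG by (subst nn_integral_tricomi_kernel) (simp_all flip: ennreal_mult')
  then show ?thesis using False z tricomi_U_pos_integral[OF al be ab, of z] by (simp add: tricomi_U_def)
next
  case True
  have rG: "rGamma \<beta> > 0" using be by (simp add: rGamma_inverse_Gamma Gamma_real_pos)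
  have ev0: "\<forall>\<^sub>F t::real in at_right 0. t > 0" by (rule eventually_at_right_less)
  obtain k :: int where k: "\<alpha> + \<beta> = of_int k" using ab by (auto elim: Ints_cases)
  have k1: "k \<ge> 1" using al be k by (metis add_pos_pos int_one_le_iff_zero_less of_int_0_less_iff)
  show ?thesis
  proof (cases "\<alpha> + \<beta> = 1")
    case a1: True
    let ?I = "\<lambda>z. \<integral>\<^sup>+t. ennreal (tricomi_kernel (\<alpha> - 1) \<beta> z t) \<partial>lborel"
    define K where "K = 2 powr (\<alpha> - 1) * exp (- 1 :: real)"
    have K: "K > 0" by (simp add: K_def)
    have al1: "\<alpha> < 1" using a1 be by simp
    have "?I 0 = \<top>" using al1 a1 by (rule nn_integral_tricomi_kernel_top)
    moreover have "tricomi_U (1 - \<alpha>) (2 - \<alpha> - \<beta>) 0 = \<infinity>"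
    proof -
      have "filterlim (\<lambda>t. rGamma \<beta> * (K * - ln t)) at_top (at_right 0)"
        using rG K by real_asymp
      moreover have "\<forall>\<^sub>F t::real in at_right 0. t \<in> {0<..<1}"
        by (rule eventually_at_right_real) simp
      \<comment> \<open>The logarithmic bound is used with \<open>z\<close> and
        \<open>\<epsilon>\<close> both equal to \<open>t\<close>.\<close>
      then have "\<forall>\<^sub>F t in at_right 0. rGamma \<beta> * (K * - ln t) \<le> tricomi_U_pos (1 - \<alpha>) (2 - \<alpha> - \<beta>) t"
      proof eventually_elim
        case (elim t)
        have "ennreal (K * - ln t) \<le> ?I t"
          unfolding K_def using al1 a1 by (rule tricomi_kernel_log_bound) (use elim in auto)
        also have "\<dots> = ennreal (tricomi_integral (\<alpha> - 1) \<beta> t)"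
          using elim be by (intro nn_integral_tricomi_kernel) auto
        finally have "K * - ln t \<le> tricomi_integral (\<alpha> - 1) \<beta> t"
          by (subst (asm) ennreal_le_iff) (auto simp: tricomi_integral_def intro!: Bochner_Integration.integral_nonneg tricomi_kernel_nonneg)
        then have "rGamma \<beta> * (K * - ln t) \<le> rGamma \<beta> * tricomi_integral (\<alpha> - 1) \<beta> t"
          using rG by (intro mult_left_mono) auto
        then show ?case
          using tricomi_U_pos_integral[OF al be ab, of t] elim by simp
      qed
      ultimately have "filterlim (tricomi_U_pos (1 - \<alpha>) (2 - \<alpha> - \<beta>)) at_top (at_right 0)"
        by (rule filterlim_at_top_mono)
      then have "((\<lambda>t. ereal (tricomi_U_pos (1 - \<alpha>) (2 - \<alpha> - \<beta>) t)) \<longlongrightarrow> \<infinity>) (at_right 0)"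
        by (simp add: tendsto_PInfty_eq_at_top)
      then show ?thesis by (simp add: tricomi_U_def tendsto_Lim)
    qed
    ultimately show ?thesis using True rG by (simp add: ennreal_mult_top)
  next
    case a1: False
    have k2: "\<alpha> + \<beta> > 1" using a1 k1 k by (cases "k = 1") auto
    have G: "Gamma (\<alpha> - 1 + \<beta>) \<ge> 0" using k2 by (intro Gamma_real_nonneg) auto
    have "((\<lambda>t. rGamma \<beta> * tricomi_integral (\<alpha> - 1) \<beta> t) \<longlongrightarrow> rGamma \<beta> * Gamma (\<alpha> - 1 + \<beta>)) (at_right 0)"
      using k2 be by (intro tendsto_mult_left tricomi_integral_at_right_0) auto
    moreover have "\<forall>\<^sub>F t in at_right 0. rGamma \<beta> * tricomi_integral (\<alpha> - 1) \<beta> t = tricomi_U_pos (1 - \<alpha>) (2 - \<alpha> - \<beta>) t"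
      using ev0 by eventually_elim (simp add: tricomi_U_pos_integral[OF al be ab])
    ultimately have "(tricomi_U_pos (1 - \<alpha>) (2 - \<alpha> - \<beta>) \<longlongrightarrow> rGamma \<beta> * Gamma (\<alpha> - 1 + \<beta>)) (at_right 0)"
      by (rule Lim_transform_eventually)
    then have "tricomi_U (1 - \<alpha>) (2 - \<alpha> - \<beta>) 0 = ereal (rGamma \<beta> * Gamma (\<alpha> - 1 + \<beta>))"
      by (simp add: tricomi_U_def tendsto_Lim)
    moreover have "(\<integral>\<^sup>+t. ennreal (tricomi_kernel (\<alpha> - 1) \<beta> 0 t) \<partial>lborel) = ennreal (Gamma (\<alpha> - 1 + \<beta>))"
      using k2 by (rule nn_integral_tricomi_kernel_0)
    ultimately show ?thesis using True rG G by (simp flip: ennreal_mult')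
  qed
qed

subsection \<open>Noncentral Gamma densities\<close>

text \<open>Here \<open>r\<close> is the shape and \<open>p\<close> the rate.\<close>

definition gamma_density :: "real \<Rightarrow> real \<Rightarrow> real \<Rightarrow> ennreal" where
  "gamma_density r p x = ennreal (indicator {0<..} x * (p powr r / Gamma r * (x powr (r - 1) * exp (- (p * x)))))"

lemma measurable_gamma_density [measurable]: "gamma_density r p \<in> borel_measurable borel"
  unfolding gamma_density_def by measurable

lemma nn_integral_gamma_density:
  assumes r: "r > 0" and p: "p > 0"
  shows "(\<integral>\<^sup>+x. gamma_density r p x \<partial>lborel) = 1"
proof -
  have G: "Gamma r > 0" using r by (rule Gamma_real_pos)
  have "(\<integral>\<^sup>+x. gamma_density r p x \<partial>lborel) =
    (\<integral>\<^sup>+x. ennreal (p powr r / Gamma r) * ennreal (indicator {0<..} x * (x powr (r - 1) * exp (- (p * x)))) \<partial>lborel)"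
    using G by (intro nn_integral_cong) (simp add: gamma_density_def mult_ac flip: ennreal_mult')
  also have "\<dots> = ennreal (p powr r / Gamma r) * ennreal (Gamma r / p powr r)"
    using r p by (subst nn_integral_cmult) (simp_all add: nn_integral_Gamma_rate)
  also have "\<dots> = 1" using G p by (simp flip: ennreal_mult')
  finally show ?thesis .
qed

lemma nn_integral_Beta:
  fixes a b :: real
  assumes "a > 0" "b > 0"
  shows "(\<integral>\<^sup>+t. ennreal (indicator {0..1} t * (t powr (a - 1) * (1 - t) powr (b - 1))) \<partial>lborel) = ennreal (Beta a b)"
  using nn_integral_has_integral_lebesgue[OF _ has_integral_Beta_real[OF assms]] by simp

text \<open>Because the rates agree, the exponentials multiply to \<open>exp (- (p * x))\<close>,
  free of \<open>y\<close>; with \<open>y = x * t\<close> a Beta integral remains. The end points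
  \<open>t = 0\<close> and \<open>t = 1\<close> are discarded as null sets.\<close>

lemma gamma_density_convolution:
  assumes r: "r > 0" and s: "s > 0" and p: "p > 0"
  shows "(\<integral>\<^sup>+y. gamma_density r p (x - y) * gamma_density s p y \<partial>lborel) = gamma_density (r + s) p x"
proof (cases "x > 0")
  case False
  then have "gamma_density r p (x - y) * gamma_density s p y = 0" for y
    by (cases "y > 0") (auto simp: gamma_density_def)
  then have "(\<integral>\<^sup>+y. gamma_density r p (x - y) * gamma_density s p y \<partial>lborel) = 0"
    by (simp only: nn_integral_const) simp
  then show ?thesis using False by (simp add: gamma_density_def)
next
  case x: True
  have G: "Gamma r > 0" "Gamma s > 0" "Gamma (r + s) > 0" using r s by (auto intro: Gamma_real_pos)
  define K where "K = p powr r / Gamma r * (p powr s / Gamma s) * exp (- (p * x)) * x powr (r + s - 2)"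
  have K: "K \<ge> 0" using G by (simp add: K_def)
  have "(\<integral>\<^sup>+y. gamma_density r p (x - y) * gamma_density s p y \<partial>lborel) =
      ennreal x * (\<integral>\<^sup>+t. gamma_density r p (x - x * t) * gamma_density s p (x * t) \<partial>lborel)"
    using x by (subst nn_integral_real_affine[where c=x and t=0]) auto
  also have "(\<integral>\<^sup>+t. gamma_density r p (x - x * t) * gamma_density s p (x * t) \<partial>lborel) =
     (\<integral>\<^sup>+t. ennreal K * ennreal (indicator {0..1} t * (t powr (s - 1) * (1 - t) powr (r - 1))) \<partial>lborel)"
  proof (intro nn_integral_cong_AE)
    have "AE t in lborel. t \<noteq> (0::real)" "AE t in lborel. t \<noteq> (1::real)" by (rule AE_lborel_singleton)+
    then show "AE t in lborel. gamma_density r p (x - x * t) * gamma_density s p (x * t) =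
       ennreal K * ennreal (indicator {0..1} t * (t powr (s - 1) * (1 - t) powr (r - 1)))"
    proof eventually_elim
      case (elim t)
      show ?case
      proof (cases "0 < t \<and> t < 1")
        case True
        have "x - x * t = x * (1 - t)" by (simp add: algebra_simps)
        moreover have "exp (- (p * x)) = exp (- (p * (x * (1 - t)))) * exp (- (p * (x * t)))"
          by (simp add: algebra_simps flip: exp_add)
        moreover have "x powr (r + s - 2) = x powr (r - 1) * x powr (s - 1)"
          by (simp flip: powr_add)
        ultimately show ?thesis using True x G
          by (simp add: gamma_density_def K_def powr_mult mult_ac flip: ennreal_mult')
      next
        case False
        then have "\<not> (0 < t) \<or> \<not> 0 < x - x * t" using elim x by (auto simp: not_less)
        then show ?thesis using False elim x by (auto simp: gamma_density_def zero_less_mult_iff indicator_def)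
      qed
    qed
  qed
  also have "\<dots> = ennreal K * ennreal (Beta s r)"
    using r s by (subst nn_integral_cmult) (simp_all add: nn_integral_Beta)
  also have "ennreal x * (ennreal K * ennreal (Beta s r)) = ennreal (x * K * Beta s r)"
    using x K G by (simp add: Beta_def add.commute mult.assoc flip: ennreal_mult')
  also have "x * K * Beta s r = p powr (r + s) / Gamma (r + s) * (x powr (r + s - 1) * exp (- (p * x)))"
    using x G by (simp add: K_def Beta_def powr_add powr_diff power2_eq_square add.commute divide_simps)
  also have "ennreal \<dots> = gamma_density (r + s) p x" using x by (simp add: gamma_density_def)
  finally show ?thesis .
qed

section \<open>Rearrangement of double series, and Poisson mixtures of Gamma densities\<close>

lemma suminf_ennreal_swap:
  fixes f :: "nat \<Rightarrow> nat \<Rightarrow> ennreal"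
  shows "(\<Sum>i. \<Sum>j. f i j) = (\<Sum>j. \<Sum>i. f i j)"
proof -
  have "(\<Sum>i. \<Sum>j. f i j) = (\<integral>\<^sup>+i. (\<Sum>j. f i j) \<partial>count_space UNIV)"
    by (simp add: nn_integral_count_space_nat)
  also have "\<dots> = (\<Sum>j. \<integral>\<^sup>+i. f i j \<partial>count_space UNIV)"
    by (rule nn_integral_suminf) simp
  finally show ?thesis by (simp add: nn_integral_count_space_nat)
qed

text \<open>The finite inner sum is padded with zeros to a full series, the order is swapped, and
  the index is shifted by \<open>j\<close>.\<close>

lemma suminf_ennreal_antidiagonal:
  fixes f :: "nat \<Rightarrow> nat \<Rightarrow> ennreal"
  shows "(\<Sum>i. \<Sum>j. f i j) = (\<Sum>k. \<Sum>j\<le>k. f (k - j) j)"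
proof -
  have "(\<Sum>k. \<Sum>j\<le>k. f (k - j) j) = (\<Sum>k. \<Sum>j. if j \<le> k then f (k - j) j else 0)"
  proof (intro suminf_cong)
    fix k :: nat
    have "(\<Sum>j. if j \<le> k then f (k - j) j else 0) = (\<Sum>j\<le>k. if j \<le> k then f (k - j) j else 0)"
      by (rule suminf_finite) auto
    then show "(\<Sum>j\<le>k. f (k - j) j) = (\<Sum>j. if j \<le> k then f (k - j) j else 0)" by simp
  qed
  also have "\<dots> = (\<Sum>j. \<Sum>k. if j \<le> k then f (k - j) j else 0)" by (rule suminf_ennreal_swap)
  also have "\<dots> = (\<Sum>j. \<Sum>i. f i j)"
  proof (rule suminf_cong)
    fix j :: nat
    show "(\<Sum>k. if j \<le> k then f (k - j) j else 0) = (\<Sum>i. f i j)"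
      by (subst suminf_offset[where i=j]) auto
  qed
  finally show ?thesis using suminf_ennreal_swap[of f] by simp
qed

text \<open>For \<open>l = 0\<close> the convention \<open>0 ^ 0 = 1\<close> makes this the point
  mass at \<open>0\<close>, so vanishing means are included in everything that follows.\<close>

definition poisson_weight :: "real \<Rightarrow> nat \<Rightarrow> real" where
  "poisson_weight l i = exp (- l) * l ^ i / fact i"

lemma poisson_weight_nonneg: "l \<ge> 0 \<Longrightarrow> poisson_weight l i \<ge> 0"
  by (simp add: poisson_weight_def)

lemma poisson_weight_sums: "poisson_weight l sums 1"
proof -
  have "(\<lambda>i. exp (- l) * (l ^ i /\<^sub>R fact i)) sums (exp (- l) * exp l)"
    by (intro sums_mult exp_converges)
  then show ?thesis by (simp add: poisson_weight_def[abs_def] field_simps flip: exp_add)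
qed

lemma poisson_weight_convolution:
  "(\<Sum>j\<le>k. poisson_weight l (k - j) * poisson_weight m j) = poisson_weight (l + m) k"
proof -
  have "poisson_weight l (k - j) * poisson_weight m j = exp (- (l + m)) / fact k * (of_nat (k choose j) * m ^ j * l ^ (k - j))"
    if "j \<le> k" for j
    using that by (simp add: poisson_weight_def binomial_fact exp_add exp_diff exp_minus divide_simps)
  then have "(\<Sum>j\<le>k. poisson_weight l (k - j) * poisson_weight m j) =
      exp (- (l + m)) / fact k * (\<Sum>j\<le>k. of_nat (k choose j) * m ^ j * l ^ (k - j))"
    by (simp add: sum_distrib_left)
  then show ?thesis by (simp add: poisson_weight_def add.commute[of l m] binomial_ring[of m l k])
qed

text \<open>A rescaled noncentral chi-square density with \<open>2 * r\<close> degrees of freedom: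
  \<open>p = 1 / 2\<close> is the unscaled case, and \<open>l\<close> is half the usual
  noncentrality parameter.\<close>

definition noncentral_gamma_density :: "real \<Rightarrow> real \<Rightarrow> real \<Rightarrow> real \<Rightarrow> ennreal" where
  "noncentral_gamma_density r p l x = (\<Sum>i. ennreal (poisson_weight l i) * gamma_density (r + real i) p x)"

lemma measurable_noncentral_gamma_density [measurable]:
  "noncentral_gamma_density r p l \<in> borel_measurable borel"
  unfolding noncentral_gamma_density_def by measurable

lemma noncentral_gamma_density_nonpos: "x \<le> 0 \<Longrightarrow> noncentral_gamma_density r p l x = 0"
  by (simp add: noncentral_gamma_density_def gamma_density_def)

lemma nn_integral_noncentral_gamma_density:
  assumes "r > 0" "p > 0" "l \<ge> 0"
  shows "(\<integral>\<^sup>+x. noncentral_gamma_density r p l x \<partial>lborel) = 1"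
proof -
  have "(\<integral>\<^sup>+x. noncentral_gamma_density r p l x \<partial>lborel) =
    (\<Sum>i. ennreal (poisson_weight l i) * (\<integral>\<^sup>+x. gamma_density (r + real i) p x \<partial>lborel))"
    unfolding noncentral_gamma_density_def by (simp add: nn_integral_suminf nn_integral_cmult)
  also have "\<dots> = (\<Sum>i. ennreal (poisson_weight l i))"
    using assms by (intro suminf_cong) (simp add: nn_integral_gamma_density)
  also have "\<dots> = 1"
    using suminf_ennreal_eq[OF poisson_weight_nonneg poisson_weight_sums, OF assms(3)] by simp
  finally show ?thesis .
qed

text \<open>The convolution of the mixture terms \<open>i\<close> and \<open>j\<close> depends on
  \<open>i + j\<close> only, so the double series is summed along antidiagonals, where the Poisson
  weights convolve by the binomial theorem.\<close>

lemma noncentral_gamma_density_convolution: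
  assumes r: "r > 0" and s: "s > 0" and p: "p > 0" and l: "l \<ge> 0" and m: "m \<ge> 0"
  shows "(\<integral>\<^sup>+y. noncentral_gamma_density r p l (x - y) * noncentral_gamma_density s p m y \<partial>lborel) =
    noncentral_gamma_density (r + s) p (l + m) x"
proof -
  let ?w = poisson_weight and ?g = gamma_density
  have "(\<integral>\<^sup>+y. noncentral_gamma_density r p l (x - y) * noncentral_gamma_density s p m y \<partial>lborel) =
    (\<integral>\<^sup>+y. (\<Sum>i. \<Sum>j. ennreal (?w l i) * ennreal (?w m j) * (?g (r + real i) p (x - y) * ?g (s + real j) p y)) \<partial>lborel)"
    unfolding noncentral_gamma_density_def
    by (intro nn_integral_cong) (simp add: mult_ac flip: ennreal_suminf_cmult ennreal_suminf_multc)
  also have "\<dots> = (\<Sum>i. \<Sum>j. ennreal (?w l i) * ennreal (?w m j) * (\<integral>\<^sup>+y. ?g (r + real i) p (x - y) * ?g (s + real j) p y \<partial>lborel))"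
    by (simp add: nn_integral_suminf nn_integral_cmult)
  also have "\<dots> = (\<Sum>i. \<Sum>j. ennreal (?w l i) * ennreal (?w m j) * ?g (r + s + real (i + j)) p x)"
    using r s p by (intro suminf_cong) (simp add: gamma_density_convolution add_ac)
  also have "\<dots> = (\<Sum>k. \<Sum>j\<le>k. ennreal (?w l (k - j)) * ennreal (?w m j) * ?g (r + s + real (k - j + j)) p x)"
    by (rule suminf_ennreal_antidiagonal)
  also have "\<dots> = (\<Sum>k. ennreal (?w (l + m) k) * ?g (r + s + real k) p x)"
  proof (intro suminf_cong)
    fix k
    have "(\<Sum>j\<le>k. ennreal (?w l (k - j)) * ennreal (?w m j) * ?g (r + s + real (k - j + j)) p x) =
      (\<Sum>j\<le>k. ennreal (?w l (k - j)) * ennreal (?w m j)) * ?g (r + s + real k) p x"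
      by (simp add: sum_distrib_right)
    also have "(\<Sum>j\<le>k. ennreal (?w l (k - j)) * ennreal (?w m j)) = ennreal (\<Sum>j\<le>k. ?w l (k - j) * ?w m j)"
      using l m by (simp add: poisson_weight_nonneg sum_ennreal flip: ennreal_mult)
    finally show "(\<Sum>j\<le>k. ennreal (?w l (k - j)) * ennreal (?w m j) * ?g (r + s + real (k - j + j)) p x) =
      ennreal (?w (l + m) k) * ?g (r + s + real k) p x"
      by (simp only: poisson_weight_convolution)
  qed
  finally show ?thesis by (simp add: noncentral_gamma_density_def)
qed

text \<open>The substitution \<open>w = u\<^sup>2\<close> is made between \<open>[0, n + 1]\<close>
  and its image, and the intervals then exhaust the half-line by monotone convergence.\<close>

lemma nn_integral_square_substitution:
  fixes f :: "real \<Rightarrow> ennreal"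
  assumes [measurable]: "f \<in> borel_measurable borel"
  shows "(\<integral>\<^sup>+w. f w * indicator {0..} w \<partial>lborel) = (\<integral>\<^sup>+u. f (u\<^sup>2) * ennreal (2 * u) * indicator {0..} u \<partial>lborel)"
proof -
  let ?L = "\<lambda>n. \<integral>\<^sup>+w. f w * indicator {0..(real (Suc n))\<^sup>2} w \<partial>lborel"
  let ?R = "\<lambda>n. \<integral>\<^sup>+u. f (u\<^sup>2) * ennreal (2 * u) * indicator {0..real (Suc n)} u \<partial>lborel"
  have large: "\<forall>\<^sub>F n in sequentially. x \<le> real (Suc n)" for x
    using eventually_gt_at_top[of "nat \<lceil>x\<rceil>"] by eventually_elim linarith
  have large2: "\<forall>\<^sub>F n in sequentially. x \<le> (real (Suc n))\<^sup>2" for x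
    using large[of x] by eventually_elim (simp add: power2_eq_square, smt (verit) mult_le_cancel_left1 of_nat_0_le_iff)
  have "(power2 has_real_derivative 2 * x) (at x)" for x :: real
    using DERIV_pow[of 2 x] by simp
  then have eq: "?L n = ?R n" for n
    using nn_integral_substitution_aux[of f 0 "real (Suc n)" power2 "\<lambda>u. 2 * u"]
    by (simp add: continuous_intros del: of_nat_Suc)
  have "?L \<longlonglongrightarrow> (\<integral>\<^sup>+w. f w * indicator {0..} w \<partial>lborel)"
  proof (rule nn_integral_LIMSEQ)
    show "incseq (\<lambda>n w. f w * indicator {0..(real (Suc n))\<^sup>2} w)"
      by (auto simp: incseq_def le_fun_def indicator_def intro: order_trans power_mono simp del: of_nat_Suc)
    fix w :: real
    show "(\<lambda>n. f w * indicator {0..(real (Suc n))\<^sup>2} w) \<longlonglongrightarrow> f w * indicator {0..} w"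
      by (rule tendsto_eventually, use large2[of w] in eventually_elim) (auto simp: indicator_def)
  qed auto
  moreover have "?R \<longlonglongrightarrow> (\<integral>\<^sup>+u. f (u\<^sup>2) * ennreal (2 * u) * indicator {0..} u \<partial>lborel)"
  proof (rule nn_integral_LIMSEQ)
    show "incseq (\<lambda>n u. f (u\<^sup>2) * ennreal (2 * u) * indicator {0..real (Suc n)} u)"
      by (auto simp: incseq_def le_fun_def indicator_def)
    fix u :: real
    show "(\<lambda>n. f (u\<^sup>2) * ennreal (2 * u) * indicator {0..real (Suc n)} u) \<longlonglongrightarrow> f (u\<^sup>2) * ennreal (2 * u) * indicator {0..} u"
      by (rule tendsto_eventually, use large[of u] in eventually_elim) (auto simp: indicator_def)
  qed auto
  ultimately show ?thesis unfolding eq by (rule LIMSEQ_unique)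
qed

lemma cosh_sums_even: "(\<lambda>i. x ^ (2 * i) / fact (2 * i)) sums cosh (x::real)"
proof -
  have "(\<lambda>i. if even (2 * i) then x ^ (2 * i) /\<^sub>R fact (2 * i) else 0) sums cosh x"
    by (subst sums_mono_reindex[of "\<lambda>i. 2 * i"])
      (auto simp: strict_mono_def cosh_converges elim: evenE intro!: cosh_converges)
  then show ?thesis by (simp add: field_simps)
qed

text \<open>Converts the Gamma factors of the mixture of shape \<open>1 / 2\<close> into
  \<open>fact (2 * i)\<close>, the denominators of the series of \<open>cosh\<close>.\<close>

lemma Gamma_half_integer:
  "Gamma (1/2 + real i) = sqrt pi * fact (2 * i) / (4 ^ i * fact i)"
proof -
  have "pochhammer (1/2) i = Gamma (1/2 + of_nat i) / Gamma (1/2 :: real)"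
    by (rule pochhammer_Gamma) (auto elim!: nonpos_Ints_cases)
  moreover have "fact (2 * i) = (2 ^ (2 * i) * pochhammer (1 / 2) i * fact i :: real)"
    by (rule fact_double)
  moreover have "(2::real) ^ (2 * i) = 4 ^ i" by (simp add: power_mult)
  ultimately have "fact (2 * i) = 4 ^ i * (Gamma (1/2 + real i) / sqrt pi) * fact i"
    by (simp add: Gamma_one_half_real)
  then show ?thesis by simp
qed

text \<open>The right-hand side is the density of the square of a normal variable. In the squares of
  \<open>sqrt w - m\<close> and \<open>- sqrt w - m\<close> only the mixed terms differ; their
  exponentials add up to a \<open>cosh\<close>, whose series is the mixture term by term.\<close>

lemma noncentral_gamma_density_one_half:
  assumes s: "s > 0" and w: "w > 0"
  defines "p \<equiv> 1 / (2 * s\<^sup>2)"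
  shows "noncentral_gamma_density (1/2) p (m\<^sup>2 * p) w =
     ennreal ((normal_density m s (sqrt w) + normal_density m s (- sqrt w)) / (2 * sqrt w))"
proof -
  have p: "p > 0" using s by (simp add: p_def)
  define K where "K = exp (- (m\<^sup>2 * p)) * sqrt p / sqrt pi * (exp (- (p * w)) / sqrt w)"
  have summand: "poisson_weight (m\<^sup>2 * p) i * (p powr (1/2 + real i) / Gamma (1/2 + real i) * (w powr (1/2 + real i - 1) * exp (- (p * w))))
    = K * ((2 * m * p * sqrt w) ^ (2 * i) / fact (2 * i))" for i
  proof -
    have 1: "(2 * m * p * sqrt w) ^ (2 * i) = 4 ^ i * (m\<^sup>2) ^ i * p ^ i * p ^ i * w ^ i"
    proof -
      have "(2 * m * p * sqrt w)\<^sup>2 = 4 * m\<^sup>2 * p * p * w"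
        using w by (simp add: power_mult_distrib power2_eq_square[of p])
      then show ?thesis by (simp only: power_mult power_mult_distrib)
    qed
    have 2: "p powr (1/2 + real i) = sqrt p * p ^ i"
      using p by (simp add: powr_add powr_half_sqrt powr_realpow)
    have "w powr (1/2 + real i - 1) = w powr (real i + (- (1/2)))" by simp
    also have "\<dots> = w ^ i * w powr (- (1/2))" using w by (simp only: powr_add powr_realpow)
    also have "w powr (- (1/2)) = 1 / sqrt w"
      using w by (subst powr_minus) (simp add: powr_half_sqrt inverse_eq_divide)
    finally have 3: "w powr (1/2 + real i - 1) = w ^ i / sqrt w" by simp
    show ?thesis
      unfolding 1 2 3 Gamma_half_integer K_def poisson_weight_def
      using w by (simp add: power_mult_distrib divide_simps)
  qed
  have pos: "poisson_weight (m\<^sup>2 * p) i * (p powr (1/2 + real i) / Gamma (1/2 + real i) * (w powr (1/2 + real i - 1) * exp (- (p * w)))) \<ge> 0" for i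
    using p by (intro mult_nonneg_nonneg divide_nonneg_nonneg poisson_weight_nonneg) (auto intro: Gamma_real_nonneg)
  have "noncentral_gamma_density (1/2) p (m\<^sup>2 * p) w = (\<Sum>i. ennreal (poisson_weight (m\<^sup>2 * p) i * (p powr (1/2 + real i) / Gamma (1/2 + real i) * (w powr (1/2 + real i - 1) * exp (- (p * w))))))"
    unfolding noncentral_gamma_density_def gamma_density_def using w p
    by (intro suminf_cong) (simp add: poisson_weight_nonneg ennreal_mult'' flip: ennreal_mult')
  also have "\<dots> = ennreal (K * cosh (2 * m * p * sqrt w))"
    using pos unfolding summand by (intro suminf_ennreal_eq sums_mult cosh_sums_even) auto
  also have "K * cosh (2 * m * p * sqrt w) = (normal_density m s (sqrt w) + normal_density m s (- sqrt w)) / (2 * sqrt w)"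
  proof -
    have c: "sqrt p / sqrt pi = 1 / sqrt (2 * pi * s\<^sup>2)"
      by (simp add: p_def real_sqrt_divide real_sqrt_mult divide_simps)
    have sq: "(sqrt w - m)\<^sup>2 = w + m\<^sup>2 - 2 * m * sqrt w" "(- sqrt w - m)\<^sup>2 = w + m\<^sup>2 + 2 * m * sqrt w"
      using w by (simp_all add: power2_eq_square algebra_simps)
    have dv: "a / (2 * s\<^sup>2) = a * p" for a by (simp add: p_def)
    have e: "exp (- (sqrt w - m)\<^sup>2 / (2 * s\<^sup>2)) = exp (- (m\<^sup>2 * p)) * exp (- (p * w)) * exp (2 * m * p * sqrt w)"
      "exp (- (- sqrt w - m)\<^sup>2 / (2 * s\<^sup>2)) = exp (- (m\<^sup>2 * p)) * exp (- (p * w)) * exp (- (2 * m * p * sqrt w))"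
      unfolding sq dv exp_add[symmetric] by (rule arg_cong[of _ _ exp], simp add: algebra_simps)+
    show ?thesis
      unfolding normal_density_def e K_def cosh_def c[symmetric] using w by (simp add: field_simps)
  qed
  finally show ?thesis .
qed

section \<open>Squares of normal variables, and differences of noncentral Gamma variables\<close>

lemma nn_integral_uminus:
  fixes f :: "real \<Rightarrow> ennreal"
  assumes "f \<in> borel_measurable borel"
  shows "(\<integral>\<^sup>+x. f (- x) \<partial>lborel) = (\<integral>\<^sup>+x. f x \<partial>lborel)"
  using nn_integral_real_affine[OF assms, of "-1" 0] by simp

text \<open>The negative half-line is folded onto the positive one before
  \<open>w = u\<^sup>2\<close> is substituted; the Jacobian \<open>2 * u\<close> cancels the
  \<open>2 * sqrt w\<close> in the density.\<close>

lemma distr_normal_square: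
  assumes s: "s > 0"
  shows "distr (density lborel (normal_density m s)) borel (\<lambda>x. x\<^sup>2) =
    density lborel (noncentral_gamma_density (1/2) (1 / (2 * s\<^sup>2)) (m\<^sup>2 * (1 / (2 * s\<^sup>2))))"
    (is "?D = density lborel ?h")
proof (rule measure_eqI)
  fix A assume "A \<in> sets ?D"
  then have [measurable]: "A \<in> sets borel" by simp
  let ?n = "\<lambda>u. ennreal (normal_density m s u)"
  let ?i = "\<lambda>u. indicator A (u\<^sup>2) :: ennreal"
  have "emeasure ?D A = (\<integral>\<^sup>+u. ?n u * ?i u \<partial>lborel)"
    by (simp add: nn_integral_indicator[symmetric] nn_integral_distr nn_integral_density del: nn_integral_indicator)
  \<comment> \<open>The origin belongs to both half-lines, whence equality almost everywhere
    only.\<close>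
  also have "\<dots> = (\<integral>\<^sup>+u. ?n u * ?i u * indicator {0..} u + ?n u * ?i u * indicator {0..} (- u) \<partial>lborel)"
  proof (rule nn_integral_cong_AE)
    have "AE u in lborel. u \<noteq> (0::real)" by (rule AE_lborel_singleton)
    then show "AE u in lborel. ?n u * ?i u = ?n u * ?i u * indicator {0..} u + ?n u * ?i u * indicator {0..} (- u)"
      by eventually_elim (auto simp: indicator_def)
  qed
  also have "\<dots> = (\<integral>\<^sup>+u. ?n u * ?i u * indicator {0..} u \<partial>lborel) + (\<integral>\<^sup>+u. ?n (- u) * ?i u * indicator {0..} u \<partial>lborel)"
    by (subst nn_integral_add) (auto simp: nn_integral_uminus[of "\<lambda>u. ?n (- u) * ?i u * indicator {0..} u", simplified])
  also have "\<dots> = (\<integral>\<^sup>+u. ?n u * ?i u * indicator {0..} u + ?n (- u) * ?i u * indicator {0..} u \<partial>lborel)"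
    by (subst nn_integral_add) auto
  also have "\<dots> = (\<integral>\<^sup>+u. (?h (u\<^sup>2) * ?i u) * ennreal (2 * u) * indicator {0..} u \<partial>lborel)"
  proof (rule nn_integral_cong_AE)
    have "AE u in lborel. u \<noteq> (0::real)" by (rule AE_lborel_singleton)
    then show "AE u in lborel. ?n u * ?i u * indicator {0..} u + ?n (- u) * ?i u * indicator {0..} u = (?h (u\<^sup>2) * ?i u) * ennreal (2 * u) * indicator {0..} u"
    proof eventually_elim
      case (elim u)
      show ?case
      proof (cases "u > 0 \<and> u\<^sup>2 \<in> A")
        case True
        then show ?thesis using noncentral_gamma_density_one_half[OF s, of "u\<^sup>2" m]
          by (simp flip: ennreal_plus ennreal_mult')
      qed (use elim in \<open>auto simp: indicator_def\<close>)
    qed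
  qed
  also have "\<dots> = (\<integral>\<^sup>+w. ?h w * indicator A w * indicator {0..} w \<partial>lborel)"
    by (rule nn_integral_square_substitution[symmetric]) measurable
  also have "\<dots> = (\<integral>\<^sup>+w. ?h w * indicator A w \<partial>lborel)"
    by (intro nn_integral_cong) (auto simp: indicator_def noncentral_gamma_density_nonpos)
  also have "\<dots> = emeasure (density lborel ?h) A" by (simp add: emeasure_density)
  finally show "emeasure ?D A = emeasure (density lborel ?h) A" .
qed simp

text \<open>The variable \<open>t\<close> runs over the values of the subtracted variable. Both
  variables have the same shape, since every summand contributes one square to each of them, but
  their rates and Poisson means differ.\<close>

definition noncentral_gamma_diff_density :: "real \<Rightarrow> real \<Rightarrow> real \<Rightarrow> real \<Rightarrow> real \<Rightarrow> real \<Rightarrow> ennreal" where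
  "noncentral_gamma_diff_density r p l q m x =
     (\<integral>\<^sup>+t. noncentral_gamma_density r p l (x + t) * noncentral_gamma_density r q m t \<partial>lborel)"

lemma measurable_noncentral_gamma_diff_density [measurable]:
  "noncentral_gamma_diff_density r p l q m \<in> borel_measurable borel"
  unfolding noncentral_gamma_diff_density_def by measurable

lemma finite_measure_noncentral_gamma:
  assumes "r > 0" "p > 0" "l \<ge> 0"
  shows "finite_measure (density lborel (noncentral_gamma_density r p l))"
    and "finite_measure (density lborel (\<lambda>x. noncentral_gamma_density r p l (- x)))"
  using nn_integral_noncentral_gamma_density[OF assms]
  by (auto intro!: finite_measureI simp: emeasure_density nn_integral_uminus)

lemma noncentral_gamma_diff_convolution:
  assumes "r > 0" "p > 0" "l \<ge> 0" "q > 0" "m \<ge> 0"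
  shows "(density lborel (noncentral_gamma_density r p l) \<star> density lborel (\<lambda>x. noncentral_gamma_density r q m (- x)))
    = density lborel (noncentral_gamma_diff_density r p l q m)"
proof -
  have "(\<integral>\<^sup>+y. noncentral_gamma_density r p l (x - y) * noncentral_gamma_density r q m (- y) \<partial>lborel) =
      noncentral_gamma_diff_density r p l q m x" for x
    using nn_integral_uminus[of "\<lambda>y. noncentral_gamma_density r p l (x + y) * noncentral_gamma_density r q m y"]
    by (simp add: noncentral_gamma_diff_density_def)
  then show ?thesis
    using assms by (subst convolution_density) (auto intro: finite_measure_noncentral_gamma)
qed

text \<open>Regroups a sum of two differences as the sum of the two positive parts and the two
  negative parts. Within each group the rates agree, so each group can be convolved.\<close>

lemma convolution_interchange:
  fixes A B C D :: "real measure"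
  assumes [simp]: "finite_measure A" "finite_measure B" "finite_measure C" "finite_measure D"
    and [simp]: "sets A = sets borel" "sets B = sets borel" "sets C = sets borel" "sets D = sets borel"
  shows "((A \<star> B) \<star> (C \<star> D)) = ((A \<star> C) \<star> (B \<star> D))"
proof -
  have "((A \<star> B) \<star> (C \<star> D)) = (A \<star> ((B \<star> C) \<star> D))"
    by (simp add: convolution_associative[symmetric] convolution_finite)
  also have "(B \<star> C) = (C \<star> B)" by (rule convolution_commutative) simp_all
  also have "(A \<star> ((C \<star> B) \<star> D)) = ((A \<star> C) \<star> (B \<star> D))"
    by (simp add: convolution_associative[symmetric] convolution_finite)
  finally show ?thesis .
qed

lemma noncentral_gamma_diff_density_convolution:
  assumes r: "r > 0" "s > 0" and p: "p > 0" "q > 0" and l: "l \<ge> 0" "l' \<ge> 0" and m: "m \<ge> 0" "m' \<ge> 0"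
  shows "(density lborel (noncentral_gamma_diff_density r p l q m) \<star> density lborel (noncentral_gamma_diff_density s p l' q m'))
    = density lborel (noncentral_gamma_diff_density (r + s) p (l + l') q (m + m'))"
proof -
  have 1: "(density lborel (noncentral_gamma_density r p l) \<star> density lborel (noncentral_gamma_density s p l'))
    = density lborel (noncentral_gamma_density (r + s) p (l + l'))"
    using assms by (subst convolution_density) (auto simp: finite_measure_noncentral_gamma noncentral_gamma_density_convolution)
  have "(\<integral>\<^sup>+y. noncentral_gamma_density r q m (- (x - y)) * noncentral_gamma_density s q m' (- y) \<partial>lborel) =
      noncentral_gamma_density (r + s) q (m + m') (- x)" for x
  proof -
    have "(\<integral>\<^sup>+y. noncentral_gamma_density r q m (- (x - y)) * noncentral_gamma_density s q m' (- y) \<partial>lborel) =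
        (\<integral>\<^sup>+y. noncentral_gamma_density r q m (- x - y) * noncentral_gamma_density s q m' y \<partial>lborel)"
      using nn_integral_uminus[of "\<lambda>y. noncentral_gamma_density r q m (- x - y) * noncentral_gamma_density s q m' y"]
      by simp
    also have "\<dots> = noncentral_gamma_density (r + s) q (m + m') (- x)"
      using assms by (intro noncentral_gamma_density_convolution)
    finally show ?thesis .
  qed
  then have 2: "(density lborel (\<lambda>x. noncentral_gamma_density r q m (- x)) \<star> density lborel (\<lambda>x. noncentral_gamma_density s q m' (- x)))
    = density lborel (\<lambda>x. noncentral_gamma_density (r + s) q (m + m') (- x))"
    using assms by (subst convolution_density) (auto simp: finite_measure_noncentral_gamma)
  show ?thesis
    using assms
    by (simp add: noncentral_gamma_diff_convolution[symmetric] convolution_interchange finite_measure_noncentral_gamma 1 2 add_pos_pos)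
qed

subsection \<open>The law of the sum of products\<close>

text \<open>The linear change of variables has determinant \<open>- 2\<close>. It is split into
  one-dimensional affine substitutions with Fubini in between:
  \<open>y = (2 * u - x / k) / k\<close> at fixed \<open>x\<close>, then
  \<open>x = k * (u + v)\<close> at fixed \<open>u\<close>.\<close>

lemma nn_integral_rotate:
  fixes F :: "real \<Rightarrow> real \<Rightarrow> ennreal"
  assumes [measurable]: "(\<lambda>(x, y). F x y) \<in> borel_measurable (lborel \<Otimes>\<^sub>M lborel)" and k: "k > 0"
  shows "(\<integral>\<^sup>+x. \<integral>\<^sup>+y. F x y \<partial>lborel \<partial>lborel) = 2 * (\<integral>\<^sup>+u. \<integral>\<^sup>+v. F (k * (u + v)) ((u - v) / k) \<partial>lborel \<partial>lborel)"
proof -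
  have "(\<integral>\<^sup>+x. \<integral>\<^sup>+y. F x y \<partial>lborel \<partial>lborel) = (\<integral>\<^sup>+x. \<integral>\<^sup>+u. ennreal (2 / k) * F x ((2 * u - x / k) / k) \<partial>lborel \<partial>lborel)"
  proof (rule nn_integral_cong)
    fix x :: real
    have "(\<integral>\<^sup>+y. F x y \<partial>lborel) = ennreal (2 / k) * (\<integral>\<^sup>+u. F x (- x / k / k + 2 / k * u) \<partial>lborel)"
      using k by (subst nn_integral_real_affine[where c="2/k" and t="- x / k / k"]) auto
    also have "\<dots> = (\<integral>\<^sup>+u. ennreal (2 / k) * F x (- x / k / k + 2 / k * u) \<partial>lborel)"
      by (rule nn_integral_cmult[symmetric]) measurable
    also have "(\<lambda>u. - x / k / k + 2 / k * u) = (\<lambda>u. (2 * u - x / k) / k)"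
      by (simp add: fun_eq_iff diff_divide_distrib)
    then have "(\<integral>\<^sup>+u. ennreal (2 / k) * F x (- x / k / k + 2 / k * u) \<partial>lborel) = (\<integral>\<^sup>+u. ennreal (2 / k) * F x ((2 * u - x / k) / k) \<partial>lborel)"
      by (simp add: fun_eq_iff)
    finally show "(\<integral>\<^sup>+y. F x y \<partial>lborel) = (\<integral>\<^sup>+u. ennreal (2 / k) * F x ((2 * u - x / k) / k) \<partial>lborel)" .
  qed
  also have "\<dots> = (\<integral>\<^sup>+u. \<integral>\<^sup>+x. ennreal (2 / k) * F x ((2 * u - x / k) / k) \<partial>lborel \<partial>lborel)"
    by (rule lborel_pair.Fubini') measurable
  also have "\<dots> = (\<integral>\<^sup>+u. \<integral>\<^sup>+v. ennreal 2 * F (k * (u + v)) ((u - v) / k) \<partial>lborel \<partial>lborel)"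
  proof (rule nn_integral_cong)
    fix u :: real
    have "(\<integral>\<^sup>+x. ennreal (2 / k) * F x ((2 * u - x / k) / k) \<partial>lborel) =
        ennreal k * (\<integral>\<^sup>+v. ennreal (2 / k) * F (k * u + k * v) ((2 * u - (k * u + k * v) / k) / k) \<partial>lborel)"
      using k by (subst nn_integral_real_affine[where c=k and t="k * u"]) auto
    also have "\<dots> = (\<integral>\<^sup>+v. ennreal k * (ennreal (2 / k) * F (k * u + k * v) ((2 * u - (k * u + k * v) / k) / k)) \<partial>lborel)"
      by (rule nn_integral_cmult[symmetric]) measurable
    also have "\<dots> = (\<integral>\<^sup>+v. ennreal 2 * F (k * (u + v)) ((u - v) / k) \<partial>lborel)"
    proof (rule nn_integral_cong)
      fix v :: real
      have 1: "k * u + k * v = k * (u + v)" by (simp add: algebra_simps)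
      have 2: "2 * u - (k * u + k * v) / k = u - v" using k unfolding 1 by simp
      show "ennreal k * (ennreal (2 / k) * F (k * u + k * v) ((2 * u - (k * u + k * v) / k) / k)) = ennreal 2 * F (k * (u + v)) ((u - v) / k)"
        using k unfolding 2 unfolding 1 by (simp flip: mult.assoc ennreal_mult' del: ennreal_numeral)
    qed
    finally show "(\<integral>\<^sup>+x. ennreal (2 / k) * F x ((2 * u - x / k) / k) \<partial>lborel) = (\<integral>\<^sup>+v. ennreal 2 * F (k * (u + v)) ((u - v) / k) \<partial>lborel)" .
  qed
  also have "\<dots> = 2 * (\<integral>\<^sup>+u. \<integral>\<^sup>+v. F (k * (u + v)) ((u - v) / k) \<partial>lborel \<partial>lborel)"
    by (simp add: nn_integral_cmult)
  finally show ?thesis .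
qed

text \<open>With \<open>U\<close> and \<open>V\<close> the centred new coordinates, the standardised
  old ones are \<open>(U + V) / g\<close> and \<open>(U - V) / g\<close>. The quadratic form then
  loses its mixed term and becomes \<open>(2 * (1 - \<rho>) * U\<^sup>2 + 2 * (1 + \<rho>) *
  V\<^sup>2) / g\<^sup>2\<close>. The factor \<open>2\<close> on the left is the Jacobian of the
  change of variables.\<close>

lemma bivariate_normal_density_rotate:
  fixes \<mu>X \<mu>Y \<sigma>X \<sigma>Y \<rho> :: real
  assumes s: "\<sigma>X > 0" "\<sigma>Y > 0" and r: "-1 < \<rho>" "\<rho> < 1"
  defines "g \<equiv> sqrt (\<sigma>X * \<sigma>Y)"
  shows "2 * bivariate_normal_density \<mu>X \<mu>Y \<sigma>X \<sigma>Y \<rho> (\<sigma>X / g * (u + v)) ((u - v) / (\<sigma>X / g)) =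
    normal_density (g * (\<mu>X / \<sigma>X + \<mu>Y / \<sigma>Y) / 2) (g * sqrt ((1 + \<rho>) / 2)) u *
    normal_density (g * (\<mu>X / \<sigma>X - \<mu>Y / \<sigma>Y) / 2) (g * sqrt ((1 - \<rho>) / 2)) v"
proof -
  have g: "g > 0" "g\<^sup>2 = \<sigma>X * \<sigma>Y" "g * g = \<sigma>X * \<sigma>Y" using s by (simp_all add: g_def)
  have r2: "1 - \<rho>\<^sup>2 = (1 - \<rho>) * (1 + \<rho>)" by (simp add: power2_eq_square algebra_simps)
  have rp: "1 - \<rho> > 0" "1 + \<rho> > 0" using r by auto
  define U where "U = u - g * (\<mu>X / \<sigma>X + \<mu>Y / \<sigma>Y) / 2"
  define V where "V = v - g * (\<mu>X / \<sigma>X - \<mu>Y / \<sigma>Y) / 2"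
  have x: "(\<sigma>X / g * (u + v) - \<mu>X) / \<sigma>X = (U + V) / g"
    using s g by (simp add: U_def V_def field_simps)
  have "(u - v) / (\<sigma>X / g) = (u - v) * (g / \<sigma>X)" by simp
  also have "g / \<sigma>X = \<sigma>Y / g"
    using s g by (simp add: frac_eq_eq mult.commute)
  finally have "(u - v) / (\<sigma>X / g) = \<sigma>Y * ((u - v) / g)" by (simp add: mult.commute)
  then have "((u - v) / (\<sigma>X / g) - \<mu>Y) / \<sigma>Y = (u - v) / g - \<mu>Y / \<sigma>Y"
    using s by (simp only: diff_divide_distrib) simp
  also have "\<dots> = (U - V) / g"
    using g(1) by (simp add: U_def V_def field_simps)
  finally have y: "((u - v) / (\<sigma>X / g) - \<mu>Y) / \<sigma>Y = (U - V) / g" .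
  have q: "- (1 / (2 * (1 - \<rho>\<^sup>2))) * (((U + V) / g)\<^sup>2 - 2 * \<rho> * ((U + V) / g) * ((U - V) / g) + ((U - V) / g)\<^sup>2)
    = - U\<^sup>2 / (g\<^sup>2 * (1 + \<rho>)) + - V\<^sup>2 / (g\<^sup>2 * (1 - \<rho>))"
  proof -
    have 1: "((U + V) / g)\<^sup>2 - 2 * \<rho> * ((U + V) / g) * ((U - V) / g) + ((U - V) / g)\<^sup>2 =
       (2 * (1 - \<rho>) * U\<^sup>2 + 2 * (1 + \<rho>) * V\<^sup>2) / g\<^sup>2"
      using g(1) by (simp add: power2_eq_square field_simps)
    have 2: "- (1 / (2 * (A * B))) * ((2 * A * U\<^sup>2 + 2 * B * V\<^sup>2) / G) = - U\<^sup>2 / (G * B) + - V\<^sup>2 / (G * A)"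
      if "A > 0" "B > 0" "G > 0" for A B G :: real
      using that by (simp add: field_simps)
    show ?thesis unfolding r2 1 using rp g(1) by (intro 2) simp_all
  qed
  have s1: "2 * (g * sqrt ((1 + \<rho>) / 2))\<^sup>2 = g\<^sup>2 * (1 + \<rho>)" "2 * (g * sqrt ((1 - \<rho>) / 2))\<^sup>2 = g\<^sup>2 * (1 - \<rho>)"
    using rp by (simp_all add: power_mult_distrib)
  have c: "sqrt (2 * pi * (g * sqrt ((1 + \<rho>) / 2))\<^sup>2) * sqrt (2 * pi * (g * sqrt ((1 - \<rho>) / 2))\<^sup>2) = pi * \<sigma>X * \<sigma>Y * sqrt (1 - \<rho>\<^sup>2)"
  proof -
    have e: "2 * pi * (g * sqrt ((1 + \<rho>) / 2))\<^sup>2 = pi * (g\<^sup>2 * (1 + \<rho>))" "2 * pi * (g * sqrt ((1 - \<rho>) / 2))\<^sup>2 = pi * (g\<^sup>2 * (1 - \<rho>))"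
      using s1 by (simp_all add: mult_ac)
    have "sqrt (2 * pi * (g * sqrt ((1 + \<rho>) / 2))\<^sup>2) * sqrt (2 * pi * (g * sqrt ((1 - \<rho>) / 2))\<^sup>2)
       = sqrt ((pi * g\<^sup>2)\<^sup>2 * (1 - \<rho>\<^sup>2))"
      unfolding r2 e real_sqrt_mult[symmetric]
      by (rule arg_cong[of _ _ sqrt]) (simp add: power2_eq_square mult_ac)
    also have "\<dots> = pi * g\<^sup>2 * sqrt (1 - \<rho>\<^sup>2)" using pi_gt_zero by (simp add: real_sqrt_mult)
    finally show ?thesis using g(2) by simp
  qed
  have "2 * bivariate_normal_density \<mu>X \<mu>Y \<sigma>X \<sigma>Y \<rho> (\<sigma>X / g * (u + v)) ((u - v) / (\<sigma>X / g)) =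
    1 / (pi * \<sigma>X * \<sigma>Y * sqrt (1 - \<rho>\<^sup>2)) * (exp (- U\<^sup>2 / (g\<^sup>2 * (1 + \<rho>))) * exp (- V\<^sup>2 / (g\<^sup>2 * (1 - \<rho>))))"
    unfolding bivariate_normal_density_def x y q exp_add by simp
  then show ?thesis
    unfolding c[symmetric] normal_density_def s1 U_def V_def by simp
qed

lemma density_reflect:
  fixes f :: "real \<Rightarrow> ennreal"
  assumes [measurable]: "f \<in> borel_measurable borel"
  shows "density lborel (\<lambda>x. f (- x)) = distr (density lborel f) borel uminus"
proof (rule measure_eqI)
  fix A assume "A \<in> sets (density lborel (\<lambda>x. f (- x)))"
  then have [measurable]: "A \<in> sets borel" by simp
  have "emeasure (distr (density lborel f) borel uminus) A = (\<integral>\<^sup>+x. f x * indicator A (- x) \<partial>lborel)"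
    by (simp add: nn_integral_indicator[symmetric] nn_integral_distr nn_integral_density del: nn_integral_indicator)
  also have "\<dots> = (\<integral>\<^sup>+x. f (- x) * indicator A x \<partial>lborel)"
    using nn_integral_uminus[of "\<lambda>x. f x * indicator A (- x)"] by simp
  finally show "emeasure (density lborel (\<lambda>x. f (- x))) A = emeasure (distr (density lborel f) borel uminus) A"
    by (simp add: emeasure_density)
qed simp

text \<open>The rates \<open>p\<close> and \<open>q\<close> are the reciprocals of twice the
  variances of the rotated coordinates \<open>u\<close> and \<open>v\<close>, and \<open>l\<close>
  and \<open>m\<close> are their squared means times these rates; the scale \<open>g\<close> cancels
  in \<open>l\<close> and \<open>m\<close>.\<close>

lemma distr_bivariate_normal_product:
  fixes X Y :: "'b \<Rightarrow> real"
  assumes "prob_space N" and s: "\<sigma>X > 0" "\<sigma>Y > 0" and r: "-1 < \<rho>" "\<rho> < 1"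
    and XY: "bivariate_normal N X Y \<mu>X \<mu>Y \<sigma>X \<sigma>Y \<rho>"
  defines "p \<equiv> 1 / (\<sigma>X * \<sigma>Y * (1 + \<rho>))" and "q \<equiv> 1 / (\<sigma>X * \<sigma>Y * (1 - \<rho>))"
    and "l \<equiv> (\<mu>X / \<sigma>X + \<mu>Y / \<sigma>Y)\<^sup>2 / (4 * (1 + \<rho>))" and "m \<equiv> (\<mu>X / \<sigma>X - \<mu>Y / \<sigma>Y)\<^sup>2 / (4 * (1 - \<rho>))"
  shows "distr N borel (\<lambda>\<omega>. X \<omega> * Y \<omega>) = density lborel (noncentral_gamma_diff_density (1/2) p l q m)"
    (is "?D = ?E")
proof (rule measure_eqI)
  define g where "g = sqrt (\<sigma>X * \<sigma>Y)"
  have g: "g > 0" "g\<^sup>2 = \<sigma>X * \<sigma>Y" using s by (simp_all add: g_def)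
  have pos: "p > 0" "q > 0" "l \<ge> 0" "m \<ge> 0" using s r by (simp_all add: p_def q_def l_def m_def)
  define a where "a = g * (\<mu>X / \<sigma>X + \<mu>Y / \<sigma>Y) / 2"
  define b where "b = g * (\<mu>X / \<sigma>X - \<mu>Y / \<sigma>Y) / 2"
  define s1 where "s1 = g * sqrt ((1 + \<rho>) / 2)"
  define s2 where "s2 = g * sqrt ((1 - \<rho>) / 2)"
  have s12: "s1 > 0" "s2 > 0" using g r by (simp_all add: s1_def s2_def)
  have p: "1 / (2 * s1\<^sup>2) = p" "1 / (2 * s2\<^sup>2) = q"
    using g r by (simp_all add: s1_def s2_def p_def q_def power_mult_distrib)
  have l: "a\<^sup>2 * p = l" "b\<^sup>2 * q = m"
    using g s r by (simp_all add: a_def b_def l_def m_def p_def q_def power_mult_distrib power_divide)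
  let ?n1 = "\<lambda>u. ennreal (normal_density a s1 u)" and ?n2 = "\<lambda>v. ennreal (normal_density b s2 v)"
  interpret n1: prob_space "density lborel ?n1" by (rule prob_space_normal_density) fact
  interpret n2: prob_space "density lborel ?n2" by (rule prob_space_normal_density) fact
  fix A assume "A \<in> sets ?D"
  then have [measurable]: "A \<in> sets borel" by simp
  define f where "f = (\<lambda>(x, y). ennreal (bivariate_normal_density \<mu>X \<mu>Y \<sigma>X \<sigma>Y \<rho> x y))"
  have d: "distr N (lborel \<Otimes>\<^sub>M lborel) (\<lambda>\<omega>. (X \<omega>, Y \<omega>)) = density (lborel \<Otimes>\<^sub>M lborel) f"
    and [measurable]: "f \<in> borel_measurable (lborel \<Otimes>\<^sub>M lborel)" "(\<lambda>\<omega>. (X \<omega>, Y \<omega>)) \<in> measurable N (lborel \<Otimes>\<^sub>M lborel)"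
    using XY unfolding bivariate_normal_def distributed_def f_def by auto
  have "?D = distr (distr N (lborel \<Otimes>\<^sub>M lborel) (\<lambda>\<omega>. (X \<omega>, Y \<omega>))) borel (\<lambda>(x, y). x * y)"
    by (subst distr_distr) (auto simp: comp_def)
  then have "emeasure ?D A = (\<integral>\<^sup>+z. f z * indicator A (fst z * snd z) \<partial>(lborel \<Otimes>\<^sub>M lborel))"
    unfolding d
    by (simp add: nn_integral_indicator[symmetric] nn_integral_distr nn_integral_density case_prod_beta' del: nn_integral_indicator)
  also have "\<dots> = (\<integral>\<^sup>+x. \<integral>\<^sup>+y. f (x, y) * indicator A (x * y) \<partial>lborel \<partial>lborel)"
    by (subst lborel.nn_integral_fst[symmetric]) auto
  also have "\<dots> = 2 * (\<integral>\<^sup>+u. \<integral>\<^sup>+v. f (\<sigma>X / g * (u + v), (u - v) / (\<sigma>X / g)) * indicator A ((\<sigma>X / g * (u + v)) * ((u - v) / (\<sigma>X / g))) \<partial>lborel \<partial>lborel)"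
    by (rule nn_integral_rotate) (use s g in auto)
  also have "\<dots> = (\<integral>\<^sup>+u. \<integral>\<^sup>+v. 2 * (f (\<sigma>X / g * (u + v), (u - v) / (\<sigma>X / g)) * indicator A ((\<sigma>X / g * (u + v)) * ((u - v) / (\<sigma>X / g)))) \<partial>lborel \<partial>lborel)"
    by (simp add: nn_integral_cmult)
  also have "\<dots> = (\<integral>\<^sup>+u. \<integral>\<^sup>+v. ?n1 u * (?n2 v * indicator A (u\<^sup>2 + - v\<^sup>2)) \<partial>lborel \<partial>lborel)"
  proof (intro nn_integral_cong)
    fix u v :: real
    have "(\<sigma>X / g * (u + v)) * ((u - v) / (\<sigma>X / g)) = u\<^sup>2 + - v\<^sup>2"
    proof -
      have "(k * (u + v)) * ((u - v) / k) = (u + v) * (u - v)" if "k \<noteq> 0" for k :: real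
        using that by simp
      from this[of "\<sigma>X / g"] show ?thesis
        using s g(1) by (simp add: power2_eq_square algebra_simps)
    qed
    moreover have "2 * f (\<sigma>X / g * (u + v), (u - v) / (\<sigma>X / g)) = ?n1 u * ?n2 v"
    proof -
      have "2 * f (\<sigma>X / g * (u + v), (u - v) / (\<sigma>X / g)) =
          ennreal 2 * ennreal (bivariate_normal_density \<mu>X \<mu>Y \<sigma>X \<sigma>Y \<rho> (\<sigma>X / g * (u + v)) ((u - v) / (\<sigma>X / g)))"
        by (simp add: f_def)
      also have "\<dots> = ennreal (2 * bivariate_normal_density \<mu>X \<mu>Y \<sigma>X \<sigma>Y \<rho> (\<sigma>X / g * (u + v)) ((u - v) / (\<sigma>X / g)))"
        by (rule ennreal_mult'[symmetric]) simp
      also have "\<dots> = ennreal (normal_density a s1 u * normal_density b s2 v)"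
        unfolding g_def a_def b_def s1_def s2_def by (subst bivariate_normal_density_rotate[OF s r]) simp
      also have "\<dots> = ?n1 u * ?n2 v" by (rule ennreal_mult') simp
      finally show ?thesis .
    qed
    ultimately show "2 * (f (\<sigma>X / g * (u + v), (u - v) / (\<sigma>X / g)) * indicator A ((\<sigma>X / g * (u + v)) * ((u - v) / (\<sigma>X / g)))) =
       ?n1 u * (?n2 v * indicator A (u\<^sup>2 + - v\<^sup>2))"
      by (simp add: mult.assoc[symmetric])
  qed
  also have "\<dots> = (\<integral>\<^sup>+u. ?n1 u * (\<integral>\<^sup>+v. ?n2 v * indicator A (u\<^sup>2 + - v\<^sup>2) \<partial>lborel) \<partial>lborel)"
    by (simp add: nn_integral_cmult)
  also have "\<dots> = (\<integral>\<^sup>+u. \<integral>\<^sup>+v. indicator A (u\<^sup>2 + - v\<^sup>2) \<partial>density lborel ?n2 \<partial>density lborel ?n1)"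
    by (simp add: nn_integral_density)
  also have "\<dots> = emeasure (distr (density lborel ?n1) borel power2 \<star> distr (density lborel ?n2) borel (\<lambda>v. - v\<^sup>2)) A"
    by (simp add: convolution_emeasure' n1.finite_measure_distr n2.finite_measure_distr nn_integral_distr)
  also have "distr (density lborel ?n2) borel (\<lambda>v. - v\<^sup>2) = distr (distr (density lborel ?n2) borel power2) borel uminus"
    by (subst distr_distr) (auto simp: comp_def)
  also have "(distr (density lborel ?n1) borel power2 \<star> \<dots>) = ?E"
    unfolding distr_normal_square[OF s12(1)] distr_normal_square[OF s12(2)] p l
    using pos by (simp add: noncentral_gamma_diff_convolution flip: density_reflect)
  finally show "emeasure ?D A = emeasure ?E A" .
qed simp

text \<open>The induction starts from a single summand because the empty sum is the constant
  \<open>0\<close>, which has no density. Every further summand raises the shape by \<open>r\<close>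
  and the Poisson means by \<open>l\<close> and \<open>m\<close>, at fixed rates.\<close>

lemma (in prob_space) distr_sum_noncentral_gamma_diff:
  assumes "finite I" "I \<noteq> {}" and indep: "indep_vars (\<lambda>_. borel) Z I"
    and Z: "\<And>i. i \<in> I \<Longrightarrow> distr M borel (Z i) = density lborel (noncentral_gamma_diff_density r p l q m)"
    and pos: "r > 0" "p > 0" "l \<ge> 0" "q > 0" "m \<ge> 0"
  shows "distr M borel (\<lambda>\<omega>. \<Sum>i\<in>I. Z i \<omega>) =
    density lborel (noncentral_gamma_diff_density (real (card I) * r) p (real (card I) * l) q (real (card I) * m))"
  using assms(1,2) indep Z
proof (induction I rule: finite_ne_induct)
  case (singleton i)
  then show ?case by simp
next
  case (insert i I)
  have rv: "random_variable borel (Z j)" if "j \<in> insert i I" for j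
    using insert.prems(1) that unfolding indep_vars_def by auto
  have card: "real (card I) > 0" using insert by (simp add: card_gt_0_iff)
  have "indep_vars (\<lambda>_. borel) Z I" using insert.prems(1) by (rule indep_vars_subset) auto
  then have IH: "distr M borel (\<lambda>\<omega>. \<Sum>i\<in>I. Z i \<omega>) =
    density lborel (noncentral_gamma_diff_density (real (card I) * r) p (real (card I) * l) q (real (card I) * m))"
    using insert by simp
  have "distr M borel (\<lambda>\<omega>. \<Sum>j\<in>insert i I. Z j \<omega>) = distr M borel (\<lambda>\<omega>. Z i \<omega> + (\<Sum>j\<in>I. Z j \<omega>))"
    using insert by simp
  also have "\<dots> = (distr M borel (Z i) \<star> distr M borel (\<lambda>\<omega>. \<Sum>j\<in>I. Z j \<omega>))"
    using insert rv by (intro sum_indep_random_variable indep_vars_sum) auto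
  also have "\<dots> = density lborel (noncentral_gamma_diff_density (r + real (card I) * r) p (l + real (card I) * l) q (m + real (card I) * m))"
    unfolding IH insert.prems(2)[of i, simplified] using pos card
    by (intro noncentral_gamma_diff_density_convolution) auto
  finally show ?case using insert by (simp add: algebra_simps)
qed

subsection \<open>The series expansion of the density\<close>

lemma nn_integral_tricomi_kernel_finite:
  assumes "\<beta> > 0" "z \<ge> 0" "z > 0 \<or> \<alpha> + \<beta> > 1"
  shows "(\<integral>\<^sup>+t. ennreal (tricomi_kernel (\<alpha> - 1) \<beta> z t) \<partial>lborel) < \<top>"
proof (cases "z = 0")
  case True
  then show ?thesis using assms nn_integral_tricomi_kernel_0[of \<alpha> \<beta>] by simp
next
  case False
  then show ?thesis using assms by (simp add: nn_integral_tricomi_kernel)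
qed

lemma nn_integral_tricomi_kernel_rate:
  assumes m: "m > 0"
  shows "(\<integral>\<^sup>+t. ennreal (indicator {0<..} t * ((x + t) powr (\<alpha> - 1) * t powr (\<beta> - 1) * exp (- (m * t)))) \<partial>lborel) =
    ennreal (m powr (1 - \<alpha> - \<beta>)) * (\<integral>\<^sup>+t. ennreal (tricomi_kernel (\<alpha> - 1) \<beta> (m * x) t) \<partial>lborel)"
proof -
  have "(\<integral>\<^sup>+t. ennreal (tricomi_kernel (\<alpha> - 1) \<beta> (m * x) t) \<partial>lborel) =
     ennreal m * (\<integral>\<^sup>+t. ennreal (tricomi_kernel (\<alpha> - 1) \<beta> (m * x) (m * t)) \<partial>lborel)"
    using m by (subst nn_integral_real_affine[where c=m and t=0]) auto
  also have "(\<integral>\<^sup>+t. ennreal (tricomi_kernel (\<alpha> - 1) \<beta> (m * x) (m * t)) \<partial>lborel) =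
    (\<integral>\<^sup>+t. ennreal (m powr (\<alpha> + \<beta> - 2)) * ennreal (indicator {0<..} t * ((x + t) powr (\<alpha> - 1) * t powr (\<beta> - 1) * exp (- (m * t)))) \<partial>lborel)"
  proof (rule nn_integral_cong)
    fix t :: real
    have "tricomi_kernel (\<alpha> - 1) \<beta> (m * x) (m * t) = m powr (\<alpha> + \<beta> - 2) * (indicator {0<..} t * ((x + t) powr (\<alpha> - 1) * t powr (\<beta> - 1) * exp (- (m * t))))"
    proof (cases "t > 0")
      case True
      have 1: "m * x + m * t = m * (x + t)" by (simp add: algebra_simps)
      have 2: "m powr (\<alpha> + \<beta> - 2) = m powr (\<alpha> - 1) * m powr (\<beta> - 1)" by (simp flip: powr_add)
      show ?thesis using True m unfolding tricomi_kernel_def 1 2 by (simp add: powr_mult)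
    qed (use m in \<open>simp add: tricomi_kernel_def zero_less_mult_iff\<close>)
    then show "ennreal (tricomi_kernel (\<alpha> - 1) \<beta> (m * x) (m * t)) = ennreal (m powr (\<alpha> + \<beta> - 2)) * ennreal (indicator {0<..} t * ((x + t) powr (\<alpha> - 1) * t powr (\<beta> - 1) * exp (- (m * t))))"
      by (simp add: ennreal_mult')
  qed
  also have "\<dots> = ennreal (m powr (\<alpha> + \<beta> - 2)) * (\<integral>\<^sup>+t. ennreal (indicator {0<..} t * ((x + t) powr (\<alpha> - 1) * t powr (\<beta> - 1) * exp (- (m * t)))) \<partial>lborel)"
    by (rule nn_integral_cmult) simp
  finally have *: "(\<integral>\<^sup>+t. ennreal (tricomi_kernel (\<alpha> - 1) \<beta> (m * x) t) \<partial>lborel) =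
     ennreal (m * m powr (\<alpha> + \<beta> - 2)) * (\<integral>\<^sup>+t. ennreal (indicator {0<..} t * ((x + t) powr (\<alpha> - 1) * t powr (\<beta> - 1) * exp (- (m * t)))) \<partial>lborel)"
    using m by (simp add: ennreal_mult' mult.assoc)
  have "m powr (1 - \<alpha> - \<beta>) * (m * m powr (\<alpha> + \<beta> - 2)) = m powr (1 - \<alpha> - \<beta> + (1 + (\<alpha> + \<beta> - 2)))"
    using m by (simp only: powr_mult_base powr_add less_imp_le)
  also have "\<dots> = 1" using m by simp
  finally have "ennreal (m powr (1 - \<alpha> - \<beta>)) * ennreal (m * m powr (\<alpha> + \<beta> - 2)) = 1"
    by (simp flip: ennreal_mult')
  then show ?thesis unfolding * by (simp flip: mult.assoc)
qed

text \<open>The exponentials combine to \<open>exp (- (p * x)) * exp (- ((p + q) * t))\<close>, so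
  scaling by \<open>p + q\<close> leads to Tricomi's kernel at \<open>(p + q) * x\<close>. The
  factor \<open>rGamma \<beta>\<close> is kept next to the integral because together they form
  \<open>U\<close>.\<close>

lemma nn_integral_gamma_density_shift:
  assumes al: "\<alpha> > 0" and be: "\<beta> > 0" and p: "p > 0" and q: "q > 0" and x: "x \<ge> 0"
  shows "(\<integral>\<^sup>+t. gamma_density \<alpha> p (x + t) * gamma_density \<beta> q t \<partial>lborel) =
    ennreal (p powr \<alpha> * q powr \<beta> / Gamma \<alpha> * exp (- (p * x)) * (p + q) powr (1 - \<alpha> - \<beta>)) *
    (ennreal (rGamma \<beta>) * (\<integral>\<^sup>+t. ennreal (tricomi_kernel (\<alpha> - 1) \<beta> ((p + q) * x) t) \<partial>lborel))"
proof -
  have G: "Gamma \<alpha> > 0" "Gamma \<beta> > 0" using al be by (auto intro: Gamma_real_pos)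
  define K where "K = p powr \<alpha> * q powr \<beta> / Gamma \<alpha> * exp (- (p * x))"
  have K: "K \<ge> 0" using G by (simp add: K_def)
  have R: "rGamma \<beta> \<ge> 0" "inverse (Gamma \<beta>) = rGamma \<beta>" using G by (simp_all add: rGamma_inverse_Gamma)
  have "(\<integral>\<^sup>+t. gamma_density \<alpha> p (x + t) * gamma_density \<beta> q t \<partial>lborel) =
    (\<integral>\<^sup>+t. ennreal (K * rGamma \<beta>) * ennreal (indicator {0<..} t * ((x + t) powr (\<alpha> - 1) * t powr (\<beta> - 1) * exp (- ((p + q) * t)))) \<partial>lborel)"
  proof (rule nn_integral_cong)
    fix t :: real
    show "gamma_density \<alpha> p (x + t) * gamma_density \<beta> q t = ennreal (K * rGamma \<beta>) * ennreal (indicator {0<..} t * ((x + t) powr (\<alpha> - 1) * t powr (\<beta> - 1) * exp (- ((p + q) * t))))"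
    proof (cases "t > 0")
      case True
      have e: "exp (- (p * (x + t))) * exp (- (q * t)) = exp (- (p * x)) * exp (- ((p + q) * t))"
        by (simp add: algebra_simps flip: exp_add)
      have "(p powr \<alpha> / Gamma \<alpha> * ((x + t) powr (\<alpha> - 1) * exp (- (p * (x + t))))) * (q powr \<beta> / Gamma \<beta> * (t powr (\<beta> - 1) * exp (- (q * t))))
        = p powr \<alpha> / Gamma \<alpha> * (x + t) powr (\<alpha> - 1) * (q powr \<beta> / Gamma \<beta> * t powr (\<beta> - 1)) * (exp (- (p * (x + t))) * exp (- (q * t)))"
        by simp
      also have "\<dots> = (K * rGamma \<beta>) * ((x + t) powr (\<alpha> - 1) * t powr (\<beta> - 1) * exp (- ((p + q) * t)))"
        unfolding e K_def R(2)[symmetric] divide_inverse by simp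
      finally show ?thesis using True x K R G
        by (simp add: gamma_density_def flip: ennreal_mult')
    qed (simp add: gamma_density_def)
  qed
  also have "\<dots> = ennreal (K * rGamma \<beta>) * (\<integral>\<^sup>+t. ennreal (indicator {0<..} t * ((x + t) powr (\<alpha> - 1) * t powr (\<beta> - 1) * exp (- ((p + q) * t)))) \<partial>lborel)"
    by (rule nn_integral_cmult) simp
  also have "\<dots> = ennreal (K * rGamma \<beta>) * (ennreal ((p + q) powr (1 - \<alpha> - \<beta>)) * (\<integral>\<^sup>+t. ennreal (tricomi_kernel (\<alpha> - 1) \<beta> ((p + q) * x) t) \<partial>lborel))"
    using p q by (subst nn_integral_tricomi_kernel_rate) auto
  also have "\<dots> = ennreal (K * (p + q) powr (1 - \<alpha> - \<beta>)) * (ennreal (rGamma \<beta>) * (\<integral>\<^sup>+t. ennreal (tricomi_kernel (\<alpha> - 1) \<beta> ((p + q) * x) t) \<partial>lborel))"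
    using K R by (simp add: ennreal_mult'' ennreal_mult mult_ac)
  finally show ?thesis by (simp add: K_def)
qed

text \<open>The translation \<open>t -> t - x\<close> exchanges the roles of the two
  variables.\<close>

lemma noncentral_gamma_diff_density_reflect:
  "noncentral_gamma_diff_density r p l q m x = noncentral_gamma_diff_density r q m p l (- x)"
  unfolding noncentral_gamma_diff_density_def
  by (subst nn_integral_real_affine[where c=1 and t="- x"]) (simp_all add: mult.commute)

lemma noncentral_gamma_diff_density_eq_suminf:
  "noncentral_gamma_diff_density r p l q m x = (\<Sum>i. \<Sum>j. ennreal (poisson_weight l i) * ennreal (poisson_weight m j) *
    (\<integral>\<^sup>+t. gamma_density (r + real i) p (x + t) * gamma_density (r + real j) q t \<partial>lborel))"
proof -
  have "noncentral_gamma_diff_density r p l q m x = (\<integral>\<^sup>+t. (\<Sum>i. \<Sum>j. ennreal (poisson_weight l i) * ennreal (poisson_weight m j) *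
     (gamma_density (r + real i) p (x + t) * gamma_density (r + real j) q t)) \<partial>lborel)"
    unfolding noncentral_gamma_diff_density_def noncentral_gamma_density_def
    by (intro nn_integral_cong) (simp add: mult_ac flip: ennreal_suminf_cmult ennreal_suminf_multc)
  then show ?thesis by (simp add: nn_integral_suminf nn_integral_cmult)
qed

lemma noncentral_gamma_diff_density_series:
  "noncentral_gamma_diff_density r p l q m x = (\<Sum>k. \<Sum>j\<le>k. ennreal (poisson_weight l (k - j)) * ennreal (poisson_weight m j) *
    (\<integral>\<^sup>+t. gamma_density (r + real (k - j)) p (x + t) * gamma_density (r + real j) q t \<partial>lborel))"
  unfolding noncentral_gamma_diff_density_eq_suminf by (rule suminf_ennreal_antidiagonal)

text \<open>For \<open>x < 0\<close> the nonnegative shift is \<open>- x\<close>, so the subtracted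
  variable takes the shifted place, and its index \<open>j\<close> becomes the one in
  \<open>\<alpha>\<close>. This is the origin of the case distinction in \<open>a_idx\<close>. The
  indices are swapped back so that \<open>j\<close> keeps counting the weights of
  \<open>m\<close>.\<close>

lemma noncentral_gamma_diff_density_series_reflected:
  "noncentral_gamma_diff_density r p l q m x = (\<Sum>k. \<Sum>j\<le>k. ennreal (poisson_weight l (k - j)) * ennreal (poisson_weight m j) *
    (\<integral>\<^sup>+t. gamma_density (r + real j) q (- x + t) * gamma_density (r + real (k - j)) p t \<partial>lborel))"
proof -
  have "noncentral_gamma_diff_density r p l q m x = (\<Sum>i. \<Sum>j. ennreal (poisson_weight m i) * ennreal (poisson_weight l j) *
    (\<integral>\<^sup>+t. gamma_density (r + real i) q (- x + t) * gamma_density (r + real j) p t \<partial>lborel))"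
    unfolding noncentral_gamma_diff_density_reflect[of r p] by (rule noncentral_gamma_diff_density_eq_suminf)
  also have "\<dots> = (\<Sum>j. \<Sum>i. ennreal (poisson_weight m i) * ennreal (poisson_weight l j) *
    (\<integral>\<^sup>+t. gamma_density (r + real i) q (- x + t) * gamma_density (r + real j) p t \<partial>lborel))"
    by (rule suminf_ennreal_swap)
  also have "\<dots> = (\<Sum>k. \<Sum>j\<le>k. ennreal (poisson_weight m j) * ennreal (poisson_weight l (k - j)) *
    (\<integral>\<^sup>+t. gamma_density (r + real j) q (- x + t) * gamma_density (r + real (k - j)) p t \<partial>lborel))"
    by (rule suminf_ennreal_antidiagonal)
  finally show ?thesis by (simp only: mult.commute mult.left_commute mult.assoc)
qed

section \<open>Finiteness of the density, and its single pole\<close>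

lemma power_over_Gamma_bounded:
  fixes c r :: real
  assumes r: "r > 0" and c: "c \<ge> 0"
  shows "\<exists>B\<ge>0. \<forall>i. c ^ i / Gamma (r + real i) \<le> B"
proof -
  let ?f = "\<lambda>i. c ^ i / Gamma (r + real i)"
  have G: "Gamma (r + real i) > 0" for i using r by (intro Gamma_real_pos) auto
  have G1: "Gamma (r + real (Suc i)) = (r + real i) * Gamma (r + real i)" for i
  proof -
    have "r + real i \<notin> \<int>\<^sub>\<le>\<^sub>0" using r nonpos_Ints_nonpos[of "r + real i"] by force
    then show ?thesis using Gamma_plus1[of "r + real i"] by (simp add: add_ac)
  qed
  obtain N where N: "2 * c < real N" using reals_Archimedean2 by blast
  have "summable ?f"
  proof (rule summable_ratio_test[of "1/2" N])
    fix i assume i: "i \<ge> N"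
    have c2: "c / (r + real i) \<le> 1/2" using N i r c by (simp add: field_simps)
    have "norm (?f (Suc i)) = c / (r + real i) * norm (?f i)"
      using c r G[of i] by (simp add: G1 abs_mult abs_divide del: of_nat_Suc)
    also have "\<dots> \<le> 1/2 * norm (?f i)" using c2 by (rule mult_right_mono) simp
    finally show "norm (?f (Suc i)) \<le> 1/2 * norm (?f i)" .
  qed simp
  then have "Bseq ?f" by (intro convergent_imp_Bseq) (auto intro: summable_LIMSEQ_zero simp: convergent_def)
  then obtain B where B: "B > 0" "\<And>i. norm (?f i) \<le> B" by (elim BseqE) blast
  then have "\<And>i. ?f i \<le> B" by (metis order_trans abs_ge_self real_norm_def)
  with B(1) show ?thesis by (intro exI[of _ B]) auto
qed

text \<open>Half of the decay rate pays for the series, whose coefficients are bounded by those of an exponential.\<close>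

lemma noncentral_gamma_density_bound:
  assumes r: "r > 0" and p: "p > 0" and l: "l \<ge> 0"
  shows "\<exists>C\<ge>0. \<forall>x. noncentral_gamma_density r p l x \<le> ennreal (C * (indicator {0<..} x * (x powr (r - 1) * exp (- (p / 2 * x)))))"
proof -
  obtain B where B: "B \<ge> 0" "\<And>i. (2 * l) ^ i / Gamma (r + real i) \<le> B"
    using power_over_Gamma_bounded[OF r, of "2 * l"] l by auto
  define C where "C = exp (- l) * p powr r * B"
  have "noncentral_gamma_density r p l x \<le> ennreal (C * (indicator {0<..} x * (x powr (r - 1) * exp (- (p / 2 * x)))))" for x
  proof (cases "x > 0")
    case x: True
    define K where "K = exp (- l) * p powr r * x powr (r - 1) * exp (- (p * x))"
    have K: "K \<ge> 0" by (simp add: K_def)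
    have G: "Gamma (r + real i) > 0" for i using r by (intro Gamma_real_pos) auto
    have "noncentral_gamma_density r p l x \<le> (\<Sum>i. ennreal (K * B * ((p * x / 2) ^ i /\<^sub>R fact i)))"
      unfolding noncentral_gamma_density_def
    proof (intro suminf_le summableI)
      fix i
      have "poisson_weight l i * (p powr (r + real i) / Gamma (r + real i) * (x powr (r + real i - 1) * exp (- (p * x)))) =
         K * ((2 * l) ^ i / Gamma (r + real i)) * ((p * x / 2) ^ i /\<^sub>R fact i)"
      proof -
        have "p powr (r + real i) = p powr r * p ^ i" using p by (simp add: powr_add powr_realpow)
        moreover have "x powr (r + real i - 1) = x powr (r - 1) * x ^ i"
          using x by (simp flip: powr_realpow powr_add) (simp add: algebra_simps)
        ultimately show ?thesis
          by (simp add: K_def poisson_weight_def power_mult_distrib power_divide field_simps)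
      qed
      also have "\<dots> \<le> K * B * ((p * x / 2) ^ i /\<^sub>R fact i)"
        using x p K B by (intro mult_right_mono mult_left_mono) auto
      finally show "ennreal (poisson_weight l i) * gamma_density (r + real i) p x \<le> ennreal (K * B * ((p * x / 2) ^ i /\<^sub>R fact i))"
        using x l by (simp add: gamma_density_def poisson_weight_nonneg ennreal_leI flip: ennreal_mult')
    qed
    also have "\<dots> = ennreal (K * B * exp (p * x / 2))"
      using x p K B by (intro suminf_ennreal_eq sums_mult exp_converges) auto
    also have "K * B * exp (p * x / 2) = C * (x powr (r - 1) * exp (- (p / 2 * x)))"
    proof -
      have "exp (- (p * x)) * exp (p * x / 2) = exp (- (p / 2 * x))" by (simp flip: exp_add)
      then show ?thesis by (simp add: K_def C_def mult_ac)
    qed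
    finally show ?thesis using x by simp
  qed (simp add: noncentral_gamma_density_nonpos)
  moreover have "C \<ge> 0" using B by (simp add: C_def)
  ultimately show ?thesis by blast
qed

text \<open>Replacing both mixtures by their single-term majorants and bounding the exponential of
  the first one by \<open>1\<close> leaves Tricomi's kernel with
  \<open>\<alpha> = \<beta> = r\<close>; its integral is finite for \<open>x > 0\<close>, and also
  at \<open>x = 0\<close> if \<open>2 * r > 1\<close>.\<close>

lemma noncentral_gamma_diff_density_finite_nonneg:
  assumes r: "r > 0" and p: "p > 0" "q > 0" and l: "l \<ge> 0" "m \<ge> 0" and x: "x \<ge> 0" "x > 0 \<or> r > 1/2"
  shows "noncentral_gamma_diff_density r p l q m x < \<top>"
proof -
  obtain C where C: "C \<ge> 0" "\<And>x. noncentral_gamma_density r p l x \<le> ennreal (C * (indicator {0<..} x * (x powr (r - 1) * exp (- (p / 2 * x)))))"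
    using noncentral_gamma_density_bound[OF r p(1) l(1)] by blast
  obtain D where D: "D \<ge> 0" "\<And>x. noncentral_gamma_density r q m x \<le> ennreal (D * (indicator {0<..} x * (x powr (r - 1) * exp (- (q / 2 * x)))))"
    using noncentral_gamma_density_bound[OF r p(2) l(2)] by blast
  have "noncentral_gamma_diff_density r p l q m x \<le>
    (\<integral>\<^sup>+t. ennreal (C * D) * ennreal (indicator {0<..} t * ((x + t) powr (r - 1) * t powr (r - 1) * exp (- (q / 2 * t)))) \<partial>lborel)"
    unfolding noncentral_gamma_diff_density_def
  proof (rule nn_integral_mono)
    fix t :: real
    show "noncentral_gamma_density r p l (x + t) * noncentral_gamma_density r q m t \<le>
      ennreal (C * D) * ennreal (indicator {0<..} t * ((x + t) powr (r - 1) * t powr (r - 1) * exp (- (q / 2 * t))))"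
    proof (cases "t > 0")
      case True
      have "noncentral_gamma_density r p l (x + t) * noncentral_gamma_density r q m t \<le>
         ennreal (C * ((x + t) powr (r - 1) * exp (- (p / 2 * (x + t))))) * ennreal (D * (t powr (r - 1) * exp (- (q / 2 * t))))"
        using C(2)[of "x + t"] D(2)[of t] True x by (intro mult_mono) auto
      also have "\<dots> = ennreal (C * ((x + t) powr (r - 1) * exp (- (p / 2 * (x + t)))) * (D * (t powr (r - 1) * exp (- (q / 2 * t)))))"
        using C D by (simp add: ennreal_mult)
      also have "C * ((x + t) powr (r - 1) * exp (- (p / 2 * (x + t)))) * (D * (t powr (r - 1) * exp (- (q / 2 * t))))
         \<le> C * ((x + t) powr (r - 1) * 1) * (D * (t powr (r - 1) * exp (- (q / 2 * t))))"
        using C D True x p by (intro mult_right_mono mult_left_mono) auto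
      also have "\<dots> = C * D * ((x + t) powr (r - 1) * t powr (r - 1) * exp (- (q / 2 * t)))" by simp
      finally show ?thesis using True C D by (simp add: ennreal_mult ennreal_leI)
    qed (simp add: noncentral_gamma_density_nonpos)
  qed
  also have "\<dots> = ennreal (C * D) * (ennreal ((q / 2) powr (1 - r - r)) * (\<integral>\<^sup>+t. ennreal (tricomi_kernel (r - 1) r (q / 2 * x) t) \<partial>lborel))"
    using p by (subst nn_integral_cmult) (auto simp only: nn_integral_tricomi_kernel_rate[of "q / 2"] half_gt_zero, simp)
  also have "\<dots> < \<top>"
    using nn_integral_tricomi_kernel_finite[of r "q / 2 * x" r] r x p
    by (intro ennreal_mult_less_top[THEN iffD2] disjI2 conjI) (auto simp: ennreal_mult_less_top)
  finally show ?thesis .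
qed

lemma noncentral_gamma_diff_density_finite:
  assumes "r > 0" "p > 0" "q > 0" "l \<ge> 0" "m \<ge> 0" "x \<noteq> 0 \<or> r > 1/2"
  shows "noncentral_gamma_diff_density r p l q m x < \<top>"
proof (cases "x \<ge> 0")
  case True
  then show ?thesis using assms by (intro noncentral_gamma_diff_density_finite_nonneg) auto
next
  case False
  then show ?thesis using assms
    unfolding noncentral_gamma_diff_density_reflect[of r p]
    by (intro noncentral_gamma_diff_density_finite_nonneg) auto
qed

text \<open>The terms of index \<open>0\<close> already suffice: their Poisson weights are positive,
  and their product behaves like \<open>1 / t\<close> at the origin.\<close>

lemma noncentral_gamma_diff_density_top:
  assumes p: "p > 0" "q > 0" and l: "l \<ge> 0" "m \<ge> 0"
  shows "noncentral_gamma_diff_density (1/2) p l q m 0 = \<top>"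
proof -
  have lb: "ennreal (poisson_weight l 0) * gamma_density r p x \<le> noncentral_gamma_density r p l x" for r p l x
    unfolding noncentral_gamma_density_def
    using sum_le_suminf[of "\<lambda>i. ennreal (poisson_weight l i) * gamma_density (r + real i) p x" "{0}"] by simp
  have "(\<integral>\<^sup>+t. ennreal (tricomi_kernel (1/2 - 1) (1/2) ((p + q) * 0) t) \<partial>lborel) = \<top>"
    using nn_integral_tricomi_kernel_top[of "1/2" "1/2"] by simp
  then have "(\<integral>\<^sup>+t. gamma_density (1/2) p (0 + t) * gamma_density (1/2) q t \<partial>lborel) = \<top>"
    using p by (subst nn_integral_gamma_density_shift)
      (auto simp: ennreal_mult_top ennreal_top_mult rGamma_inverse_Gamma Gamma_one_half_real simp del: mult_zero_right)
  then have "\<top> = (\<integral>\<^sup>+t. ennreal (poisson_weight l 0) * ennreal (poisson_weight m 0) * (gamma_density (1/2) p (0 + t) * gamma_density (1/2) q t) \<partial>lborel)"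
    by (subst nn_integral_cmult) (auto simp: ennreal_mult_top poisson_weight_def simp flip: ennreal_mult')
  also have "\<dots> \<le> noncentral_gamma_diff_density (1/2) p l q m 0"
    unfolding noncentral_gamma_diff_density_def
  proof (rule nn_integral_mono)
    fix t
    have "ennreal (poisson_weight l 0) * gamma_density (1/2) p (0 + t) * (ennreal (poisson_weight m 0) * gamma_density (1/2) q t) \<le>
      noncentral_gamma_density (1/2) p l (0 + t) * noncentral_gamma_density (1/2) q m t"
      by (intro mult_mono lb) auto
    then show "ennreal (poisson_weight l 0) * ennreal (poisson_weight m 0) * (gamma_density (1/2) p (0 + t) * gamma_density (1/2) q t) \<le>
      noncentral_gamma_density (1/2) p l (0 + t) * noncentral_gamma_density (1/2) q m t"
      by (simp only: mult.commute mult.left_commute mult.assoc)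
  qed
  finally show ?thesis by (simp add: top_unique)
qed

text \<open>The quantities \<open>e\<close> and \<open>G\<close> stand for the exponent and the
  Gamma factor, which depend on the sign of \<open>x\<close>; leaving them abstract lets one
  computation serve both signs.\<close>

lemma series_coefficient:
  fixes n j k :: nat and \<rho> \<sigma>X \<sigma>Y \<mu>X \<mu>Y e G :: real
  assumes s: "\<sigma>X > 0" "\<sigma>Y > 0" and r: "-1 < \<rho>" "\<rho> < 1" and n: "n \<ge> 1" and j: "j \<le> k"
  defines "p \<equiv> 1 / (\<sigma>X * \<sigma>Y * (1 + \<rho>))" and "q \<equiv> 1 / (\<sigma>X * \<sigma>Y * (1 - \<rho>))"
    and "l \<equiv> (\<mu>X / \<sigma>X + \<mu>Y / \<sigma>Y)\<^sup>2 / (4 * (1 + \<rho>))" and "m \<equiv> (\<mu>X / \<sigma>X - \<mu>Y / \<sigma>Y)\<^sup>2 / (4 * (1 - \<rho>))"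
  shows "(1 - \<rho>\<^sup>2) powr (real n / 2 - 1) / (2 ^ (n - 1) * \<sigma>X * \<sigma>Y) *
       exp (- (real n / (2 * (1 - \<rho>\<^sup>2))) *
              (\<mu>X\<^sup>2 / \<sigma>X\<^sup>2 + \<mu>Y\<^sup>2 / \<sigma>Y\<^sup>2 - 2 * \<rho> * \<mu>X * \<mu>Y / (\<sigma>X * \<sigma>Y)) - e) *
     ((real n / 8) ^ k / (fact k * G) * real (k choose j) *
          ((1 + \<rho>) / (1 - \<rho>)) ^ j * (\<mu>X / \<sigma>X - \<mu>Y / \<sigma>Y) ^ (2 * j) *
          ((1 - \<rho>) / (1 + \<rho>)) ^ (k - j) * (\<mu>X / \<sigma>X + \<mu>Y / \<sigma>Y) ^ (2 * k - 2 * j)) =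
     poisson_weight (real n * l) (k - j) * poisson_weight (real n * m) j *
      (p powr (real n / 2 + real (k - j)) * q powr (real n / 2 + real j) / G * exp (- e) *
       (p + q) powr (1 - (real n / 2 + real (k - j)) - (real n / 2 + real j)))"
proof -
  define i where "i = k - j"
  have k: "k = i + j" using j by (simp add: i_def)
  define R where "R = 1 + \<rho>"
  define S where "S = 1 - \<rho>"
  define s where "s = \<sigma>X * \<sigma>Y"
  define u where "u = \<mu>X / \<sigma>X + \<mu>Y / \<sigma>Y"
  define v where "v = \<mu>X / \<sigma>X - \<mu>Y / \<sigma>Y"
  have pos: "R > 0" "S > 0" "s > 0" using r assms(1,2) by (simp_all add: R_def S_def s_def)
  have RS: "1 - \<rho>\<^sup>2 = R * S" by (simp add: R_def S_def power2_eq_square algebra_simps)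
  have sum2: "R + S = 2" by (simp add: R_def S_def)
  have pq: "p = 1 / (s * R)" "q = 1 / (s * S)" by (simp_all add: p_def q_def R_def S_def s_def)
  have ppos: "p > 0" "q > 0" using pos by (simp_all add: pq)
  have psum: "p + q = 2 / (s * (R * S))"
  proof -
    have "p + q = (R + S) / (s * (R * S))" using pos by (simp add: pq field_simps)
    then show ?thesis by (simp add: sum2)
  qed
  have lm: "l = u\<^sup>2 / (4 * R)" "m = v\<^sup>2 / (4 * S)" by (simp_all add: l_def m_def u_def v_def R_def S_def)
  define E where "E = \<mu>X\<^sup>2 / \<sigma>X\<^sup>2 + \<mu>Y\<^sup>2 / \<sigma>Y\<^sup>2 - 2 * \<rho> * \<mu>X * \<mu>Y / (\<sigma>X * \<sigma>Y)"
  \<comment> \<open>The two Poisson factors \<open>exp (- (real n * l))\<close> and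
    \<open>exp (- (real n * m))\<close> merge into the exponential of the quadratic form in the
    means.\<close>
  have ex: "real n * l + real n * m = real n / (2 * (R * S)) * E"
  proof -
    have "u\<^sup>2 * S + v\<^sup>2 * R = 2 * E"
    proof -
      define a where "a = \<mu>X / \<sigma>X"
      define b where "b = \<mu>Y / \<sigma>Y"
      have "(a + b)\<^sup>2 * (1 - \<rho>) + (a - b)\<^sup>2 * (1 + \<rho>) = 2 * (a\<^sup>2 + b\<^sup>2 - 2 * \<rho> * (a * b))"
        by (simp add: power2_eq_square algebra_simps)
      then show ?thesis by (simp add: a_def b_def E_def u_def v_def R_def S_def power_divide)
    qed
    moreover have "real n * l + real n * m = real n / (2 * (R * S)) * ((u\<^sup>2 * S + v\<^sup>2 * R) / 2)"
      using pos by (simp add: lm field_simps)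
    ultimately show ?thesis by simp
  qed
  \<comment> \<open>All half-integral powers are expressed through \<open>T\<close>; apart from
    \<open>T * T = (R * S) ^ n\<close> only natural powers have to be compared.\<close>
  define T where "T = (R * S) powr (real n / 2)"
  have T: "T > 0" "T * T = (R * S) ^ n"
    using pos by (simp_all add: T_def powr_realpow flip: powr_add)
  have T1: "(1 - \<rho>\<^sup>2) powr (real n / 2 - 1) = T / (R * S)"
    unfolding RS T_def using pos by (subst powr_diff) simp
  have pw: "p powr (real n / 2 + real i) * q powr (real n / 2 + real j) = p ^ i * q ^ j / (s ^ n * T)"
  proof -
    have "p powr (real n / 2) * q powr (real n / 2) = (1 / (s\<^sup>2 * (R * S))) powr (real n / 2)"
      using ppos pos by (simp add: pq power2_eq_square mult_ac flip: powr_mult)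
    also have "\<dots> = 1 / ((s\<^sup>2) powr (real n / 2) * T)"
      using pos by (simp add: powr_divide powr_mult T_def)
    also have "(s\<^sup>2) powr (real n / 2) = s ^ n"
    proof -
      have "(s\<^sup>2) powr (real n / 2) = (s powr 2) powr (real n / 2)" using pos by simp
      also have "\<dots> = s ^ n" using pos by (simp only: powr_powr) (simp add: powr_realpow)
      finally show ?thesis .
    qed
    finally have "p powr (real n / 2) * q powr (real n / 2) = 1 / (s ^ n * T)" .
    moreover have "p powr (real n / 2 + real i) * q powr (real n / 2 + real j) = (p powr (real n / 2) * q powr (real n / 2)) * (p ^ i * q ^ j)"
      using ppos by (simp add: powr_add powr_realpow)
    ultimately show ?thesis by simp
  qed
  have sw: "(p + q) powr (1 - (real n / 2 + real i) - (real n / 2 + real j)) = (p + q) / ((p + q) ^ n * (p + q) ^ k)"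
  proof -
    have "1 - (real n / 2 + real i) - (real n / 2 + real j) = 1 - (real n + real k)" by (simp add: k)
    then have "(p + q) powr (1 - (real n / 2 + real i) - (real n / 2 + real j)) = (p + q) powr 1 / (p + q) powr (real n + real k)"
      by (simp only: powr_diff)
    then show ?thesis using ppos by (simp add: powr_add powr_realpow)
  qed
  have front: "T / (R * S) / (2 ^ (n - 1) * s) = (p + q) / ((p + q) ^ n * (s ^ n * T))"
  proof -
    have n2: "(2::real) ^ n = 2 * 2 ^ (n - 1)" using n by (cases n) auto
    have "(p + q) ^ n * s ^ n = 2 ^ n / (R * S) ^ n"
      using pos unfolding psum by (simp add: power_divide power_mult_distrib)
    then have "(p + q) ^ n * (s ^ n * T) = 2 ^ n / (T * T) * T"
      by (simp only: T(2) mult.assoc[symmetric])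
    then have "(p + q) ^ n * (s ^ n * T) = 2 ^ n / T" using T(1) by simp
    then show ?thesis unfolding psum n2 using pos T(1) by simp
  qed
  \<comment> \<open>These ratios produce the \<open>1 / 8\<close> of the series: \<open>l\<close>
    carries a factor \<open>1 / 4\<close>, and multiplying by \<open>S / 2\<close> gives
    \<open>real n / 8 * (S / R) * u\<^sup>2\<close>; similarly for \<open>m\<close> and
    \<open>R / 2\<close>.\<close>
  have pr: "p / (p + q) = S / 2" "q / (p + q) = R / 2"
    unfolding psum using pos by (simp_all add: pq)
  have summand: "(real n / 8) ^ k / fact k * real (k choose j) * (R / S) ^ j * v ^ (2 * j) * (S / R) ^ i * u ^ (2 * i) =
    (real n * l) ^ i / fact i * ((real n * m) ^ j / fact j) * (p ^ i * q ^ j / (p + q) ^ k)"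
  proof -
    have ratio: "p ^ i * q ^ j / (p + q) ^ k = (S / 2) ^ i * (R / 2) ^ j"
      unfolding k pr[symmetric] by (simp add: power_divide power_add)
    have "(real n * l) ^ i / fact i * ((real n * m) ^ j / fact j) * (p ^ i * q ^ j / (p + q) ^ k) =
       (real n * l * (S / 2)) ^ i * (real n * m * (R / 2)) ^ j / (fact i * fact j)"
    proof -
      have "(real n * l) ^ i / fact i * ((real n * m) ^ j / fact j) * (A ^ i * B ^ j) =
          (real n * l * A) ^ i * (real n * m * B) ^ j / (fact i * fact j)" for A B
        by (simp add: power_mult_distrib)
      from this[of "S / 2" "R / 2"] show ?thesis unfolding ratio .
    qed
    also have "real n * l * (S / 2) = (real n / 8) * (S / R) * u\<^sup>2" by (simp add: lm)
    also have "real n * m * (R / 2) = (real n / 8) * (R / S) * v\<^sup>2" by (simp add: lm)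
    also have "((real n / 8) * (S / R) * u\<^sup>2) ^ i * ((real n / 8) * (R / S) * v\<^sup>2) ^ j / (fact i * fact j) =
      (real n / 8) ^ k / (fact i * fact j) * (R / S) ^ j * v ^ (2 * j) * (S / R) ^ i * u ^ (2 * i)"
      unfolding power_mult_distrib k power_add power_mult by simp
    also have "(real n / 8) ^ k / (fact i * fact j) = (real n / 8) ^ k / fact k * real (k choose j)"
      using binomial_fact[of j k, where 'a=real] by (simp add: k mult.commute)
    finally show ?thesis ..
  qed
  have exs: "exp (- (real n / (2 * (1 - \<rho>\<^sup>2))) * E - e) = exp (- (real n * l)) * exp (- (real n * m)) * exp (- e)"
    unfolding RS exp_add[symmetric] using ex by simp
  have k2: "2 * k - 2 * j = 2 * i" by (simp add: k)
  define L where "L = (real n * l) ^ i / fact i * ((real n * m) ^ j / fact j) * (p ^ i * q ^ j / (p + q) ^ k)"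
  have "(real n / 8) ^ k / (fact k * G) * real (k choose j) * (R / S) ^ j * v ^ (2 * j) * (S / R) ^ i * u ^ (2 * i) = L / G"
    unfolding L_def summand[symmetric] by simp
  moreover have "poisson_weight (real n * l) i * poisson_weight (real n * m) j *
      (p ^ i * q ^ j / (s ^ n * T) / G * exp (- e) * ((p + q) / ((p + q) ^ n * (p + q) ^ k))) =
     (p + q) / ((p + q) ^ n * (s ^ n * T)) * (exp (- (real n * l)) * exp (- (real n * m)) * exp (- e)) * (L / G)"
    unfolding L_def poisson_weight_def by (simp add: mult_ac)
  moreover have "2 ^ (n - 1) * \<sigma>X * \<sigma>Y = 2 ^ (n - 1) * s" by (simp add: s_def)
  ultimately show ?thesis
    unfolding k2 i_def[symmetric] pw sw T1 E_def[symmetric] exs R_def[symmetric] S_def[symmetric] u_def[symmetric] v_def[symmetric]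
    by (simp only: front)
qed

section \<open>Identification of the stated series with the density of the difference\<close>

lemma enn2ereal_mult: "enn2ereal (a * b) = enn2ereal a * enn2ereal b"
  by (rule times_ennreal.rep_eq)

text \<open>Both sides are compared term by term. The sign of \<open>x\<close> decides which of the
  two Gamma variables is shifted, hence which of the two series expansions of the right-hand side is
  used.\<close>

lemma sum_normal_products_pdf_eq:
  fixes n :: nat and \<rho> \<sigma>X \<sigma>Y \<mu>X \<mu>Y :: real
  assumes s: "\<sigma>X > 0" "\<sigma>Y > 0" and r: "-1 < \<rho>" "\<rho> < 1" and n: "n \<ge> 1"
  defines "p \<equiv> 1 / (\<sigma>X * \<sigma>Y * (1 + \<rho>))" and "q \<equiv> 1 / (\<sigma>X * \<sigma>Y * (1 - \<rho>))"
    and "l \<equiv> (\<mu>X / \<sigma>X + \<mu>Y / \<sigma>Y)\<^sup>2 / (4 * (1 + \<rho>))" and "m \<equiv> (\<mu>X / \<sigma>X - \<mu>Y / \<sigma>Y)\<^sup>2 / (4 * (1 - \<rho>))"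
  shows "sum_normal_products_pdf n \<mu>X \<mu>Y \<sigma>X \<sigma>Y \<rho> x =
    enn2ereal (noncentral_gamma_diff_density (real n / 2) p (real n * l) q (real n * m) x)"
proof -
  define C where "C = (1 - \<rho>\<^sup>2) powr (real n / 2 - 1) / (2 ^ (n - 1) * \<sigma>X * \<sigma>Y) *
       exp (- (real n / (2 * (1 - \<rho>\<^sup>2))) *
              (\<mu>X\<^sup>2 / \<sigma>X\<^sup>2 + \<mu>Y\<^sup>2 / \<sigma>Y\<^sup>2 - 2 * \<rho> * \<mu>X * \<mu>Y / (\<sigma>X * \<sigma>Y))
            - \<bar>x\<bar> / (\<sigma>X * \<sigma>Y * (1 + \<rho> * sgn x)))"
  define c where "c k j = (real n / 8) ^ k / (fact k * Gamma (real n / 2 + real (a_idx j k x))) *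
          real (k choose j) *
          ((1 + \<rho>) / (1 - \<rho>)) ^ j * (\<mu>X / \<sigma>X - \<mu>Y / \<sigma>Y) ^ (2 * j) *
          ((1 - \<rho>) / (1 + \<rho>)) ^ (k - j) * (\<mu>X / \<sigma>X + \<mu>Y / \<sigma>Y) ^ (2 * k - 2 * j)" for k j
  \<comment> \<open>The index complementary to \<open>a_idx j k x\<close>: it makes the two shapes
    add up to \<open>n + k\<close> for either sign of \<open>x\<close>.\<close>
  define b where "b k j = k - a_idx j k x" for k j :: nat
  define W where "W k j = ennreal (rGamma (real n / 2 + real (b k j))) *
     (\<integral>\<^sup>+t. ennreal (tricomi_kernel (real n / 2 + real (a_idx j k x) - 1) (real n / 2 + real (b k j)) ((p + q) * \<bar>x\<bar>) t) \<partial>lborel)" for k j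
  have pos: "p > 0" "q > 0" "l \<ge> 0" "m \<ge> 0" using s r by (simp_all add: p_def q_def l_def m_def)
  have rho2: "\<rho>\<^sup>2 < 1" using r by (simp add: power2_less_1_iff abs_less_iff)
  have C: "C \<ge> 0" using s rho2 by (simp add: C_def)
  have even_pow: "y ^ (2 * i) \<ge> 0" for y :: real and i by (simp add: power_mult)
  have c: "c k j \<ge> 0" for k j
  proof -
    have "Gamma (real n / 2 + real (a_idx j k x)) \<ge> 0" using n by (intro Gamma_real_nonneg) auto
    moreover have "(\<mu>X / \<sigma>X + \<mu>Y / \<sigma>Y) ^ (2 * k - 2 * j) \<ge> 0"
      using even_pow[of _ "k - j"] by (simp add: diff_mult_distrib2)
    ultimately show ?thesis unfolding c_def using r
      by (intro mult_nonneg_nonneg divide_nonneg_nonneg even_pow) auto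
  qed
  have ps: "p + q = 2 / (\<sigma>X * \<sigma>Y * (1 - \<rho>\<^sup>2))"
  proof -
    have "1 - \<rho>\<^sup>2 = (1 + \<rho>) * (1 - \<rho>)" by (simp add: power2_eq_square algebra_simps)
    then show ?thesis unfolding p_def q_def using s r by (simp add: divide_simps)
  qed
  have U: "tricomi_U (1 - real n / 2 - real (a_idx j k x)) (2 - real n - real k)
          (2 * \<bar>x\<bar> / (\<sigma>X * \<sigma>Y * (1 - \<rho>\<^sup>2))) = enn2ereal (W k j)" if "j \<le> k" for k j
  proof -
    let ?al = "real n / 2 + real (a_idx j k x)" and ?be = "real n / 2 + real (b k j)"
    have "a_idx j k x \<le> k" using that by (simp add: a_idx_def)
    then have ab: "?al + ?be = real (n + k)" by (simp add: b_def of_nat_diff)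
    have 1: "1 - real n / 2 - real (a_idx j k x) = 1 - ?al" by simp
    have 2: "2 - real n - real k = 2 - ?al - ?be" using ab by simp
    have 3: "2 * \<bar>x\<bar> / (\<sigma>X * \<sigma>Y * (1 - \<rho>\<^sup>2)) = (p + q) * \<bar>x\<bar>" by (simp add: ps)
    have "?al + ?be \<in> \<int>" unfolding ab by (rule Ints_of_nat)
    then show ?thesis unfolding 1 2 3 W_def
      using n pos by (intro tricomi_U_eq_nn_integral) auto
  qed
  have half_pos: "real n / 2 + real i > 0" for i using n by (simp add: add_pos_nonneg)
  have weight_split: "ennreal (poisson_weight (real n * l) i * poisson_weight (real n * m) j * d) * w =
      ennreal (poisson_weight (real n * l) i) * ennreal (poisson_weight (real n * m) j) * (ennreal d * w)" for i j d w
    using pos by (simp add: ennreal_mult' poisson_weight_nonneg mult.assoc)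
  have "sum_normal_products_pdf n \<mu>X \<mu>Y \<sigma>X \<sigma>Y \<rho> x =
    ereal C * (\<Sum>k. \<Sum>j=0..k. ereal (c k j) * tricomi_U (1 - real n / 2 - real (a_idx j k x)) (2 - real n - real k)
          (2 * \<bar>x\<bar> / (\<sigma>X * \<sigma>Y * (1 - \<rho>\<^sup>2))))"
    unfolding sum_normal_products_pdf_def C_def c_def ..
  also have "\<dots> = ereal C * (\<Sum>k. \<Sum>j=0..k. enn2ereal (ennreal (c k j) * W k j))"
    using c by (simp add: U enn2ereal_mult)
  also have "\<dots> = enn2ereal (ennreal C * (\<Sum>k. \<Sum>j=0..k. ennreal (c k j) * W k j))"
  proof -
    have "(\<Sum>k. \<Sum>j=0..k. enn2ereal (f k j)) = enn2ereal (\<Sum>k. \<Sum>j=0..k. f k j)" for f :: "nat \<Rightarrow> nat \<Rightarrow> ennreal"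
      by simp
    then show ?thesis unfolding enn2ereal_mult[of "ennreal C"] using C by simp
  qed
  also have "ennreal C * (\<Sum>k. \<Sum>j=0..k. ennreal (c k j) * W k j) = (\<Sum>k. \<Sum>j\<le>k. ennreal (C * c k j) * W k j)"
    using C c by (simp add: sum_distrib_left mult.assoc atLeast0AtMost ennreal_mult flip: ennreal_suminf_cmult)
  also have "\<dots> = noncentral_gamma_diff_density (real n / 2) p (real n * l) q (real n * m) x"
  proof (cases "x \<ge> 0")
    case True
    show ?thesis unfolding noncentral_gamma_diff_density_series
    proof (intro suminf_cong sum.cong refl)
      fix k j :: nat assume "j \<in> {..k}"
      then have jk: "j \<le> k" by simp
      have idx: "a_idx j k x = k - j" "b k j = j" using True jk by (simp_all add: a_idx_def b_def)
      \<comment> \<open>At \<open>x = 0\<close>, where \<open>sgn x = 0\<close>, both sides are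
        \<open>0\<close>.\<close>
      have e: "\<bar>x\<bar> / (\<sigma>X * \<sigma>Y * (1 + \<rho> * sgn x)) = p * x" using True by (cases "x = 0") (simp_all add: p_def)
      have "C * c k j = poisson_weight (real n * l) (k - j) * poisson_weight (real n * m) j *
        (p powr (real n / 2 + real (k - j)) * q powr (real n / 2 + real j) / Gamma (real n / 2 + real (k - j)) * exp (- (p * x)) *
         (p + q) powr (1 - (real n / 2 + real (k - j)) - (real n / 2 + real j)))"
        unfolding C_def c_def e idx p_def q_def l_def m_def by (rule series_coefficient[OF s r n jk])
      then show "ennreal (C * c k j) * W k j = ennreal (poisson_weight (real n * l) (k - j)) * ennreal (poisson_weight (real n * m) j) *
        (\<integral>\<^sup>+t. gamma_density (real n / 2 + real (k - j)) p (x + t) * gamma_density (real n / 2 + real j) q t \<partial>lborel)"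
        unfolding W_def idx abs_of_nonneg[OF True]
        using n pos True by (simp only: nn_integral_gamma_density_shift half_pos weight_split)
    qed
  next
    case False
    then have absx: "\<bar>x\<bar> = - x" and neg: "0 \<le> - x" by simp_all
    show ?thesis unfolding noncentral_gamma_diff_density_series_reflected
    proof (intro suminf_cong sum.cong refl)
      fix k j :: nat assume "j \<in> {..k}"
      then have jk: "j \<le> k" by simp
      have idx: "a_idx j k x = j" "b k j = k - j" using False jk by (simp_all add: a_idx_def b_def)
      have e: "\<bar>x\<bar> / (\<sigma>X * \<sigma>Y * (1 + \<rho> * sgn x)) = q * - x" using False by (simp add: q_def)
      have "C * c k j = poisson_weight (real n * l) (k - j) * poisson_weight (real n * m) j *
        (p powr (real n / 2 + real (k - j)) * q powr (real n / 2 + real j) / Gamma (real n / 2 + real j) * exp (- (q * - x)) *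
         (p + q) powr (1 - (real n / 2 + real (k - j)) - (real n / 2 + real j)))"
        unfolding C_def c_def e idx p_def q_def l_def m_def by (rule series_coefficient[OF s r n jk])
      also have "(p + q) powr (1 - (real n / 2 + real (k - j)) - (real n / 2 + real j)) =
         (q + p) powr (1 - (real n / 2 + real j) - (real n / 2 + real (k - j)))"
        by (simp add: algebra_simps)
      also have "p powr (real n / 2 + real (k - j)) * q powr (real n / 2 + real j) = q powr (real n / 2 + real j) * p powr (real n / 2 + real (k - j))"
        by (rule mult.commute)
      finally show "ennreal (C * c k j) * W k j = ennreal (poisson_weight (real n * l) (k - j)) * ennreal (poisson_weight (real n * m) j) *
        (\<integral>\<^sup>+t. gamma_density (real n / 2 + real j) q (- x + t) * gamma_density (real n / 2 + real (k - j)) p t \<partial>lborel)"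
        unfolding W_def idx absx add.commute[of p q]
        using n pos False by (simp only: nn_integral_gamma_density_shift half_pos weight_split neg)
    qed
  qed
  finally show ?thesis .
qed

text \<open>The first two conjuncts guard the reading of the third: \<open>e2ennreal\<close> sends
  negative values to \<open>0\<close>, so nonnegativity shows that nothing is truncated, and
  infinity is taken exactly at the pole \<open>x = 0\<close> for \<open>n = 1\<close>. The copies
  \<open>Z i\<close> live on their own space \<open>M\<close> and are tied to \<open>X\<close> and
  \<open>Y\<close> through their law only.\<close>

theorem theorem2p1:
  fixes N :: "'b measure" and X Y :: "'b \<Rightarrow> real"
    and M :: "'a measure" and Z :: "nat \<Rightarrow> 'a \<Rightarrow> real"
    and \<mu>X \<mu>Y \<sigma>X \<sigma>Y \<rho> :: real and n :: nat
  assumes "prob_space N" and "prob_space M"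
    and "\<sigma>X > 0" and "\<sigma>Y > 0" and "-1 < \<rho>" and "\<rho> < 1" and "n \<ge> 1"
    and "bivariate_normal N X Y \<mu>X \<mu>Y \<sigma>X \<sigma>Y \<rho>"
    and "prob_space.indep_vars M (\<lambda>_. borel) Z {1..n}"
    and "\<And>i. i \<in> {1..n} \<Longrightarrow> distr M borel (Z i) = distr N borel (\<lambda>\<omega>. X \<omega> * Y \<omega>)"
  shows "(\<forall>x. 0 \<le> sum_normal_products_pdf n \<mu>X \<mu>Y \<sigma>X \<sigma>Y \<rho> x) \<and>
    (\<forall>x. sum_normal_products_pdf n \<mu>X \<mu>Y \<sigma>X \<sigma>Y \<rho> x = \<infinity> \<longleftrightarrow> n = 1 \<and> x = 0) \<and>
    distributed M lborel (\<lambda>\<omega>. \<Sum>i=1..n. Z i \<omega>)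
      (\<lambda>x. e2ennreal (sum_normal_products_pdf n \<mu>X \<mu>Y \<sigma>X \<sigma>Y \<rho> x))"
proof -
  interpret M: prob_space M by fact
  define p where "p = 1 / (\<sigma>X * \<sigma>Y * (1 + \<rho>))"
  define q where "q = 1 / (\<sigma>X * \<sigma>Y * (1 - \<rho>))"
  define l where "l = (\<mu>X / \<sigma>X + \<mu>Y / \<sigma>Y)\<^sup>2 / (4 * (1 + \<rho>))"
  define m where "m = (\<mu>X / \<sigma>X - \<mu>Y / \<sigma>Y)\<^sup>2 / (4 * (1 - \<rho>))"
  define F where "F = noncentral_gamma_diff_density (real n / 2) p (real n * l) q (real n * m)"
  have pos: "p > 0" "q > 0" "l \<ge> 0" "m \<ge> 0" using assms(3-6) by (simp_all add: p_def q_def l_def m_def)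
  have pdf: "sum_normal_products_pdf n \<mu>X \<mu>Y \<sigma>X \<sigma>Y \<rho> x = enn2ereal (F x)" for x
    unfolding F_def p_def q_def l_def m_def by (rule sum_normal_products_pdf_eq[OF assms(3-7)])
  have top: "F x = \<top> \<longleftrightarrow> n = 1 \<and> x = 0" for x
  proof (cases "n = 1 \<and> x = 0")
    case True
    then show ?thesis using noncentral_gamma_diff_density_top[OF pos] by (simp add: F_def)
  next
    case False
    then have "F x < \<top>"
      unfolding F_def using assms(7) pos by (intro noncentral_gamma_diff_density_finite) auto
    with False show ?thesis by auto
  qed
  have law: "distr M borel (Z i) = density lborel (noncentral_gamma_diff_density (1/2) p l q m)" if "i \<in> {1..n}" for i
    unfolding assms(10)[OF that] p_def q_def l_def m_def
    by (rule distr_bivariate_normal_product[OF assms(1,3-6,8)])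
  have "distr M borel (\<lambda>\<omega>. \<Sum>i=1..n. Z i \<omega>) = density lborel F"
    using M.distr_sum_noncentral_gamma_diff[OF _ _ assms(9) law] assms(7) pos by (simp add: F_def)
  moreover have "Z i \<in> borel_measurable M" if "i \<in> {1..n}" for i
    using assms(9) that unfolding M.indep_vars_def by auto
  then have "(\<lambda>\<omega>. \<Sum>i=1..n. Z i \<omega>) \<in> borel_measurable M" by measurable
  ultimately have "distributed M lborel (\<lambda>\<omega>. \<Sum>i=1..n. Z i \<omega>) F"
    unfolding distributed_def by (simp add: F_def cong: distr_cong)
  then show ?thesis by (simp add: pdf top)
qed

end
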